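(* Up to equivalence, the projective space $\mathrm{PG}(3,q)$ (with a given symplectic polarity) has exactly $1$ special spread if $q=3$, exactly $2$ special spreads if $q=5$, and exactly $14$ special spreads if $q=7$.
   Context: A symplectic polarity $\zeta$ of $\mathrm{PG}(3,q)$ is a polarity with $x\in x^\zeta$ for every point $x$. The graph $Sp(4,q)$ has the points of $\mathrm{PG}(3,q)$ as vertices, two distinct points $x,y$ being adjacent iff $y\in x^\zeta$ (i.e. $x$ and $y$ are orthogonal). A line $L$ is totally isotropic if $L^\zeta=L$. A spread is a set of lines of $\mathrm{PG}(3,q)$ partitioning its point set. For $q$ odd, a special spread (with respect to $\zeta$) is a spread $S$ consisting of lines that are not totally isotropic such that for every $\ell\in S$ there is a uniquely determined line $\ell'\in S$ such that any point of $\ell$ is orthogonal to any point of $\ell'$ (that is, $\ell'=\ell^\zeta$). Two special spreads are equivalent if there exists an automorphism of the graph $Sp(4,q)$ mapping one of them to the other. *)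

theory Defs
  imports "HOL-Analysis.Cartesian_Space" "HOL-Library.Disjoint_Sets"
begin

text \<open>
  The projective space over the field \<^typ>\<open>'a\<close> is modelled by the lattice of linear subspaces
  of \<^typ>\<open>'a ^ 4\<close>; a subspace of vector space dimension \<open>k + 1\<close> has projective dimension \<open>k\<close>,
  and incidence is inclusion.
\<close>

definition pg_points :: "('a::field ^ 4) set set" where
  "pg_points = {P. vec.subspace P \<and> vec.dim P = 1}"

definition pg_lines :: "('a::field ^ 4) set set" where
  "pg_lines = {L. vec.subspace L \<and> vec.dim L = 2}"

definition points_on :: "('a::field ^ 4) set \<Rightarrow> ('a ^ 4) set set" where
  "points_on U = {P \<in> pg_points. P \<subseteq> U}"

text \<open>The values of \<open>\<zeta>\<close> at sets that are not subspaces are irrelevant.\<close>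

definition polarity :: "(('a::field ^ 4) set \<Rightarrow> ('a ^ 4) set) \<Rightarrow> bool" where
  "polarity \<zeta> \<longleftrightarrow>
     (\<forall>U. vec.subspace U \<longrightarrow> vec.subspace (\<zeta> U) \<and> \<zeta> (\<zeta> U) = U) \<and>
     (\<forall>U W. vec.subspace U \<longrightarrow> vec.subspace W \<longrightarrow> U \<subseteq> W \<longrightarrow> \<zeta> W \<subseteq> \<zeta> U)"

definition symplectic_polarity :: "(('a::field ^ 4) set \<Rightarrow> ('a ^ 4) set) \<Rightarrow> bool" where
  "symplectic_polarity \<zeta> \<longleftrightarrow> polarity \<zeta> \<and> (\<forall>x \<in> pg_points. x \<subseteq> \<zeta> x)"

definition pg_orthogonal ::
    "(('a::field ^ 4) set \<Rightarrow> ('a ^ 4) set) \<Rightarrow> ('a ^ 4) set \<Rightarrow> ('a ^ 4) set \<Rightarrow> bool" where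
  "pg_orthogonal \<zeta> x y \<longleftrightarrow> y \<subseteq> \<zeta> x"

definition Sp4_adj ::
    "(('a::field ^ 4) set \<Rightarrow> ('a ^ 4) set) \<Rightarrow> ('a ^ 4) set \<Rightarrow> ('a ^ 4) set \<Rightarrow> bool" where
  "Sp4_adj \<zeta> x y \<longleftrightarrow>
     x \<in> pg_points \<and> y \<in> pg_points \<and> x \<noteq> y \<and> pg_orthogonal \<zeta> x y"

definition Sp4_automorphism ::
    "(('a::field ^ 4) set \<Rightarrow> ('a ^ 4) set) \<Rightarrow> (('a ^ 4) set \<Rightarrow> ('a ^ 4) set) \<Rightarrow> bool" where
  "Sp4_automorphism \<zeta> g \<longleftrightarrow>
     bij_betw g pg_points pg_points \<and>
     (\<forall>x \<in> pg_points. \<forall>y \<in> pg_points. Sp4_adj \<zeta> (g x) (g y) \<longleftrightarrow> Sp4_adj \<zeta> x y)"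

definition totally_isotropic ::
    "(('a::field ^ 4) set \<Rightarrow> ('a ^ 4) set) \<Rightarrow> ('a ^ 4) set \<Rightarrow> bool" where
  "totally_isotropic \<zeta> L \<longleftrightarrow> \<zeta> L = L"

definition spread :: "('a::field ^ 4) set set \<Rightarrow> bool" where
  "spread S \<longleftrightarrow> S \<subseteq> pg_lines \<and> partition_on pg_points (points_on ` S)"

definition special_spreads ::
    "(('a::field ^ 4) set \<Rightarrow> ('a ^ 4) set) \<Rightarrow> ('a ^ 4) set set set" where
  "special_spreads \<zeta> =
     {S. spread S \<and> (\<forall>l \<in> S. \<not> totally_isotropic \<zeta> l) \<and>
         (\<forall>l \<in> S. \<exists>!l'. l' \<in> S \<and>
            (\<forall>x \<in> points_on l. \<forall>y \<in> points_on l'. pg_orthogonal \<zeta> x y))}"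

text \<open>
  A graph automorphism acts on points only, so it acts on a line through the set of points on
  that line.
\<close>

definition maps_spread ::
    "(('a::field ^ 4) set \<Rightarrow> ('a ^ 4) set) \<Rightarrow> ('a ^ 4) set set \<Rightarrow> ('a ^ 4) set set \<Rightarrow> bool" where
  "maps_spread g S T \<longleftrightarrow> (\<lambda>l. g ` points_on l) ` S = points_on ` T"

definition special_spread_equiv ::
    "(('a::field ^ 4) set \<Rightarrow> ('a ^ 4) set) \<Rightarrow> ('a ^ 4) set set rel" where
  "special_spread_equiv \<zeta> =
     {(S, T). S \<in> special_spreads \<zeta> \<and> T \<in> special_spreads \<zeta> \<and>
              (\<exists>g. Sp4_automorphism \<zeta> g \<and> maps_spread g S T)}"

lemma Sp4_automorphism_inv:
  assumes "Sp4_automorphism \<zeta> g"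
  shows "Sp4_automorphism \<zeta> (inv_into pg_points g)"
proof -
  let ?h = "inv_into pg_points g"
  have b: "bij_betw g pg_points pg_points"
    and adj: "\<And>x y. x \<in> pg_points \<Longrightarrow> y \<in> pg_points \<Longrightarrow>
                Sp4_adj \<zeta> (g x) (g y) \<longleftrightarrow> Sp4_adj \<zeta> x y"
    using assms by (auto simp: Sp4_automorphism_def)
  have bh: "bij_betw ?h pg_points pg_points" by (rule bij_betw_inv_into[OF b])
  have "Sp4_adj \<zeta> (?h x) (?h y) \<longleftrightarrow> Sp4_adj \<zeta> x y"
    if "x \<in> pg_points" "y \<in> pg_points" for x y
    using adj[of "?h x" "?h y"] that bij_betwE[OF bh] bij_betw_inv_into_right[OF b] by simp
  with bh show ?thesis by (simp add: Sp4_automorphism_def)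
qed

lemma Sp4_automorphism_comp:
  assumes "Sp4_automorphism \<zeta> g" "Sp4_automorphism \<zeta> h"
  shows "Sp4_automorphism \<zeta> (h \<circ> g)"
  using assms bij_betw_trans[of g pg_points pg_points h pg_points]
  unfolding Sp4_automorphism_def by (auto dest: bij_betwE)

lemma equiv_special_spread_equiv: "equiv (special_spreads \<zeta>) (special_spread_equiv \<zeta>)"
proof (rule equivI)
  show "special_spread_equiv \<zeta> \<subseteq> special_spreads \<zeta> \<times> special_spreads \<zeta>"
    by (auto simp: special_spread_equiv_def)
  have "Sp4_automorphism \<zeta> id" by (simp add: Sp4_automorphism_def)
  moreover have "maps_spread id S S" for S :: "('a ^ 4) set set" by (simp add: maps_spread_def)
  ultimately show "refl_on (special_spreads \<zeta>) (special_spread_equiv \<zeta>)"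
    unfolding refl_on_def special_spread_equiv_def by blast
  show "sym (special_spread_equiv \<zeta>)"
  proof (rule symI)
    fix S T assume "(S, T) \<in> special_spread_equiv \<zeta>"
    then obtain g where ST: "S \<in> special_spreads \<zeta>" "T \<in> special_spreads \<zeta>"
      and g: "Sp4_automorphism \<zeta> g" and m: "maps_spread g S T"
      by (auto simp: special_spread_equiv_def)
    let ?h = "inv_into pg_points g"
    have b: "bij_betw g pg_points pg_points" using g by (simp add: Sp4_automorphism_def)
    have "?h ` g ` points_on l = points_on l" for l
      using b by (intro inv_into_image_cancel) (auto simp: bij_betw_def points_on_def)
    then have "points_on ` S = (\<lambda>A. ?h ` A) ` (\<lambda>l. g ` points_on l) ` S"
      by (simp add: image_image)
    also have "\<dots> = (\<lambda>l. ?h ` points_on l) ` T"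
      using m by (simp add: maps_spread_def image_image)
    finally have "maps_spread ?h T S" by (simp add: maps_spread_def)
    with ST Sp4_automorphism_inv[OF g] show "(T, S) \<in> special_spread_equiv \<zeta>"
      by (auto simp: special_spread_equiv_def)
  qed
  show "trans (special_spread_equiv \<zeta>)"
  proof (rule transI)
    fix S T U assume "(S, T) \<in> special_spread_equiv \<zeta>" "(T, U) \<in> special_spread_equiv \<zeta>"
    then obtain g h where SU: "S \<in> special_spreads \<zeta>" "U \<in> special_spreads \<zeta>"
      and g: "Sp4_automorphism \<zeta> g" "maps_spread g S T"
      and h: "Sp4_automorphism \<zeta> h" "maps_spread h T U"
      by (auto simp: special_spread_equiv_def)
    have "(\<lambda>l. (h \<circ> g) ` points_on l) ` S = (\<lambda>A. h ` A) ` (\<lambda>l. g ` points_on l) ` S"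
      by (simp add: image_image image_comp)
    also have "\<dots> = points_on ` U"
      using g h by (simp add: maps_spread_def image_image)
    finally have "maps_spread (h \<circ> g) S U" by (simp add: maps_spread_def)
    with SU Sp4_automorphism_comp[OF g(1) h(1)] show "(S, U) \<in> special_spread_equiv \<zeta>"
      by (auto simp: special_spread_equiv_def)
  qed
qed

end

theory Submission
  imports Defs
begin

text \<open>
  Choose coordinates in which the polarity is the standard symplectic form. The self-adjoint
  trace-free operators form a five-dimensional space on which squaring is a quadratic form
  \<open>Q\<close>: \<open>u\<^sup>2 = Q(u)\<close> and \<open>u v + v u = B(u, v)\<close>. The lines that are not totally isotropic are
  the \<open>1\<close>-eigenspaces of the vectors with \<open>Q(u) = 1\<close>, and \<open>u \<mapsto> - u\<close> is the polarity.
  So a special spread is a set of \<open>(q\<^sup>2 + 1) / 2\<close> pairs \<open>\<plusminus> u\<close> of unit vectors with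
  \<open>B(u, v) \<noteq> \<plusminus> 2\<close> for distinct pairs, and a nonsingular \<open>w\<close>, being a similitude, acts on these
  sets by a reflection. A backtracking search over the points to be covered, in which
  configurations are identified by products of reflections, shows that every such set is a
  reflection image of a listed one. The listed sets are inequivalent because the number of
  pairs with \<open>B(u, v) = 0\<close> is an invariant of graph automorphisms: \<open>B(u, v) = 0\<close> holds iff some
  automorphism fixes the points of the line of \<open>u\<close> and of its polar line, and exchanges the line
  of \<open>v\<close> with its polar line.
\<close>

section \<open>The certified search\<close>

text \<open>Geometrically this is the Klein correspondence cut down by the polarity: the pairs of
  mutually polar non-isotropic lines are points of PG(4,q) off a parabolic quadric, and
  \<open>B(u, v) = +-2\<close> says that the join of two such points is tangent to it. One bilinear
  condition thus expresses that four lines are disjoint, and covering follows by counting, since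
  (q^2 + 1)(q^2 - 1) = q^4 - 1. Two obstacles shape the proof. Equivalence admits arbitrary
  automorphisms of the point graph, which are not given as linear maps. Hence spreads are identified
  only by explicit automorphisms, the reflections, while they are told apart by a relation between
  lines that is phrased in the graph itself, by quantifying over its automorphisms. That the
  resulting numbers separate all listed sets is a fact of computation. Moreover the polarity is
  given merely as an inclusion-reversing involution, so the alternating form has to be built from
  the orthogonality of points. Branching over a point keeps the search small: q^2 pairs of lines
  cover it, and at the root reflections identify all of them.\<close>

text \<open>
  The search is evaluated by the simplifier. Its functions are defined by pattern matching on
  evaluated arguments rather than with conditionals, and candidates are kept in trees, since
  rewriting with long lists takes quadratic time.
\<close>

datatype 'a vec5 = V 'a 'a 'a 'a 'a
datatype 'a tree = Tip | Elem 'a | Node "'a tree" "'a tree"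

section \<open>The quadratic form, its polar form and reflections in coordinates\<close>

fun quad :: "'a::field vec5 \<Rightarrow> 'a" where
  "quad (V a b c d e) = a * a + b * c + d * e"
text \<open>The functional B(u, -) as a coordinate vector. It is computed once per chosen vector,
  after which each comparison with a candidate is a dot product.\<close>

fun dual :: "'a::field vec5 \<Rightarrow> 'a vec5" where
  "dual (V a b c d e) = V (a + a) c b e d"
fun pairing :: "'a::field vec5 \<Rightarrow> 'a vec5 \<Rightarrow> 'a" where
  "pairing (V a b c d e) (V a' b' c' d' e') = a * a' + b * b' + c * c' + d * d' + e * e'"
definition polar :: "'a::field vec5 \<Rightarrow> 'a vec5 \<Rightarrow> 'a" where
  "polar u v = pairing (dual u) v"
fun neg :: "'a::field vec5 \<Rightarrow> 'a vec5" where
  "neg (V a b c d e) = V (- a) (- b) (- c) (- d) (- e)"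
fun reflected :: "'a::field \<Rightarrow> 'a vec5 \<Rightarrow> 'a vec5 \<Rightarrow> 'a vec5" where
  "reflected t (V a b c d e) (V a' b' c' d' e') =
     V (t * a + - a') (t * b + - b') (t * c + - c') (t * d + - d') (t * e + - e')"
text \<open>For nonsingular w this is the conjugation of u by w in the Clifford algebra. It fixes w
  and negates the orthogonal space of w, so it is the negative of the usual reflection and agrees
  with it on pairs \<open>+-u\<close>.\<close>

definition reflect :: "'a::field vec5 \<Rightarrow> 'a vec5 \<Rightarrow> 'a vec5" where
  "reflect w u = reflected (polar w u * inverse (quad w)) w u"

text \<open>Both predicates are kept opaque during evaluation: they are decided by one rule per
  field element, such as \<open>isz7\<close> and \<open>bad7\<close>.\<close>

definition is_zero :: "'a::field \<Rightarrow> bool" where "is_zero x = (x = 0)"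
definition is_pm_two :: "'a::field \<Rightarrow> bool" where "is_pm_two x = (x = 2 \<or> x = - 2)"

text \<open>
  A vector is written as a number whose octal digits, after a leading one, are its coordinates.
\<close>

fun digits :: "num \<Rightarrow> 'a::field list" where
  "digits (num.Bit0 (num.Bit0 (num.Bit0 n))) = 0 # digits n"
| "digits (num.Bit1 (num.Bit0 (num.Bit0 n))) = 1 # digits n"
| "digits (num.Bit0 (num.Bit1 (num.Bit0 n))) = 2 # digits n"
| "digits (num.Bit1 (num.Bit1 (num.Bit0 n))) = 3 # digits n"
| "digits (num.Bit0 (num.Bit0 (num.Bit1 n))) = 4 # digits n"
| "digits (num.Bit1 (num.Bit0 (num.Bit1 n))) = 5 # digits n"
| "digits (num.Bit0 (num.Bit1 (num.Bit1 n))) = 6 # digits n"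
| "digits n = []"

text \<open>The coordinates come in reverse because \<open>digits\<close> starts with the last
  digit. A malformed number yields the zero vector, which is rejected by \<open>nonsingular\<close>
  and by \<open>separated\<close>; likewise the zero point is rejected by
  \<open>nonzero\<close>.\<close>

fun vec5_of :: "'a::field list \<Rightarrow> 'a vec5" where
  "vec5_of [e, d, c, b, a] = V a b c d e"
| "vec5_of _ = V 0 0 0 0 0"
definition decode_vec :: "nat \<Rightarrow> 'a::field vec5" where "decode_vec k = vec5_of (digits (num_of_nat k))"
datatype 'a vec4 = Pt 'a 'a 'a 'a
fun vec4_of :: "'a::field list \<Rightarrow> 'a vec4" where
  "vec4_of [d, c, b, a] = Pt a b c d"
| "vec4_of _ = Pt 0 0 0 0"
definition decode_point :: "nat \<Rightarrow> 'a::field vec4" where "decode_point k = vec4_of (digits (num_of_nat k))"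

lemma decode_vec_numeral: "decode_vec (numeral n) = vec5_of (digits n)"
  by (simp add: decode_vec_def num_of_nat_numeral_eq)
lemma decode_point_numeral: "decode_point (numeral n) = vec4_of (digits n)"
  by (simp add: decode_point_def num_of_nat_numeral_eq)

fun neg4 :: "'a::field vec4 \<Rightarrow> 'a vec4" where
  "neg4 (Pt a b c d) = Pt (- a) (- b) (- c) (- d)"
fun nonzero :: "'a::field vec4 \<Rightarrow> bool" where
  "nonzero (Pt a b c d) = (\<not> (is_zero a \<and> is_zero b \<and> is_zero c \<and> is_zero d))"
text \<open>The chain from \<open>sends1\<close> to \<open>sends4\<close> tests
  \<open>clif u x = - y\<close> one coordinate at a time. The Boolean is the verdict on the
  preceding coordinate, so that a failure ends the test at once.\<close>

fun sends4 :: "bool \<Rightarrow> 'a::field vec5 \<Rightarrow> 'a vec4 \<Rightarrow> 'a vec4 \<Rightarrow> bool" where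
  "sends4 False u x y = False"
| "sends4 True (V a b c d e) (Pt x1 x2 x3 x4) (Pt y1 y2 y3 y4) = is_zero (e * x1 + b * x2 + - (a * x4) + y4)"
fun sends3 :: "bool \<Rightarrow> 'a::field vec5 \<Rightarrow> 'a vec4 \<Rightarrow> 'a vec4 \<Rightarrow> bool" where
  "sends3 False u x y = False"
| "sends3 True (V a b c d e) (Pt x1 x2 x3 x4) (Pt y1 y2 y3 y4) =
     sends4 (is_zero (c * x1 + - (d * x2) + - (a * x3) + y3)) (V a b c d e) (Pt x1 x2 x3 x4) (Pt y1 y2 y3 y4)"
fun sends2 :: "bool \<Rightarrow> 'a::field vec5 \<Rightarrow> 'a vec4 \<Rightarrow> 'a vec4 \<Rightarrow> bool" where
  "sends2 False u x y = False"
| "sends2 True (V a b c d e) (Pt x1 x2 x3 x4) (Pt y1 y2 y3 y4) =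
     sends3 (is_zero (a * x2 + - (e * x3) + c * x4 + y2)) (V a b c d e) (Pt x1 x2 x3 x4) (Pt y1 y2 y3 y4)"
fun sends1 :: "'a::field vec5 \<Rightarrow> 'a vec4 \<Rightarrow> 'a vec4 \<Rightarrow> bool" where
  "sends1 (V a b c d e) (Pt x1 x2 x3 x4) (Pt y1 y2 y3 y4) =
     sends2 (is_zero (a * x1 + b * x3 + d * x4 + y1)) (V a b c d e) (Pt x1 x2 x3 x4) (Pt y1 y2 y3 y4)"

section \<open>Candidate sets and the tests made by a certificate\<close>

fun join :: "'a tree \<Rightarrow> 'a tree \<Rightarrow> 'a tree" where
  "join Tip t = t"
| "join (Elem v) Tip = Elem v"
| "join (Elem v) (Elem w) = Node (Elem v) (Elem w)"
| "join (Elem v) (Node s t) = Node (Elem v) (Node s t)"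
| "join (Node s t) Tip = Node s t"
| "join (Node s t) (Elem v) = Node (Node s t) (Elem v)"
| "join (Node s t) (Node s' t') = Node (Node s t) (Node s' t')"

fun elem_unless :: "bool \<Rightarrow> 'a \<Rightarrow> 'a tree" where
  "elem_unless True v = Tip"
| "elem_unless False v = Elem v"
text \<open>Testing both signs of 2 makes one vector of each pair \<open>+-v\<close> sufficient. The
  chosen vector u drops out of the candidates as well, since B(u, u) = 2.\<close>

fun compatible :: "'a::field vec5 \<Rightarrow> 'a vec5 tree \<Rightarrow> 'a vec5 tree" where
  "compatible f Tip = Tip"
| "compatible f (Elem v) = elem_unless (is_pm_two (pairing f v)) v"
| "compatible f (Node s t) = join (compatible f s) (compatible f t)"

fun cons_if :: "bool \<Rightarrow> 'a \<Rightarrow> 'a list \<Rightarrow> 'a list" where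
  "cons_if True v acc = v # acc"
| "cons_if False v acc = acc"
fun covering :: "'a::field vec4 \<Rightarrow> 'a vec4 \<Rightarrow> 'a vec5 tree \<Rightarrow> 'a vec5 list \<Rightarrow> 'a vec5 list" where
  "covering x y Tip acc = acc"
| "covering x y (Elem v) acc = cons_if (sends1 v x y \<or> sends1 v x x) v acc"
| "covering x y (Node s t) acc = covering x y s (covering x y t acc)"
text \<open>A branching point might lie on a line chosen earlier, so the chosen vectors have to be
  offered as branches too.\<close>

fun covering_in :: "'a::field vec4 \<Rightarrow> 'a vec4 \<Rightarrow> 'a vec5 list \<Rightarrow> 'a vec5 list" where
  "covering_in x y [] = []"
| "covering_in x y (v # vs) = cons_if (sends1 v x y \<or> sends1 v x x) v (covering_in x y vs)"

fun lists_eq :: "bool \<Rightarrow> 'a list \<Rightarrow> 'a list \<Rightarrow> bool" where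
  "lists_eq True (x # xs) (y # ys) = lists_eq (x = y) xs ys"
| "lists_eq b [] [] = b"
| "lists_eq _ _ _ = False"
fun vec5_eq :: "'a vec5 \<Rightarrow> 'a vec5 \<Rightarrow> bool" where
  "vec5_eq (V a b c d e) (V a' b' c' d' e') = lists_eq (a = a') [b, c, d, e] [b', c', d', e']"
fun member_or :: "bool \<Rightarrow> 'a vec5 \<Rightarrow> 'a vec5 list \<Rightarrow> bool" where
  "member_or True u rs = True"
| "member_or False u [] = False"
| "member_or False u (r # rs) = member_or (vec5_eq u r) u rs"
definition member_pm :: "'a::field vec5 \<Rightarrow> 'a vec5 list \<Rightarrow> bool" where
  "member_pm u rs = member_or (member_or False u rs) (neg u) rs"

fun reflects :: "nat list \<Rightarrow> 'a::field vec5 \<Rightarrow> 'a vec5" where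
  "reflects [] u = u"
| "reflects (w # ws) u = reflects ws (reflect (decode_vec w) u)"
fun nonsingular :: "'a::field itself \<Rightarrow> nat list \<Rightarrow> bool" where
  "nonsingular ty [] = True"
| "nonsingular ty (w # ws) = (\<not> is_zero (quad (decode_vec w :: 'a vec5)) \<and> nonsingular ty ws)"

text \<open>Indices start at one. As \<open>Num.BitM n\<close> is 2n - 1, both recursive equations
  lower the index by one.\<close>

fun lookup :: "num \<Rightarrow> 'b list \<Rightarrow> 'b option" where
  "lookup n [] = None"
| "lookup num.One (x # xs) = Some x"
| "lookup (num.Bit0 n) (x # xs) = lookup (Num.BitM n) xs"
| "lookup (num.Bit1 n) (x # xs) = lookup (num.Bit0 n) xs"

fun list_into :: "nat list \<Rightarrow> 'a::field vec5 list \<Rightarrow> 'a vec5 list \<Rightarrow> bool" where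
  "list_into ws [] rs = True"
| "list_into ws (u # us) rs = (member_pm (reflects ws u) rs \<and> list_into ws us rs)"
fun tree_into :: "nat list \<Rightarrow> 'a::field vec5 tree \<Rightarrow> 'a vec5 list \<Rightarrow> bool" where
  "tree_into ws Tip rs = True"
| "tree_into ws (Elem u) rs = member_pm (reflects ws u) rs"
| "tree_into ws (Node s t) rs = (tree_into ws s rs \<and> tree_into ws t rs)"

text \<open>The earlier configuration need only be carried into the current one, up to signs: a
  special set containing the current one then pulls back to a special set containing the earlier
  one.\<close>

fun known_ok :: "'a::field vec5 list option \<Rightarrow> nat list \<Rightarrow> 'a vec5 list \<Rightarrow> bool" where
  "known_ok None ws cs = False"
| "known_ok (Some h) ws cs = (nonsingular TYPE('a) ws \<and> list_into ws h cs)"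
text \<open>Chosen vectors and remaining candidates alike must land in the representative. Every
  special set still possible then has its image inside it, and between special sets inclusion is
  equality.\<close>

fun leaf :: "'a::field vec5 list option \<Rightarrow> nat list \<Rightarrow> 'a vec5 list \<Rightarrow> 'a vec5 tree \<Rightarrow> bool" where
  "leaf None ws cs t = False"
| "leaf (Some r) ws cs t = (nonsingular TYPE('a) ws \<and> list_into ws cs r \<and> tree_into ws t r)"

definition lookup_nat :: "nat \<Rightarrow> 'b list \<Rightarrow> 'b option" where
  "lookup_nat k xs = lookup (num_of_nat k) xs"
lemma lookup_nat_numeral: "lookup_nat (numeral n) xs = lookup n xs" "lookup_nat 1 xs = lookup num.One xs"
  by (simp_all add: lookup_nat_def num_of_nat_numeral_eq num_of_nat.simps(1) flip: numeral_One)

text \<open>Marks the only place where the list of representatives is to be unfolded.\<close>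

definition deferred :: "'b \<Rightarrow> 'b" where "deferred x = x"

text \<open>
  \<open>Br p\<close> branches over the candidates whose line or polar line contains the point \<open>p\<close>.
  \<open>Leaf\<close> and \<open>Sx\<close> carry reflections into, respectively, a representative and from an earlier
  configuration marked by \<open>Rec\<close>; the latter are numbered backwards from the latest.
\<close>

datatype cert = Br nat certs | Leaf "nat list" nat | Rec cert
and certs = Dn | Nx cert certs | Sx "nat list" nat certs

fun guard :: "bool \<Rightarrow> 'b \<Rightarrow> 'b option" where
  "guard True x = Some x" | "guard False x = None"
fun recorded :: "'b \<Rightarrow> 'b list option \<Rightarrow> 'b list option" where
  "recorded c None = None" | "recorded c (Some h) = Some (c # h)"

text \<open>The value is the extended history of settled configurations, or \<open>None\<close> on
  failure. Since \<open>Rec\<close> adds a configuration only after its own subtree has been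
  checked, an \<open>Sx\<close> can never refer to a claim that is still open.\<close>

primrec check :: "'a::field vec5 list list \<Rightarrow> 'a vec5 list list \<Rightarrow> 'a vec5 list \<Rightarrow> 'a vec5 tree \<Rightarrow>
    cert \<Rightarrow> 'a vec5 list list option"
  and check_all :: "'a::field vec5 list list \<Rightarrow> 'a vec5 list list option \<Rightarrow> 'a vec5 list \<Rightarrow> 'a vec5 tree \<Rightarrow>
    'a vec5 list \<Rightarrow> certs \<Rightarrow> 'a vec5 list list option" where
  "check R H cs T (Br p c) = check_all R (guard (nonzero (decode_point p :: 'a vec4)) H) cs T
     (covering (decode_point p) (neg4 (decode_point p)) T (covering_in (decode_point p) (neg4 (decode_point p)) cs)) c"
| "check R H cs T (Leaf ws j) = guard (leaf (lookup_nat j (deferred R)) ws cs T) H"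
| "check R H cs T (Rec c) = recorded cs (check R H cs T c)"
| "check_all R H cs T os Dn = (case os of [] \<Rightarrow> H | _ \<Rightarrow> None)"
| "check_all R H cs T os (Nx c c') = (case H of None \<Rightarrow> None | Some h \<Rightarrow>
     (case os of [] \<Rightarrow> None | u # us \<Rightarrow> check_all R (check R h (u # cs) (compatible (dual u) T) c) cs T us c'))"
| "check_all R H cs T os (Sx ws j c) = (case H of None \<Rightarrow> None | Some h \<Rightarrow>
     (case os of [] \<Rightarrow> None | u # us \<Rightarrow> check_all R (guard (known_ok (lookup_nat j h) ws (u # cs)) h) cs T us c))"

text \<open>With the history in the form \<open>Some h\<close>, a branch is evaluated completely
  before the next one is unfolded.\<close>

lemma check_all_simps:
  "check_all R H cs T [] Dn = H"
  "check_all R (Some h) cs T (u # us) (Nx c c') = check_all R (check R h (u # cs) (compatible (dual u) T) c) cs T us c'"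
  "check_all R (Some h) cs T (u # us) (Sx ws j c') = check_all R (guard (known_ok (lookup_nat j h) ws (u # cs)) h) cs T us c'"
  by simp_all

section \<open>Enumeration of the unit vectors up to sign\<close>

fun elem_if :: "bool \<Rightarrow> 'a \<Rightarrow> 'a tree" where
  "elem_if True v = Elem v"
| "elem_if False v = Tip"
text \<open>The list \<open>p\<close> holds the coordinates fixed so far, the latest one first, in
  the order expected by \<open>vec5_of\<close>.\<close>

fun grid :: "'a::field list \<Rightarrow> 'a list list \<Rightarrow> 'a vec5 tree"
  and grid_first :: "'a::field list \<Rightarrow> 'a list \<Rightarrow> 'a list list \<Rightarrow> 'a vec5 tree" where
  "grid p [] = elem_if (is_zero (quad (vec5_of p) + - 1)) (vec5_of p)"
| "grid p (xs # xss) = grid_first p xs xss"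
| "grid_first p [] xss = Tip"
| "grid_first p (x # xs) xss = join (grid (x # p) xss) (grid_first p xs xss)"
text \<open>The first nonzero coordinate is taken from \<open>hf\<close>. If \<open>hf\<close>
  contains one of x and -x for each nonzero x, one vector of every pair \<open>+-u\<close> is
  listed.\<close>

definition all_units :: "'a::field list \<Rightarrow> 'a list \<Rightarrow> 'a vec5 tree" where
  "all_units hf es = join (grid [] [hf, es, es, es, es]) (join (grid [0] [hf, es, es, es])
     (join (grid [0, 0] [hf, es, es]) (join (grid [0, 0, 0] [hf, es]) (grid [0, 0, 0, 0] [hf]))))"

fun isSome :: "'b option \<Rightarrow> bool" where "isSome None = False" | "isSome (Some x) = True"

lemmas eval_rules = quad.simps dual.simps pairing.simps polar_def neg.simps reflected.simps
  reflect_def digits.simps vec5_of.simps decode_vec_numeral decode_point_numeral vec4_of.simps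
  neg4.simps nonzero.simps sends4.simps sends3.simps sends2.simps sends1.simps join.simps
  elem_unless.simps compatible.simps cons_if.simps covering.simps covering_in.simps lists_eq.simps
  vec5_eq.simps member_or.simps member_pm_def reflects.simps nonsingular.simps lookup.simps
  Num.BitM.simps list_into.simps tree_into.simps known_ok.simps leaf.simps lookup_nat_numeral
  guard.simps recorded.simps check.simps check_all_simps elem_if.simps grid.simps grid_first.simps
  all_units_def isSome.simps simp_thms

section \<open>The Clifford model of the hyperbolic lines\<close>

lemma [simp]:
  "(vector [w, x, y, z] :: 'a::zero ^ 4) $ 1 = w"
  "(vector [w, x, y, z] :: 'a::zero ^ 4) $ 2 = x"
  "(vector [w, x, y, z] :: 'a::zero ^ 4) $ 3 = y"
  "(vector [w, x, y, z] :: 'a::zero ^ 4) $ 4 = z"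
  by (simp_all add: vector_def)

definition sform :: "'a::field ^ 4 \<Rightarrow> 'a ^ 4 \<Rightarrow> 'a" where
  "sform x y = x$1 * y$2 - x$2 * y$1 + x$3 * y$4 - x$4 * y$3"

text \<open>
  In block form the operator is \<open>((a, M), (adj M, - a))\<close> with \<open>M = ((b, d), (- e, c))\<close>, so its
  square is \<open>a\<^sup>2 + det M\<close>.
\<close>

fun clif :: "'a::field vec5 \<Rightarrow> 'a ^ 4 \<Rightarrow> 'a ^ 4" where
  "clif (V a b c d e) x = vector
     [a * x$1 + b * x$3 + d * x$4, a * x$2 - e * x$3 + c * x$4,
      c * x$1 - d * x$2 - a * x$3, e * x$1 + b * x$2 - a * x$4]"

lemma polar_V: "polar (V a b c d e) (V a' b' c' d' e') =
    2 * a * a' + c * b' + b * c' + e * d' + d * e'"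
  by (simp add: polar_def algebra_simps)

lemma clif_add: "clif u (x + y) = clif u x + clif u y"
  by (cases u) (simp add: vec_eq_iff forall_4 algebra_simps)
lemma clif_smult: "clif u (c *s x) = c *s clif u x"
  by (cases u) (simp add: vec_eq_iff forall_4 algebra_simps)
lemma clif_zero [simp]: "clif u 0 = 0"
  using clif_smult[of u 0 0] by simp
lemma clif_minus: "clif u (- x) = - clif u x"
  using clif_smult[of u "- 1" x] by simp
lemma clif_diff: "clif u (x - y) = clif u x - clif u y"
  using clif_add[of u x "- y"] by (simp add: clif_minus)
lemma clif_neg: "clif (neg u) x = - clif u x"
  by (cases u) (simp add: vec_eq_iff forall_4 algebra_simps)
lemma clif_reflected: "clif (reflected t w u) x = t *s clif w x - clif u x"
  by (cases u; cases w) (simp add: vec_eq_iff forall_4 algebra_simps)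
lemma clif_anti: "clif u (clif v x) + clif v (clif u x) = polar u v *s x"
  by (cases u; cases v) (simp add: vec_eq_iff forall_4 polar_V algebra_simps)
lemma clif_sq: "clif u (clif u x) = quad u *s x"
  by (cases u) (simp add: vec_eq_iff forall_4 algebra_simps)
lemma sform_clif: "sform (clif u x) y = sform x (clif u y)"
  by (cases u) (simp add: sform_def algebra_simps)
lemma sform_clif_clif: "sform (clif w x) (clif w y) = quad w * sform x y"
  by (cases w) (simp add: sform_def algebra_simps)

lemma clif_inject:
  assumes "\<And>x. clif u x = clif v x"
  shows "u = v"
proof -
  obtain a b c d e where u: "u = V a b c d e" by (cases u)
  obtain a' b' c' d' e' where v: "v = V a' b' c' d' e'" by (cases v)
  \<comment> \<open>Columns one, three and four of the matrix of \<open>clif u\<close> contain all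
    five coordinates of u.\<close>
  show ?thesis
    using assms[of "axis 1 1"] assms[of "axis 3 1"] assms[of "axis 4 1"]
    by (simp add: u v vec_eq_iff forall_4 axis_def)
qed

lemma neg_neg [simp]: "neg (neg u) = u" by (cases u) simp
lemma polar_sym: "polar u v = polar v u" by (cases u; cases v) (simp add: polar_V algebra_simps)
lemma polar_self: "polar u u = 2 * quad u" by (cases u) (simp add: polar_V algebra_simps)
lemma polar_neg: "polar (neg u) v = - polar u v" by (cases u; cases v) (simp add: polar_V algebra_simps)
lemma polar_neg': "polar v (neg u) = - polar v u" by (cases u; cases v) (simp add: polar_V algebra_simps)
lemma quad_neg [simp]: "quad (neg u) = quad u" by (cases u) simp
lemma polar_reflected: "polar v (reflected t w u) = t * polar v w - polar v u"
  by (cases u; cases v; cases w) (simp add: polar_V algebra_simps)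
lemma quad_reflected: "quad (reflected t w u) = t * t * quad w - t * polar w u + quad u"
  by (cases u; cases w) (simp add: polar_V algebra_simps)
lemma reflected_reflected: "reflected t w (reflected t w u) = u"
  by (cases u; cases w) simp
lemma reflected_neg: "reflected (- t) w (neg u) = neg (reflected t w u)"
  by (cases u; cases w) simp

lemma quad_reflect: assumes "quad w \<noteq> 0" shows "quad (reflect w u) = quad u"
  using assms by (simp add: reflect_def quad_reflected)
lemma reflect_reflect: assumes "quad w \<noteq> 0" shows "reflect w (reflect w u) = u"
proof -
  have "polar w (reflect w u) = polar w u"
    using assms by (simp add: reflect_def polar_reflected polar_self)
  then show ?thesis unfolding reflect_def[of w "reflect w u"] by (simp add: reflect_def reflected_reflected)
qed
lemma reflect_neg: "reflect w (neg u) = neg (reflect w u)"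
  using reflected_neg by (simp add: reflect_def polar_neg')
text \<open>This expresses \<open>reflect w u\<close> as the conjugate of u by w; consequently w
  carries the eigenspaces of u to those of the conjugate.\<close>

lemma clif_reflect: assumes "quad w \<noteq> 0" shows "clif (reflect w u) (clif w x) = clif w (clif u x)"
  using assms clif_anti[of w u x]
  by (simp add: reflect_def clif_reflected clif_sq eq_diff_eq[symmetric])

lemma clif_neq0: assumes "quad w \<noteq> 0" "x \<noteq> 0" shows "clif w x \<noteq> 0"
proof
  assume "clif w x = 0"
  then have "quad w *s x = 0" by (metis clif_sq clif_zero)
  with assms show False by (simp add: vector_mul_eq_0)
qed

text \<open>The vector form of a special spread: closure under \<open>neg\<close> supplies the polar
  partner of each line, and unique existence says that the 1-eigenspaces partition the
  points.\<close>

definition special :: "'a::field vec5 set \<Rightarrow> bool" where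
  "special X \<longleftrightarrow> (\<forall>u\<in>X. quad u = 1 \<and> neg u \<in> X) \<and> (\<forall>x. x \<noteq> 0 \<longrightarrow> (\<exists>!u. u \<in> X \<and> clif u x = x))"

lemma special_quad: "special X \<Longrightarrow> u \<in> X \<Longrightarrow> quad u = 1" by (simp add: special_def)
lemma special_neg: "special X \<Longrightarrow> neg u \<in> X \<longleftrightarrow> u \<in> X"
  by (metis special_def neg_neg)
lemma special_unique:
  "special X \<Longrightarrow> u \<in> X \<Longrightarrow> v \<in> X \<Longrightarrow> clif u x = x \<Longrightarrow> clif v x = x \<Longrightarrow> x \<noteq> 0 \<Longrightarrow> u = v"
  unfolding special_def by blast
lemma special_cover: "special X \<Longrightarrow> x \<noteq> 0 \<Longrightarrow> \<exists>u\<in>X. clif u x = x"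
  unfolding special_def by blast

lemma special_reflect:
  assumes X: "special X" and w: "quad w \<noteq> 0"
  shows "special (reflect w ` X)"
  unfolding special_def
proof (intro conjI allI ballI impI)
  fix u assume "u \<in> reflect w ` X"
  then show "quad u = 1" "neg u \<in> reflect w ` X"
    using special_quad[OF X] special_neg[OF X] by (auto simp: quad_reflect[OF w] reflect_neg[symmetric])
next
  fix x :: "'a ^ 4" assume x: "x \<noteq> 0"
  let ?y = "clif w x"
  have *: "clif (reflect w u) x = x \<longleftrightarrow> clif u ?y = ?y" for u
  proof
    assume "clif (reflect w u) x = x"
    then show "clif u ?y = ?y" using clif_reflect[OF w, of "reflect w u" x] by (simp add: reflect_reflect[OF w])
  next
    assume "clif u ?y = ?y"
    then have "clif (reflect w u) (clif w ?y) = clif w ?y" by (simp add: clif_reflect[OF w])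
    then have "quad w *s clif (reflect w u) x = quad w *s x" by (simp add: clif_sq clif_smult)
    with w show "clif (reflect w u) x = x" by simp
  qed
  have y0: "?y \<noteq> 0" by (rule clif_neq0[OF w x])
  obtain u where u: "u \<in> X" "clif u ?y = ?y" using special_cover[OF X y0] by blast
  show "\<exists>!u. u \<in> reflect w ` X \<and> clif u x = x"
  proof (rule ex1I[of _ "reflect w u"])
    show "reflect w u \<in> reflect w ` X \<and> clif (reflect w u) x = x" using u by (simp add: *)
    fix v assume "v \<in> reflect w ` X \<and> clif v x = x"
    then obtain v' where "v' \<in> X" "v = reflect w v'" "clif v' ?y = ?y" using * by blast
    then show "v = reflect w u" using special_unique[OF X u(1) _ u(2) _ y0] by blast
  qed
qed

text \<open>If \<open>B(u, v) = 2\<close> then \<open>u - v\<close> is nilpotent and its kernel contains a common eigenvector.\<close>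

lemma special_polar:
  assumes X: "special X" and u: "u \<in> X" and v: "v \<in> X" and ne: "v \<noteq> u" "v \<noteq> neg u"
  shows "polar u v \<noteq> 2" "polar u v \<noteq> - 2"
proof -
  have main: "polar u v \<noteq> 2" if u: "u \<in> X" and v: "v \<in> X" and ne: "v \<noteq> u" for u v
  proof
    assume p: "polar u v = 2"
    obtain y where y: "clif u y \<noteq> clif v y" using clif_inject[of u v] ne by blast
    define x where "x = clif u y - clif v y"
    have q: "quad u = 1" "quad v = 1" using special_quad[OF X] u v by auto
    have sq: "clif u (clif u z) = z" "clif v (clif v z) = z" for z by (simp_all add: clif_sq q)
    have "clif u (clif v y) + clif v (clif u y) = y + y"
      using clif_anti[of u v y] p by (simp add: vec_eq_iff)
    then have x1: "clif u x = clif v x"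
      by (simp add: x_def clif_diff sq algebra_simps)
    have x0: "x \<noteq> 0" using y by (simp add: x_def)
    define z where "z = x + clif u x"
    have zu: "clif u z = z" by (simp add: z_def clif_add sq)
    have zv: "clif v z = z" by (simp add: z_def clif_add x1 sq)
    show False
    proof (cases "z = 0")
      case False
      then show False using special_unique[OF X u v zu zv] ne by simp
    next
      case True
      then have "clif u x = - x" by (simp add: z_def add_eq_0_iff)
      then have "clif (neg u) x = x" "clif (neg v) x = x"
        using x1 by (simp_all add: clif_neg)
      then have "neg u = neg v"
        using special_unique[OF X _ _ _ _ x0] special_neg[OF X] u v by blast
      then show False using ne neg_neg by metis
    qed
  qed
  show "polar u v \<noteq> 2" using main[OF u v ne(1)] .
  show "polar u v \<noteq> - 2"
    using main[OF u, of "neg v"] v ne special_neg[OF X, of v] neg_neg[of v]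
    by (metis polar_neg' add.inverse_inverse)
qed

text \<open>The eigenspaces of either set partition the nonzero vectors, so a member of the larger
  set shares a fixed vector with a member of the smaller one and equals it.\<close>

lemma special_subset_eq:
  assumes "special X" "special Y" "X \<subseteq> Y"
  shows "X = Y"
proof
  show "Y \<subseteq> X"
  proof
    fix u assume u: "u \<in> Y"
    show "u \<in> X"
    proof (cases "\<exists>x. x \<noteq> 0 \<and> clif u x = x")
      case True
      then obtain x where x: "x \<noteq> 0" "clif u x = x" by blast
      then obtain v where "v \<in> X" "clif v x = x" using special_cover[OF assms(1)] by blast
      then show ?thesis using special_unique[OF assms(2) u _ x(2) _ x(1)] assms(3) by blast
    next
      case False
      define x :: "'a ^ 4" where "x = axis 1 1"
      have x0: "x \<noteq> 0" by (simp add: x_def axis_eq_0_iff)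
      \<comment> \<open>The vector x + u x is fixed by u, hence zero in this case. Then
        \<open>neg u\<close> fixes x, and the argument applies to \<open>neg u\<close>.\<close>
      have "clif u (x + clif u x) = x + clif u x"
        by (simp add: clif_add clif_sq special_quad[OF assms(2) u])
      with False have "x + clif u x = 0" by blast
      then have "clif (neg u) x = x" by (simp add: clif_neg add_eq_0_iff2)
      moreover obtain v where "v \<in> X" "clif v x = x" using special_cover[OF assms(1) x0] by blast
      ultimately have "neg u \<in> X"
        using special_unique[OF assms(2) _ _ _ _ x0] special_neg[OF assms(2)] u assms(3) by blast
      then show ?thesis using special_neg[OF assms(1)] by blast
    qed
  qed
qed (rule assms(3))

section \<open>Meaning of the evaluated functions\<close>

abbreviation pm :: "'a::field vec5 set \<Rightarrow> 'a vec5 set" where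
  "pm A \<equiv> {u. u \<in> A \<or> neg u \<in> A}"

lemma set_join: "set_tree (join s t) = set_tree s \<union> set_tree t"
  by (cases "(s, t)" rule: join.cases) auto

lemma set_compatible: "set_tree (compatible f t) = {v \<in> set_tree t. \<not> is_pm_two (pairing f v)}"
proof (induction t)
  case (Elem v)
  then show ?case by (cases "is_pm_two (pairing f v)") auto
qed (auto simp: set_join)

fun point :: "'a::zero vec4 \<Rightarrow> 'a ^ 4" where
  "point (Pt a b c d) = vector [a, b, c, d]"

lemma point_neg4: "point (neg4 p) = - point p"
  by (cases p) (simp add: vec_eq_iff forall_4)
lemma nonzero_point: "nonzero p \<longleftrightarrow> point p \<noteq> 0"
  by (cases p) (auto simp: is_zero_def vec_eq_iff forall_4)
lemma sends1_iff: "sends1 u p r \<longleftrightarrow> clif u (point p) = - point r"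
proof -
  have z: "s + y = 0 \<longleftrightarrow> s = - y" for s y :: 'a by (simp add: add_eq_0_iff2)
  have sends4: "sends4 g (V a b c d e) (Pt x1 x2 x3 x4) (Pt y1 y2 y3 y4) \<longleftrightarrow>
      g \<and> e * x1 + b * x2 - a * x4 = - y4" for g and a b c d e x1 x2 x3 x4 y1 y2 y3 y4 :: 'a
    by (cases g) (simp_all add: is_zero_def z)
  have sends3: "sends3 g (V a b c d e) (Pt x1 x2 x3 x4) (Pt y1 y2 y3 y4) \<longleftrightarrow>
      g \<and> c * x1 - d * x2 - a * x3 = - y3 \<and> e * x1 + b * x2 - a * x4 = - y4"
    for g and a b c d e x1 x2 x3 x4 y1 y2 y3 y4 :: 'a
    by (cases g) (simp_all add: is_zero_def z sends4)
  have sends2: "sends2 g (V a b c d e) (Pt x1 x2 x3 x4) (Pt y1 y2 y3 y4) \<longleftrightarrow>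
      g \<and> a * x2 - e * x3 + c * x4 = - y2 \<and> c * x1 - d * x2 - a * x3 = - y3 \<and>
      e * x1 + b * x2 - a * x4 = - y4" for g and a b c d e x1 x2 x3 x4 y1 y2 y3 y4 :: 'a
    by (cases g) (simp_all add: is_zero_def z sends3)
  show ?thesis
    by (cases u; cases p; cases r) (simp add: sends2 is_zero_def z vec_eq_iff forall_4)
qed

lemma set_cons_if: "set (cons_if b v acc) = (if b then {v} else {}) \<union> set acc"
  by (cases b) auto
lemma set_covering: "set (covering p (neg4 p) t acc) =
    {v \<in> set_tree t. clif v (point p) = point p \<or> clif v (point p) = - point p} \<union> set acc"
  by (induction t arbitrary: acc) (auto simp: set_cons_if sends1_iff point_neg4)
lemma set_covering_in: "set (covering_in p (neg4 p) vs) =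
    {v \<in> set vs. clif v (point p) = point p \<or> clif v (point p) = - point p}"
  by (induction vs) (auto simp: set_cons_if sends1_iff point_neg4)

lemma lists_eq_iff: "lists_eq b xs ys \<longleftrightarrow> b \<and> xs = ys"
  by (induction b xs ys rule: lists_eq.induct) auto
lemma vec5_eq_iff: "vec5_eq u v \<longleftrightarrow> u = v" by (cases u; cases v) (simp add: lists_eq_iff)
lemma member_or_iff: "member_or b u rs \<longleftrightarrow> b \<or> u \<in> set rs"
  by (induction b u rs rule: member_or.induct) (auto simp: vec5_eq_iff)
lemma member_pm_iff: "member_pm u rs \<longleftrightarrow> u \<in> pm (set rs)" by (auto simp: member_pm_def member_or_iff)
lemma list_into_iff: "list_into ws us rs \<longleftrightarrow> (\<forall>u\<in>set us. reflects ws u \<in> pm (set rs))"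
  by (induction us) (auto simp: member_pm_iff)
lemma tree_into_iff: "tree_into ws t rs \<longleftrightarrow> (\<forall>u\<in>set_tree t. reflects ws u \<in> pm (set rs))"
  by (induction t) (auto simp: member_pm_iff)
lemma lookup_set: "lookup n xs = Some x \<Longrightarrow> x \<in> set xs"
  by (induction n xs rule: lookup.induct) auto
lemma lookup_nat_set: "lookup_nat n xs = Some x \<Longrightarrow> x \<in> set xs"
  by (simp add: lookup_nat_def lookup_set)

lemma neg_reflects: "reflects ws (neg u) = neg (reflects ws u)"
  by (induction ws arbitrary: u) (auto simp: reflect_neg)

lemma reflects_inject:
  assumes "nonsingular TYPE('a::field) ws" "reflects ws u = reflects ws (v :: 'a vec5)"
  shows "u = v"
  using assms
proof (induction ws arbitrary: u v)
  case (Cons w ws)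
  then have "quad (decode_vec w :: 'a vec5) \<noteq> 0" by (simp add: is_zero_def)
  moreover have "reflect (decode_vec w) u = reflect (decode_vec w) v" using Cons.IH Cons.prems by simp
  ultimately show ?case using reflect_reflect[of "decode_vec w :: 'a vec5"] by metis
qed simp

section \<open>Soundness of the certificates\<close>

locale checker =
  fixes G :: "'a::field vec5 set \<Rightarrow> bool" and R :: "'a vec5 list list"
  assumes G_reflect: "\<lbrakk>special X; quad w \<noteq> 0; G (reflect w ` X)\<rbrakk> \<Longrightarrow> G X"
    and G_rep: "\<lbrakk>special X; r \<in> set R; X \<subseteq> pm (set r)\<rbrakk> \<Longrightarrow> G X"
begin

lemma G_reflects:
  assumes "special X" "nonsingular TYPE('a) ws" "G (reflects ws ` X)"
  shows "G X"
  using assms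
proof (induction ws arbitrary: X)
  case (Cons w ws)
  have q: "quad (decode_vec w :: 'a vec5) \<noteq> 0" using Cons.prems(2) by (simp add: is_zero_def)
  have "G (reflect (decode_vec w) ` X)"
    using Cons.IH[OF special_reflect[OF Cons.prems(1) q]] Cons.prems by (simp add: image_image)
  then show ?case using G_reflect[OF Cons.prems(1) q] by blast
qed simp

lemma special_reflects:
  assumes "special (X :: 'a vec5 set)" "nonsingular TYPE('a) ws"
  shows "special (reflects ws ` X)"
  using assms
proof (induction ws arbitrary: X)
  case (Cons w ws)
  have q: "quad (decode_vec w :: 'a vec5) \<noteq> 0" using Cons.prems(2) by (simp add: is_zero_def)
  show ?case
    using Cons.IH[OF special_reflect[OF Cons.prems(1) q]] Cons.prems by (simp add: image_image)
qed simp

text \<open>Undoing a product of reflections undoes the last factor first, which is why the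
  induction runs from the end of the list.\<close>

lemma G_reflects_inv:
  assumes "special X" "nonsingular TYPE('a) ws" "\<And>Y. special Y \<Longrightarrow> X = reflects ws ` Y \<Longrightarrow> G Y"
  shows "G X"
  using assms
proof (induction ws arbitrary: X rule: rev_induct)
  case Nil
  then show ?case by simp
next
  case (snoc w ws)
  have reflects_snoc: "reflects (ws @ [w]) u = reflect (decode_vec w) (reflects ws u)" for u :: "'a vec5"
    by (induction ws arbitrary: u) auto
  have nonsingular: "nonsingular TYPE('a) ws" and q: "quad (decode_vec w :: 'a vec5) \<noteq> 0"
    using snoc.prems(2) by (induction ws) (auto simp: is_zero_def)
  let ?X = "reflect (decode_vec w) ` X"
  have "G ?X"
  proof (rule snoc.IH[OF special_reflect[OF snoc.prems(1) q] nonsingular])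
    fix Y assume Y: "special Y" "?X = reflects ws ` Y"
    have "X = reflects (ws @ [w]) ` Y"
      using arg_cong[OF Y(2), of "image (reflect (decode_vec w))"] by (simp add: image_image reflect_reflect[OF q] reflects_snoc)
    then show "G Y" by (rule snoc.prems(3)[OF Y(1)])
  qed
  then show ?case by (rule G_reflect[OF snoc.prems(1) q])
qed

text \<open>The claim that a configuration is settled. It speaks of all completions, so
  \<open>good []\<close> is the completeness of the list of representatives.\<close>

definition good :: "'a vec5 list \<Rightarrow> bool" where
  "good h \<longleftrightarrow> (\<forall>X. special X \<longrightarrow> set h \<subseteq> X \<longrightarrow> G X)"
definition confined :: "'a vec5 list \<Rightarrow> 'a vec5 tree \<Rightarrow> bool" where
  "confined cs T \<longleftrightarrow> (\<forall>X. special X \<longrightarrow> set cs \<subseteq> X \<longrightarrow> X \<subseteq> pm (set cs \<union> set_tree T))"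

text \<open>By \<open>special_polar\<close>, a member of X other than \<open>+-u\<close> passes the
  filter. The vector u itself, which the filter may drop, is now among the chosen ones.\<close>

lemma confined_compatible:
  assumes "confined cs T"
  shows "confined (u # cs) (compatible (dual u) T)"
  unfolding confined_def
proof (intro allI impI subsetI)
  fix X v assume X: "special X" and cs: "set (u # cs) \<subseteq> X" and v: "v \<in> X"
  have "v \<in> pm (set cs \<union> set_tree T)" using assms X cs v unfolding confined_def by auto
  moreover have "v \<in> pm (insert u (set_tree (compatible (dual u) T)))" if t: "v \<in> pm (set_tree T)"
  proof (cases "v = u \<or> v = neg u")
    case True
    then show ?thesis by auto
  next
    case False
    have "polar u v \<noteq> 2" "polar u v \<noteq> - 2" using special_polar[OF X _ v] cs False by auto
    then have "\<not> is_pm_two (pairing (dual u) v)" "\<not> is_pm_two (pairing (dual u) (neg v))"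
      using polar_neg'[of u v] by (auto simp: is_pm_two_def polar_def[symmetric] minus_equation_iff[of _ 2])
    then show ?thesis using t by (auto simp: set_compatible)
  qed
  ultimately show "v \<in> pm (set (u # cs) \<union> set_tree (compatible (dual u) T))" by auto
qed

text \<open>The preimage of X under the reflections is special and, these being injective, contains
  the earlier configuration, which is already settled.\<close>

lemma good_sym:
  assumes "known_ok (lookup_nat j h) ws cs" "\<forall>c\<in>set h. good c"
  shows "good cs"
proof -
  obtain c where c: "lookup_nat j h = Some c" and w: "nonsingular TYPE('a) ws" and a: "list_into ws c cs"
    using assms(1) by (cases "lookup_nat j h") auto
  have gc: "good c" using assms(2) lookup_nat_set[OF c] by blast
  show ?thesis unfolding good_def
  proof (intro allI impI)
    fix X assume X: "special X" and cs: "set cs \<subseteq> X"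
    show "G X"
    proof (rule G_reflects_inv[OF X w])
      fix Y assume Y: "special Y" "X = reflects ws ` Y"
      have "u \<in> Y" if u: "u \<in> set c" for u
      proof -
        have "reflects ws u \<in> pm (set cs)" using a u unfolding list_into_iff by blast
        then have "reflects ws u \<in> X" using special_neg[OF X] cs by blast
        then obtain v where "v \<in> Y" "reflects ws u = reflects ws v" using Y(2) by blast
        then show ?thesis using reflects_inject[OF w] by blast
      qed
      then show "G Y" using gc Y(1) unfolding good_def by blast
    qed
  qed
qed

lemma good_leaf:
  assumes "leaf (lookup_nat j (deferred R)) ws cs T" "confined cs T"
  shows "good cs"
proof -
  obtain r where r: "lookup_nat j R = Some r" and w: "nonsingular TYPE('a) ws"
    and a: "list_into ws cs r" "tree_into ws T r"
    using assms(1) by (cases "lookup_nat j (deferred R)") (auto simp: deferred_def)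
  have rR: "r \<in> set R" using lookup_nat_set[OF r] .
  show ?thesis unfolding good_def
  proof (intro allI impI)
    fix X assume X: "special X" and cs: "set cs \<subseteq> X"
    have "X \<subseteq> pm (set cs \<union> set_tree T)" using assms(2) X cs unfolding confined_def by blast
    then have "reflects ws ` X \<subseteq> pm (set r)"
      using a by (fastforce simp: list_into_iff tree_into_iff neg_reflects)
    then show "G X" using G_reflects[OF X w] G_rep[OF special_reflects[OF X w] rR] by blast
  qed
qed

lemma guard_Some: "guard b x = Some y \<longleftrightarrow> b \<and> y = x" by (cases b) auto

text \<open>The invariant is that every configuration in the history is settled. It makes
  \<open>Sx\<close> usable, and together with the bound \<open>confined\<close> it settles the
  configuration at hand.\<close>

lemma check_sound:
  "\<lbrakk>check R H cs T c = Some H'; \<forall>h\<in>set H. good h; confined cs T\<rbrakk> \<Longrightarrow>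
     (\<forall>h\<in>set H'. good h) \<and> good cs"
  "\<lbrakk>check_all R Ho cs T os ct = Some H'; \<And>H. Ho = Some H \<Longrightarrow> \<forall>h\<in>set H. good h; confined cs T\<rbrakk> \<Longrightarrow>
     (\<forall>h\<in>set H'. good h) \<and> (\<forall>u\<in>set os. good (u # cs))"
proof (induction c and ct arbitrary: H cs T H' and Ho cs T os H')
  case (Br p ct)
  let ?p = "decode_point p :: 'a vec4"
  let ?os = "covering ?p (neg4 ?p) T (covering_in ?p (neg4 ?p) cs)"
  define x where "x = point ?p"
  have eq: "check_all R (guard (nonzero ?p) H) cs T ?os ct = Some H'" using Br.prems(1) by simp
  have *: "(\<forall>h\<in>set H'. good h) \<and> (\<forall>u\<in>set ?os. good (u # cs))"
    by (rule Br.IH[OF eq _ Br.prems(3)]) (use Br.prems(2) in \<open>auto simp: guard_Some\<close>)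
  \<comment> \<open>Failure propagates to the end, so the overall success shows that the guard
    held.\<close>
  have "check_all R None cs T os ct = None" for os
    by (cases ct) (auto split: list.splits)
  with eq have "nonzero ?p" by (cases "nonzero ?p") (auto simp del: check_all.simps)
  then have x: "x \<noteq> 0" by (simp add: x_def nonzero_point)
  have "good cs" unfolding good_def
  proof (intro allI impI)
    fix X assume X: "special X" and cs: "set cs \<subseteq> X"
    \<comment> \<open>Some member of X must cover the branching point; by confinement it or its
      negative is among the branches.\<close>
    obtain u where u: "u \<in> X" "clif u x = x" using special_cover[OF X x] by blast
    have "u \<in> pm (set cs \<union> set_tree T)" using Br.prems(3) X cs u(1) unfolding confined_def by blast
    then obtain v where v: "v \<in> set cs \<union> set_tree T" "v = u \<or> v = neg u" by auto
    have "clif v x = x \<or> clif v x = - x" using v(2) u(2) by (auto simp: clif_neg)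
    then have "v \<in> set ?os" using v(1) by (auto simp: set_covering set_covering_in x_def)
    then have "good (v # cs)" using * by blast
    moreover have "v \<in> X" using v(2) u(1) special_neg[OF X] by blast
    ultimately show "G X" using X cs unfolding good_def by auto
  qed
  with * show ?case by blast
next
  case (Leaf ws j)
  then show ?case using good_leaf by (auto simp: guard_Some)
next
  case (Rec c)
  then obtain H'' where "check R H cs T c = Some H''" "H' = cs # H''"
    by (cases "check R H cs T c") auto
  then show ?case using Rec.IH Rec.prems by fastforce
next
  case Dn
  then show ?case by (cases os) auto
next
  case (Nx c ct)
  obtain H u us where e: "Ho = Some H" "os = u # us"
    and eq: "check_all R (check R H (u # cs) (compatible (dual u) T) c) cs T us ct = Some H'"
    using Nx.prems(1) by (auto split: option.splits list.splits)
  have n: "check_all R None cs T os ct = None" for os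
    by (cases ct) (auto split: list.splits)
  obtain H1 where H1: "check R H (u # cs) (compatible (dual u) T) c = Some H1" using eq n by fastforce
  have 1: "(\<forall>h\<in>set H1. good h) \<and> good (u # cs)"
    using Nx.IH(1)[OF H1 _ confined_compatible[OF Nx.prems(3)]] Nx.prems(2)[OF e(1)] by blast
  have "(\<forall>h\<in>set H'. good h) \<and> (\<forall>u\<in>set us. good (u # cs))"
    using Nx.IH(2)[OF eq _ Nx.prems(3)] H1 1 by auto
  with 1 e show ?case by auto
next
  case (Sx ws j ct)
  obtain H u us where e: "Ho = Some H" "os = u # us"
    and eq: "check_all R (guard (known_ok (lookup_nat j H) ws (u # cs)) H) cs T us ct = Some H'"
    using Sx.prems(1) by (auto split: option.splits list.splits)
  have n: "check_all R None cs T os ct = None" for os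
    by (cases ct) (auto split: list.splits)
  have s: "known_ok (lookup_nat j H) ws (u # cs)" using eq n by (cases "known_ok (lookup_nat j H) ws (u # cs)") auto
  have 1: "good (u # cs)" using good_sym[OF s] Sx.prems(2)[OF e(1)] by blast
  have "(\<forall>h\<in>set H'. good h) \<and> (\<forall>u\<in>set us. good (u # cs))"
    using Sx.IH[OF eq _ Sx.prems(3)] s Sx.prems(2)[OF e(1)] by auto
  with 1 e show ?case by auto
qed

end

section \<open>Coordinates for a symplectic polarity\<close>

lemma sform_add_right: "sform x (y + z) = sform x y + sform x z"
  by (simp add: sform_def algebra_simps)
lemma sform_smult_right: "sform x (c *s y) = c * sform x y"
  by (simp add: sform_def algebra_simps)
lemma sform_add_left: "sform (x + y) z = sform x z + sform y z"
  by (simp add: sform_def algebra_simps)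
lemma sform_smult_left: "sform (c *s x) y = c * sform x y"
  by (simp add: sform_def algebra_simps)
lemma sform_minus_right: "sform x (- y) = - sform x y"
  by (simp add: sform_def algebra_simps)
lemma sform_diff_right: "sform x (y - z) = sform x y - sform x z"
  by (simp add: sform_def algebra_simps)
lemma sform_self [simp]: "sform x x = 0" by (simp add: sform_def)
lemma sform_sym: "sform x y = - sform y x" by (simp add: sform_def)
lemma sform_zero [simp]: "sform x 0 = 0" "sform 0 x = 0" by (simp_all add: sform_def)

lemma proportional2:
  fixes a b :: "'a::field"
  assumes "a * d = b * c" "a \<noteq> 0 \<or> b \<noteq> 0"
  obtains k where "c = k * a" "d = k * b"
proof (cases "a = 0")
  case True
  then show ?thesis using that[of "d / b"] assms by simp
next
  case False
  then show ?thesis using that[of "c / a"] assms by (simp add: field_simps)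
qed

text \<open>Orthogonality of a polarity, read in a basis of two orthogonal hyperbolic planes. The
  first four base relations leave the ratio of the scales of the two planes open; the fifth fixes it
  to match \<open>sform\<close>.\<close>

locale orthogonality =
  fixes orth :: "'a::field ^ 4 \<Rightarrow> 'a ^ 4 \<Rightarrow> bool"
  assumes sym: "orth x y \<Longrightarrow> orth y x"
    and self: "orth x x"
    and add: "orth x y \<Longrightarrow> orth x z \<Longrightarrow> orth x (y + z)"
    and smult: "orth x y \<Longrightarrow> orth x (c *s y)"
    and nondeg: "x \<noteq> 0 \<Longrightarrow> \<exists>y. \<not> orth x y"
    and base: "orth (vector [1,0,0,0]) (vector [0,0,1,0])" "orth (vector [1,0,0,0]) (vector [0,0,0,1])"
      "orth (vector [0,1,0,0]) (vector [0,0,1,0])" "orth (vector [0,1,0,0]) (vector [0,0,0,1])"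
      "orth (vector [1,0,1,0]) (vector [0,1,0,-1])"
begin

definition good :: "'a ^ 4 \<Rightarrow> bool" where "good x \<longleftrightarrow> (\<forall>y. orth x y \<longleftrightarrow> sform x y = 0)"

lemma goodD: "good x \<Longrightarrow> orth x y \<longleftrightarrow> sform x y = 0" by (simp add: good_def)
lemma goodD': "good x \<Longrightarrow> orth y x \<longleftrightarrow> sform x y = 0" using goodD sym by blast

lemma O_zero: "orth x 0" using smult[OF self, of x 0] by simp

text \<open>The orthogonal of \<open>x\<close> is a proper subspace, so containing the hyperplane it equals it.\<close>

lemma goodI:
  assumes "\<And>y. sform x y = 0 \<Longrightarrow> orth x y"
  shows "good x"
proof (cases "x = 0")
  case True
  then show ?thesis using sym[OF O_zero] by (simp add: good_def)
next
  case False
  have "sform x y = 0" if y: "orth x y" for y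
  proof (rule ccontr)
    assume n: "sform x y \<noteq> 0"
    have "orth x z" for z
    proof -
      have "orth x (z - (sform x z / sform x y) *s y)"
        using n by (intro assms) (simp add: sform_diff_right sform_smult_right)
      from add[OF this smult[OF y, of "sform x z / sform x y"]] show ?thesis by simp
    qed
    then show False using nondeg[OF False] by blast
  qed
  then show ?thesis using assms by (auto simp: good_def)
qed

lemma O_lincomb:
  assumes "orth x u" "orth x v" "orth x w"
  shows "orth x (k *s u + l *s v + m *s w)"
  by (intro add smult assms)

lemma vec4_cases: obtains a b c d where "x = (vector [a, b, c, d] :: 'a ^ 4)"
  by (rule that[of "x$1" "x$2" "x$3" "x$4"]) (simp add: vec_eq_iff forall_4)

text \<open>The \<open>sform\<close>-orthogonal space of a basis vector is spanned by that vector
  and the basis of the other plane, all of which the base relations provide.\<close>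

lemma unit_good:
  "good (vector [1,0,0,0])" "good (vector [0,1,0,0])"
  "good (vector [0,0,1,0])" "good (vector [0,0,0,1])"
proof -
  have *: "good x" if "orth x u" "orth x v" "\<And>y. sform x y = 0 \<Longrightarrow> \<exists>k l m. y = k *s x + l *s u + m *s v" for x u v
    using that(3) by (intro goodI) (metis O_lincomb self that(1,2))
  show "good (vector [1,0,0,0])"
  proof (rule *[OF base(1,2)])
    fix y :: "'a ^ 4" assume "sform (vector [1,0,0,0]) y = 0"
    then show "\<exists>k l m. y = k *s vector [1,0,0,0] + l *s vector [0,0,1,0] + m *s vector [0,0,0,1]"
      by (intro exI[of _ "y$1"] exI[of _ "y$3"] exI[of _ "y$4"]) (simp add: sform_def vec_eq_iff forall_4)
  qed
  show "good (vector [0,1,0,0])"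
  proof (rule *[OF base(3,4)])
    fix y :: "'a ^ 4" assume "sform (vector [0,1,0,0]) y = 0"
    then show "\<exists>k l m. y = k *s vector [0,1,0,0] + l *s vector [0,0,1,0] + m *s vector [0,0,0,1]"
      by (intro exI[of _ "y$2"] exI[of _ "y$3"] exI[of _ "y$4"]) (simp add: sform_def vec_eq_iff forall_4)
  qed
  show "good (vector [0,0,1,0])"
  proof (rule *[OF sym[OF base(1)] sym[OF base(3)]])
    fix y :: "'a ^ 4" assume "sform (vector [0,0,1,0]) y = 0"
    then show "\<exists>k l m. y = k *s vector [0,0,1,0] + l *s vector [1,0,0,0] + m *s vector [0,1,0,0]"
      by (intro exI[of _ "y$3"] exI[of _ "y$1"] exI[of _ "y$2"]) (simp add: sform_def vec_eq_iff forall_4)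
  qed
  show "good (vector [0,0,0,1])"
  proof (rule *[OF sym[OF base(2)] sym[OF base(4)]])
    fix y :: "'a ^ 4" assume "sform (vector [0,0,0,1]) y = 0"
    then show "\<exists>k l m. y = k *s vector [0,0,0,1] + l *s vector [1,0,0,0] + m *s vector [0,1,0,0]"
      by (intro exI[of _ "y$4"] exI[of _ "y$1"] exI[of _ "y$2"]) (simp add: sform_def vec_eq_iff forall_4)
  qed
qed

text \<open>The same argument for a vector in one of the two planes: the basis vectors of the other
  plane, already understood, are orthogonal to it by symmetry.\<close>

lemma plane_good:
  "good (vector [a, b, 0, 0])" "good (vector [0, 0, a, b])"
proof -
  have "good (vector [a, b, 0, 0]) \<and> good (vector [0, 0, a, b])" if ab: "a \<noteq> 0 \<or> b \<noteq> 0"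
  proof (intro conjI goodI)
    fix y assume y: "sform (vector [a, b, 0, 0]) y = 0"
    then have "a * y$2 = b * y$1" by (simp add: sform_def)
    from proportional2[OF this ab] obtain k where k: "y$1 = k * a" "y$2 = k * b" .
    have "y = k *s vector [a, b, 0, 0] + y$3 *s vector [0,0,1,0] + y$4 *s vector [0,0,0,1]"
      using k by (simp add: vec_eq_iff forall_4)
    moreover have "orth (vector [a, b, 0, 0]) (vector [0,0,1,0])" "orth (vector [a, b, 0, 0]) (vector [0,0,0,1])"
      using unit_good by (simp_all add: goodD' sform_def)
    ultimately show "orth (vector [a, b, 0, 0]) y" using O_lincomb[OF self] by metis
  next
    fix y assume y: "sform (vector [0, 0, a, b]) y = 0"
    then have "a * y$4 = b * y$3" by (simp add: sform_def)
    from proportional2[OF this ab] obtain k where k: "y$3 = k * a" "y$4 = k * b" .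
    have "y = k *s vector [0, 0, a, b] + y$1 *s vector [1,0,0,0] + y$2 *s vector [0,1,0,0]"
      using k by (simp add: vec_eq_iff forall_4)
    moreover have "orth (vector [0, 0, a, b]) (vector [1,0,0,0])" "orth (vector [0, 0, a, b]) (vector [0,1,0,0])"
      using unit_good by (simp_all add: goodD' sform_def)
    ultimately show "orth (vector [0, 0, a, b]) y" using O_lincomb[OF self] by metis
  qed
  moreover have "good 0" using sym[OF O_zero] by (simp add: good_def)
  moreover have "vector [0, 0, 0, 0] = (0 :: 'a ^ 4)" by (simp add: vec_eq_iff forall_4)
  ultimately show "good (vector [a, b, 0, 0])" "good (vector [0, 0, a, b])"
    by (metis, metis)
qed

text \<open>Of the three vectors spanning the \<open>sform\<close>-orthogonal space, two are the
  plane components of x, handled by \<open>plane_good\<close>. So a single further orthogonal vector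
  \<open>y0\<close> is enough; the inequality keeps it independent of them.\<close>

lemma sum_good:
  assumes y0: "orth (vector [a, b, c, d]) y0" "sform (vector [a, b, c, d]) y0 = 0"
    "a * y0$2 - b * y0$1 \<noteq> 0" and ne: "c \<noteq> 0 \<or> d \<noteq> 0"
  shows "good (vector [a, b, c, d])"
proof (rule goodI)
  let ?x = "vector [a, b, c, d] :: 'a ^ 4"
  fix y assume y: "sform ?x y = 0"
  define m where "m = (a * y$2 - b * y$1) / (a * y0$2 - b * y0$1)"
  define z where "z = y - m *s y0"
  have "m * (a * y0$2 - b * y0$1) = a * y$2 - b * y$1" using y0(3) by (simp add: m_def)
  then have z1: "a * z$2 - b * z$1 = 0" by (simp add: z_def algebra_simps)
  have "sform ?x z = 0" using y y0(2) by (simp add: z_def sform_diff_right sform_smult_right)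
  then have z2: "c * z$4 - d * z$3 = 0" using z1 by (simp add: sform_def algebra_simps)
  have "a \<noteq> 0 \<or> b \<noteq> 0" using y0(3) by auto
  with z1 obtain k where k: "z$1 = k * a" "z$2 = k * b" using proportional2[of a "z$2" b "z$1"] by auto
  from z2 ne obtain l where l: "z$3 = l * c" "z$4 = l * d" using proportional2[of c "z$4" d "z$3"] by auto
  have "y = k *s vector [a, b, 0, 0] + l *s vector [0, 0, c, d] + m *s y0"
    using k l by (simp add: z_def vec_eq_iff forall_4 algebra_simps)
  moreover have "orth ?x (vector [a, b, 0, 0])" "orth ?x (vector [0, 0, c, d])"
    using plane_good by (simp_all add: goodD' sform_def)
  ultimately show "orth ?x y" using O_lincomb y0(1) by metis
qed

text \<open>A bootstrap in which vectors already understood serve as \<open>y0\<close> for others: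
  the fifth base relation starts it, vectors with equal first and third entries follow, then those
  whose first and third entries are nonzero, then the rest.\<close>

lemma all_good: "good x"
proof -
  have w2: "good (vector [0,1,0,-1])"
    by (rule sum_good[OF sym[OF base(5)]]) (simp_all add: sform_def)
  have diag: "good (vector [a, b, a, d])" if "a \<noteq> 0" for a b d
  proof (rule sum_good[where ?y0.0 = "vector [0,1,0,-1]"])
    show "orth (vector [a, b, a, d]) (vector [0,1,0,-1])"
      using w2 by (simp add: goodD' sform_def)
  qed (use that in \<open>simp_all add: sform_def\<close>)
  have step: "good (vector [a, b, c, d])"
    if "good (vector [p, q, r, s])" "a * q - b * p + c * s - d * r = 0" "a * q - b * p \<noteq> 0" "c \<noteq> 0 \<or> d \<noteq> 0"
    for a b c d p q r s
  proof (rule sum_good[where ?y0.0 = "vector [p, q, r, s]"])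
    show "orth (vector [a, b, c, d]) (vector [p, q, r, s])"
      using that(2) goodD'[OF that(1)] sform_sym[of "vector [p, q, r, s]"]
      by (simp add: sform_def algebra_simps)
  qed (use that in \<open>simp_all add: sform_def algebra_simps\<close>)
  \<comment> \<open>The witness (1, (b + 1)/a, 1, (d - 1)/c) gives the two plane parts of the form
    the values 1 and -1.\<close>
  have nonzero: "good (vector [a, b, c, d])" if "a \<noteq> 0" "c \<noteq> 0" for a b c d
    using that by (intro step[OF diag[of 1 "(b + 1) / a" "(d - 1) / c"]]) (simp_all add: field_simps)
  obtain a b c d where x: "x = vector [a, b, c, d]" by (rule vec4_cases)
  consider "a = 0" "b = 0" | "c = 0" "d = 0" | "a \<noteq> 0" "c \<noteq> 0" | "a = 0" "b \<noteq> 0" "c \<noteq> 0"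
    | "a \<noteq> 0" "c = 0" "d \<noteq> 0" | "a = 0" "c = 0" "b \<noteq> 0" "d \<noteq> 0" by blast
  then show ?thesis
  proof cases
    \<comment> \<open>In the remaining three cases the witnesses give the two plane parts the values
      -b and b, then d and -d, then -bd and bd.\<close>
    case 4
    then show ?thesis unfolding x
      by (intro step[OF diag[of 1 0 "(d + b) / c"]]) simp_all
  next
    case 5
    then show ?thesis unfolding x
      by (intro step[OF diag[of 1 "(b + d) / a" 0]]) simp_all
  next
    case 6
    then show ?thesis unfolding x
      by (intro step[OF nonzero[of d "- b" 0 0]]) simp_all
  qed (simp_all add: x plane_good nonzero)
qed

end

section \<open>Construction of a symplectic basis from the polarity\<close>

lemma symplectic_coordinates:
  fixes \<zeta> :: "('a::field ^ 4) set \<Rightarrow> ('a ^ 4) set"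
  assumes "symplectic_polarity \<zeta>"
  obtains \<phi> :: "'a ^ 4 \<Rightarrow> 'a ^ 4" where
    "\<And>x y. \<phi> (x + y) = \<phi> x + \<phi> y" "\<And>c x. \<phi> (c *s x) = c *s \<phi> x" "bij \<phi>"
    "\<And>x y. \<phi> y \<in> \<zeta> (vec.span {\<phi> x}) \<longleftrightarrow> sform x y = 0"
proof -
  have polar: "polarity \<zeta>" using assms by (simp add: symplectic_polarity_def)
  have sub: "vec.subspace (\<zeta> U)" and inv: "\<zeta> (\<zeta> U) = U" if "vec.subspace U" for U
    using polar that by (auto simp: polarity_def)
  have anti: "\<zeta> W \<subseteq> \<zeta> U" if "vec.subspace U" "vec.subspace W" "U \<subseteq> W" for U W
    using polar that by (auto simp: polarity_def)
  define P where "P x = \<zeta> (vec.span {x})" for x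
  have Psub: "vec.subspace (P x)" for x by (simp add: P_def sub)
  have Psym: "x \<in> P y" if "y \<in> P x" for x y
  proof -
    have "vec.span {y} \<subseteq> P x" using that Psub by (simp add: vec.span_minimal)
    then have "\<zeta> (P x) \<subseteq> \<zeta> (vec.span {y})" by (intro anti Psub) simp_all
    then show ?thesis by (auto simp: P_def inv intro: vec.span_base)
  qed
  have Padd: "y + z \<in> P x" if "y \<in> P x" "z \<in> P x" for x y z
    using Psub that by (rule vec.subspace_add)
  have Psm: "c *s y \<in> P x" if "y \<in> P x" for x y c
    using Psub that by (rule vec.subspace_scale)
  have Pdiff: "y - z \<in> P x" if "y \<in> P x" "z \<in> P x" for x y z
    using Psub that by (rule vec.subspace_diff)
  have Pz: "0 \<in> P x" for x using Psub by (rule vec.subspace_0)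
  have Pself: "x \<in> P x" for x
  proof (cases "x = 0")
    case False
    then have "vec.span {x} \<in> pg_points" by (simp add: pg_points_def)
    then have "vec.span {x} \<subseteq> P x" using assms by (auto simp: symplectic_polarity_def P_def)
    then show ?thesis using vec.span_base[of x "{x}"] by blast
  qed (use Pz in simp)
  have Pne: "\<exists>y. y \<notin> P x" if "x \<noteq> 0" for x
  proof (rule ccontr)
    assume "\<nexists>y. y \<notin> P x"
    then have "\<zeta> (vec.span {x}) = UNIV" by (auto simp: P_def)
    then have e: "\<zeta> UNIV = vec.span {x}" using inv[of "vec.span {x}"] by simp
    have "\<zeta> UNIV \<subseteq> \<zeta> U" if "vec.subspace U" for U using that by (intro anti) simp_all
    from this[of "\<zeta> {0}"] have "\<zeta> UNIV \<subseteq> {0}" by (simp add: sub inv)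
    then have "x \<in> {0}" using e vec.span_base[of x "{x}"] by blast
    with that show False by simp
  qed
  \<comment> \<open>\<open>P x\<close> has codimension at most one: the polar of the span of z and
    \<open>P x\<close> is a proper subspace of the span of x, hence zero, so that span is the whole
    space.\<close>
  have hyp: "\<exists>c. y - c *s z \<in> P x" if z: "z \<notin> P x" for x y z
  proof -
    let ?W = "vec.span (insert z (P x))"
    have W: "vec.subspace ?W" by simp
    have PW: "P x \<subseteq> ?W" by (meson subset_insertI vec.span_superset subset_trans)
    have "\<zeta> ?W \<subseteq> vec.span {x}"
      using anti[OF Psub W PW] by (simp add: P_def inv)
    have "\<zeta> ?W = {0}"
    proof (rule ccontr)
      assume "\<zeta> ?W \<noteq> {0}"
      then obtain w where w: "w \<in> \<zeta> ?W" "w \<noteq> 0"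
        using vec.subspace_0[OF sub[OF W]] by blast
      then obtain k where k: "w = k *s x"
        using \<open>\<zeta> ?W \<subseteq> vec.span {x}\<close> by (auto simp: vec.span_singleton)
      with w have "inverse k *s w = x" by auto
      then have "x \<in> \<zeta> ?W" using vec.subspace_scale[OF sub[OF W] w(1)] by metis
      then have "vec.span {x} \<subseteq> \<zeta> ?W" using sub[OF W] by (simp add: vec.span_minimal)
      then have "\<zeta> (\<zeta> ?W) \<subseteq> P x" unfolding P_def by (intro anti sub W) simp_all
      then have "?W \<subseteq> P x" by (simp add: inv)
      then show False using z vec.span_base[of z "insert z (P x)"] by blast
    qed
    moreover have "\<zeta> UNIV \<subseteq> \<zeta> ?W" by (intro anti W) simp_all
    ultimately have "\<zeta> UNIV = \<zeta> ?W" using vec.subspace_0[OF sub[of UNIV]] by auto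
    then have "?W = UNIV" using inv[OF W] inv[of UNIV] by simp
    then have "y \<in> ?W" by simp
    then obtain c where "y - c *s z \<in> vec.span (P x)" by (metis vec.span_breakdown_eq)
    moreover have "vec.span (P x) = P x" using Psub by (simp add: vec.span_eq_iff)
    ultimately show ?thesis by auto
  qed
  define e1 :: "'a ^ 4" where "e1 = axis 1 1"
  have e1: "e1 \<noteq> 0" by (simp add: e1_def)
  obtain f1 where f1: "f1 \<notin> P e1" using Pne[OF e1] by blast
  then have e1': "e1 \<notin> P f1" using Psym by blast
  have split: "\<exists>s t. y - s *s e1 - t *s f1 \<in> P e1 \<inter> P f1" for y
  proof -
    obtain t where t: "y - t *s f1 \<in> P e1" using hyp[OF f1] by blast
    obtain s where s: "(y - t *s f1) - s *s e1 \<in> P f1" using hyp[OF e1'] by blast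
    have "(y - t *s f1) + (- s) *s e1 \<in> P e1" by (intro Padd Psm t Pself)
    then have "y - s *s e1 - t *s f1 \<in> P e1 \<inter> P f1"
      using s by (simp add: algebra_simps)
    then show ?thesis by blast
  qed
  \<comment> \<open>Otherwise the splitting would put every vector into the span of
    \<open>e1\<close> and \<open>f1\<close>, whose dimension is at most two.\<close>
  have "\<exists>e2. e2 \<noteq> 0 \<and> e2 \<in> P e1 \<inter> P f1"
  proof (rule ccontr)
    assume n: "\<not> ?thesis"
    have "y \<in> vec.span {e1, f1}" for y
    proof -
      obtain s t where "y - s *s e1 - t *s f1 = 0" using split[of y] n by blast
      then have "y = s *s e1 + t *s f1" by (simp add: algebra_simps)
      then show ?thesis by (simp add: vec.span_add vec.span_scale vec.span_base)
    qed
    then have "vec.span {e1, f1} = UNIV" by blast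
    then have "vec.dim (UNIV :: ('a ^ 4) set) \<le> card {e1, f1}"
      by (metis vec.dim_le_card finite.emptyI finite_insert subset_UNIV)
    also have "\<dots> \<le> 2" by (simp add: card_insert_if)
    finally show False by (simp add: vec.dim_UNIV vec.dimension_def card_cart_basis)
  qed
  then obtain e2 where e2: "e2 \<noteq> 0" "e2 \<in> P e1" "e2 \<in> P f1" by blast
  obtain z where z: "z \<notin> P e2" using Pne[OF e2(1)] by blast
  obtain s t where st: "z - s *s e1 - t *s f1 \<in> P e1 \<inter> P f1" using split by blast
  define g where "g = z - s *s e1 - t *s f1"
  have g1: "g \<in> P e1" "g \<in> P f1" using st by (auto simp: g_def)
  have g2: "g \<notin> P e2"
  proof
    assume "g \<in> P e2"
    then have "g + (s *s e1 + t *s f1) \<in> P e2" using e2 Psym by (intro Padd Psm) auto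
    then show False using z by (simp add: g_def)
  qed
  have "g \<notin> P (e1 + e2)"
  proof
    assume "g \<in> P (e1 + e2)"
    from Pdiff[OF Psym[OF this] Psym[OF g1(1)]] have "e2 \<in> P g" by simp
    then show False using g2 Psym by blast
  qed
  \<comment> \<open>This scalar is the scale of the second plane: with \<open>f2 = c *s g\<close> it
    becomes the fifth base relation.\<close>
  then obtain c where c: "f1 - c *s g \<in> P (e1 + e2)" using hyp by blast
  have c0: "c \<noteq> 0"
  proof
    assume "c = 0"
    then have "f1 \<in> P (e1 + e2)" using c by simp
    from Pdiff[OF Psym[OF this] e2(3)] show False using e1' by simp
  qed
  define f2 where "f2 = c *s g"
  have f2: "f2 \<in> P e1" "f2 \<in> P f1" using g1 Psm by (auto simp: f2_def)
  have f2': "f2 \<notin> P e2"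
  proof
    assume "f2 \<in> P e2"
    then have "inverse c *s f2 \<in> P e2" by (rule Psm)
    then show False using g2 c0 by (simp add: f2_def)
  qed
  have e2': "e2 \<notin> P f2" using f2' Psym by blast
  define \<phi> where "\<phi> x = x$1 *s e1 + x$2 *s f1 + x$3 *s e2 + x$4 *s f2" for x :: "'a ^ 4"
  have phi_add: "\<phi> (x + y) = \<phi> x + \<phi> y" for x y by (simp add: \<phi>_def vec.scale_left_distrib algebra_simps)
  have phi_smult: "\<phi> (k *s x) = k *s \<phi> x" for k x by (simp add: \<phi>_def vec.scale_right_distrib)
  have coeff0: "k = 0" if "k *s y + w = 0" "w \<in> P x" "y \<notin> P x" for k y w x
  proof (rule ccontr)
    assume "k \<noteq> 0"
    have "k *s y = (- 1) *s w" using that(1) by (simp add: add_eq_0_iff)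
    then have "y = inverse k *s ((- 1) *s w)" using \<open>k \<noteq> 0\<close> by (metis vec.scale_left_imp_eq vec.scale_scale vec.scale_one right_inverse mult.commute)
    then show False using that(2,3) Psm by metis
  qed
  have ker: "x = 0" if x: "\<phi> x = 0" for x
  proof -
    have ort: "f1 \<in> P e2" "f1 \<in> P f2" "e1 \<in> P e2" "e1 \<in> P f2" using e2 f2 Psym by auto
    have "x$1 = 0"
      by (rule coeff0[of _ e1 "x$2 *s f1 + x$3 *s e2 + x$4 *s f2" f1])
        (use x e1' in \<open>auto simp: \<phi>_def add.assoc intro!: Padd Psm Pself e2 f2\<close>)
    moreover have "x$2 = 0"
      by (rule coeff0[of _ f1 "x$1 *s e1 + x$3 *s e2 + x$4 *s f2" e1])
        (use x f1 in \<open>auto simp: \<phi>_def algebra_simps intro!: Padd Psm Pself e2 f2\<close>)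
    moreover have "x$3 = 0"
      by (rule coeff0[of _ e2 "x$1 *s e1 + x$2 *s f1 + x$4 *s f2" f2])
        (use x e2' in \<open>auto simp: \<phi>_def algebra_simps intro!: Padd Psm Pself ort\<close>)
    moreover have "x$4 = 0"
      by (rule coeff0[of _ f2 "x$1 *s e1 + x$2 *s f1 + x$3 *s e2" e2])
        (use x f2' in \<open>auto simp: \<phi>_def algebra_simps intro!: Padd Psm Pself ort\<close>)
    ultimately show ?thesis by (simp add: vec_eq_iff forall_4)
  qed
  have lin: "Vector_Spaces.linear (*s) (*s) \<phi>" by unfold_locales (simp_all add: phi_add phi_smult)
  have "inj \<phi>"
  proof (rule injI)
    fix x y assume "\<phi> x = \<phi> y"
    then have "\<phi> (x + (- 1) *s y) = 0" unfolding phi_add phi_smult by simp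
    from ker[OF this] show "x = y" by simp
  qed
  then have bij: "bij \<phi>" using vec.linear_inj_imp_surj[OF lin] by (simp add: bij_def)
  define orth where "orth x y \<longleftrightarrow> \<phi> y \<in> P (\<phi> x)" for x y
  interpret orthogonality orth
  proof
    show "orth x y \<Longrightarrow> orth y x" for x y using Psym by (simp add: orth_def)
    show "orth x x" for x using Pself by (simp add: orth_def)
    show "orth x y \<Longrightarrow> orth x z \<Longrightarrow> orth x (y + z)" for x y z by (simp add: orth_def phi_add Padd)
    show "orth x y \<Longrightarrow> orth x (c *s y)" for x y c by (simp add: orth_def phi_smult Psm)
    show "\<exists>y. \<not> orth x y" if "x \<noteq> 0" for x
    proof -
      have "\<phi> x \<noteq> 0" using that ker by blast
      then show ?thesis using Pne bij unfolding orth_def by (metis bij_pointE)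
    qed
    show "orth (vector [1,0,0,0]) (vector [0,0,1,0])" "orth (vector [1,0,0,0]) (vector [0,0,0,1])"
      "orth (vector [0,1,0,0]) (vector [0,0,1,0])" "orth (vector [0,1,0,0]) (vector [0,0,0,1])"
      using e2 f2 by (simp_all add: orth_def \<phi>_def)
    show "orth (vector [1,0,1,0]) (vector [0,1,0,-1])"
      using c by (simp add: orth_def \<phi>_def f2_def)
  qed
  show ?thesis
    using that[OF phi_add phi_smult bij] all_good by (auto simp: good_def orth_def P_def)
qed

section \<open>Lines as eigenspaces\<close>

definition eig :: "'a::field vec5 \<Rightarrow> ('a ^ 4) set" where "eig u = {x. clif u x = x}"

lemma eig_iff: "x \<in> eig u \<longleftrightarrow> clif u x = x" by (simp add: eig_def)
lemma eig_neg_iff: "x \<in> eig (neg u) \<longleftrightarrow> clif u x = - x"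
  by (simp add: eig_def clif_neg) (metis minus_minus)
lemma eig_zero: "0 \<in> eig u" by (simp add: eig_def)
lemma eig_add: "x \<in> eig u \<Longrightarrow> y \<in> eig u \<Longrightarrow> x + y \<in> eig u" by (simp add: eig_def clif_add)
lemma eig_smult: "x \<in> eig u \<Longrightarrow> c *s x \<in> eig u" by (simp add: eig_def clif_smult)

lemma sform_nondeg: "(\<And>y. sform y x = 0) \<Longrightarrow> x = (0 :: 'b::field ^ 4)"
proof -
  assume *: "\<And>y. sform y x = 0"
  show "x = 0"
    using *[of "vector [1,0,0,0]"] *[of "vector [0,1,0,0]"] *[of "vector [0,0,1,0]"] *[of "vector [0,0,0,1]"]
    by (simp add: sform_def vec_eq_iff forall_4)
qed

context
  assumes two: "(2 :: 'a::field) \<noteq> 0"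
begin

lemma self_neg_zero: "x = - x \<longleftrightarrow> x = (0 :: 'a ^ 4)"
proof -
  have "a = - a \<longleftrightarrow> a = 0" for a :: 'a
  proof
    assume "a = - a"
    then have "2 * a = 0" by (metis add.right_inverse mult_2)
    then show "a = 0" using two by simp
  qed simp
  then show ?thesis by (simp add: vec_eq_iff)
qed

lemma eig_inter_neg: "x \<in> eig u \<Longrightarrow> x \<in> eig (neg u) \<Longrightarrow> x = (0 :: 'a ^ 4)"
  using self_neg_zero[of x] unfolding eig_neg_iff unfolding eig_iff by simp

lemma eig_orth:
  assumes "x \<in> eig u" "y \<in> eig (neg u)"
  shows "sform x y = (0 :: 'a)"
proof -
  have "sform x y = - sform x y"
    using sform_clif[of u x y] assms(1) assms(2)[unfolded eig_neg_iff]
    by (simp add: eig_iff sform_minus_right)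
  then have "2 * sform x y = 0" by (metis add.right_inverse mult_2)
  then show ?thesis using two by simp
qed

lemma eig_proj:
  assumes "quad u = (1::'a)"
  shows "z + clif u z \<in> eig u" "z - clif u z \<in> eig (neg u)"
  unfolding eig_neg_iff unfolding eig_iff using assms by (simp_all add: clif_add clif_diff clif_sq)

lemma eig_decomp:
  fixes z :: "'a ^ 4"
  assumes "quad u = (1::'a)"
  obtains x x' where "z = x + x'" "clif u z = x - x'" "x \<in> eig u" "x' \<in> eig (neg u)"
proof
  let ?h = "inverse (2 :: 'a)"
  have h: "?h * a + ?h * a = a" for a :: 'a
    using two by (metis mult_2 mult.assoc right_inverse mult.left_commute mult_1)
  show "z = ?h *s (z + clif u z) + ?h *s (z - clif u z)"
    using h by (simp add: vec_eq_iff algebra_simps)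
  show "clif u z = ?h *s (z + clif u z) - ?h *s (z - clif u z)"
    using h by (simp add: vec_eq_iff algebra_simps)
  show "?h *s (z + clif u z) \<in> eig u" "?h *s (z - clif u z) \<in> eig (neg u)"
    by (intro eig_smult eig_proj assms)+
qed

text \<open>The vectors z + u z lie in \<open>eig u\<close>, and self-adjointness turns
  orthogonality to all of them into y + u y = 0.\<close>

lemma eig_neg_perp:
  assumes "quad u = (1::'a)"
  shows "y \<in> eig (neg u) \<longleftrightarrow> (\<forall>x\<in>eig u. sform x y = 0)"
proof
  assume *: "\<forall>x\<in>eig u. sform x y = 0"
  have "sform z (y + clif u y) = 0" for z
  proof -
    have "sform (z + clif u z) y = 0" using * eig_proj(1)[OF assms] by blast
    then show ?thesis by (simp add: sform_add_left sform_add_right sform_clif)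
  qed
  then have "y + clif u y = 0" by (rule sform_nondeg)
  then show "y \<in> eig (neg u)" by (simp add: eig_neg_iff add_eq_0_iff)
qed (use eig_orth in blast)

text \<open>The inequality records that the form is nondegenerate on the eigenspace, which is
  therefore a hyperbolic plane and gives a line that is not totally isotropic.\<close>

lemma eig_basis:
  assumes u: "quad u = (1::'a)"
  obtains p q where "sform p q \<noteq> 0" "eig u = {s *s p + t *s q |s t. True}"
proof -
  obtain a b c d e where V: "u = V a b c d e" by (cases u)
  have rel: "a * a + b * c + d * e = 1" using u by (simp add: V)
  show ?thesis
  proof (cases "a = - 1")
    case False
    then have k: "1 + a \<noteq> 0" by (metis add_eq_0_iff add.commute)
    \<comment> \<open>\<open>p\<close> and \<open>q\<close> are the first two columns of 1 + u,
      which is twice the projection onto the eigenspace.\<close>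
    define p :: "'a ^ 4" where "p = vector [1 + a, 0, c, e]"
    define q :: "'a ^ 4" where "q = vector [0, 1 + a, - d, b]"
    have r2: "b * c + d * e = (1 + a) * (1 - a)" using rel by (simp add: algebra_simps)
    have "sform p q = (1 + a) * (1 + a) + (b * c + d * e)"
      by (simp add: p_def q_def sform_def algebra_simps)
    also have "\<dots> = 2 * (1 + a)" unfolding r2 by (simp add: algebra_simps)
    finally have "sform p q \<noteq> 0" using two k by (metis mult_eq_0_iff)
    moreover have "eig u = {s *s p + t *s q |s t. True}"
    proof safe
      fix x assume "x \<in> eig u"
      then have x3: "c * x$1 - d * x$2 = (1 + a) * x$3" and x4: "e * x$1 + b * x$2 = (1 + a) * x$4"
        by (simp_all add: eig_iff V vec_eq_iff forall_4 algebra_simps eq_diff_eq)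
      have "(1 + a) *s x = x$1 *s p + x$2 *s q"
        using x3 x4 by (simp add: p_def q_def vec_eq_iff forall_4 mult.commute)
      then have "inverse (1 + a) *s ((1 + a) *s x) = inverse (1 + a) *s (x$1 *s p + x$2 *s q)" by simp
      then have "x = (inverse (1 + a) * x$1) *s p + (inverse (1 + a) * x$2) *s q"
        using k by (simp add: vec.scale_right_distrib)
      then show "\<exists>s t. x = s *s p + t *s q \<and> True" by blast
    next
      fix s t
      have "p \<in> eig u" "q \<in> eig u"
        using rel by (auto simp: p_def q_def eig_iff V vec_eq_iff forall_4 algebra_simps eq_diff_eq)
      then show "s *s p + t *s q \<in> eig u" by (intro eig_add eig_smult)
    qed
    ultimately show ?thesis by (rule that)
  next
    case True
    \<comment> \<open>For a = -1 the first two columns of 1 + u are dependent; columns three and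
      four are taken instead.\<close>
    define p :: "'a ^ 4" where "p = vector [b, - e, 2, 0]"
    define q :: "'a ^ 4" where "q = vector [d, c, 0, 2]"
    have r2: "b * c + d * e = 0" using rel True by simp
    have "sform p q = b * c + d * e + 2 * 2"
      by (simp add: p_def q_def sform_def algebra_simps)
    then have "sform p q \<noteq> 0" using two unfolding r2 by (metis add_0 mult_eq_0_iff)
    moreover have "eig u = {s *s p + t *s q |s t. True}"
    proof safe
      fix x assume "x \<in> eig u"
      then have x1: "b * x$3 + d * x$4 = 2 * x$1" and x2: "c * x$4 - e * x$3 = 2 * x$2"
        by (simp_all add: eig_iff V True vec_eq_iff forall_4 algebra_simps)
      have "2 *s x = x$3 *s p + x$4 *s q"
        using x1 x2 by (simp add: p_def q_def vec_eq_iff forall_4 mult.commute)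
      then have "inverse 2 *s (2 *s x) = inverse 2 *s (x$3 *s p + x$4 *s q)" by simp
      then have "x = (inverse 2 * x$3) *s p + (inverse 2 * x$4) *s q"
        using two by (simp add: vec.scale_right_distrib)
      then show "\<exists>s t. x = s *s p + t *s q \<and> True" by blast
    next
      fix s t
      have "p \<in> eig u" "q \<in> eig u"
        using r2 by (auto simp: p_def q_def eig_iff V True vec_eq_iff forall_4 algebra_simps add_eq_0_iff)
      then show "s *s p + t *s q \<in> eig u" by (intro eig_add eig_smult)
    qed
    ultimately show ?thesis by (rule that)
  qed
qed

lemma eig_nonzero:
  assumes "quad u = (1::'a)"
  obtains x where "x \<in> eig u" "x \<noteq> 0"
proof -
  obtain p q where "sform p q \<noteq> 0" "eig u = {s *s p + t *s q |s t. True}" by (rule eig_basis[OF assms])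
  moreover have "p = 1 *s p + 0 *s q" by simp
  ultimately have "p \<in> eig u" "p \<noteq> 0" by (blast, auto)
  then show ?thesis by (rule that)
qed

text \<open>On a plane with a nondegenerate alternating form, orthogonality is proportionality: the
  form is the determinant of the coordinates up to a factor.\<close>

lemma eig_proportional:
  assumes u: "quad u = (1::'a)" and x: "x \<in> eig u" "x \<noteq> 0" and y: "y \<in> eig u" "sform x y = 0"
  obtains k where "y = k *s x"
proof -
  obtain p q where pq: "sform p q \<noteq> 0" and e: "eig u = {s *s p + t *s q |s t. True}" by (rule eig_basis[OF u])
  obtain s t where s: "x = s *s p + t *s q" using x(1) e by auto
  obtain s' t' where s': "y = s' *s p + t' *s q" using y(1) e by auto
  have "sform x y = (s * t' - t * s') * sform p q"
    using sform_sym[of q p]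
    by (simp add: s s' sform_add_left sform_add_right sform_smult_left sform_smult_right algebra_simps)
  then have "s * t' = t * s'" using y(2) pq by simp
  moreover have "s \<noteq> 0 \<or> t \<noteq> 0" using s x(2) by auto
  ultimately obtain k where "s' = k * s" "t' = k * t" by (rule proportional2)
  then have "y = k *s x" by (simp add: s s' vec.scale_right_distrib)
  then show ?thesis by (rule that)
qed

lemma eig_dual:
  assumes u: "quad u = (1::'a)" and x: "x \<in> eig u" "x \<noteq> 0"
  obtains w where "w \<in> eig u" "sform x w = c"
proof -
  have "sform y x = - sform x y" for y by (rule sform_sym)
  then obtain y where y: "sform x y \<noteq> 0" using x(2) sform_nondeg[of x] by (metis neg_equal_0_iff_equal)
  define w where "w = y + clif u y"
  have w: "w \<in> eig u" unfolding w_def by (rule eig_proj(1)[OF u])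
  have "sform x w = 2 * sform x y"
    using sform_clif[of u x y] x(1) by (simp add: w_def eig_iff sform_add_right)
  then have "sform x w \<noteq> 0" using y two by simp
  then have "sform x ((c / sform x w) *s w) = c" by (simp add: sform_smult_right)
  then show ?thesis using that eig_smult[OF w] by blast
qed

text \<open>The (-1)-eigenspace is the orthogonal space of the 1-eigenspace, so the latter
  determines the operator.\<close>

lemma eig_inject:
  assumes u: "quad u = (1::'a)" and v: "quad v = 1" and e: "eig u = eig v"
  shows "u = v"
proof (rule clif_inject)
  fix z :: "'a ^ 4"
  have e': "eig (neg u) = eig (neg v)"
    using eig_neg_perp[OF u] eig_neg_perp[OF v] e by blast
  obtain x x' where x: "z = x + x'" "clif u z = x - x'" "x \<in> eig u" "x' \<in> eig (neg u)"
    by (rule eig_decomp[OF u])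
  then have "clif v x = x" "clif v x' = - x'"
    using e e' eig_iff[of x v] eig_neg_iff[of x' v] by auto
  then have "clif v z = x - x'" by (simp add: x(1) clif_add)
  then show "clif u z = clif v z" using x(2) by simp
qed

text \<open>The operator is twice the orthogonal projection onto the span of a and b, minus the
  identity. Its coordinates are, up to affine normalisation, Pluecker coordinates of that
  line.\<close>

lemma eig_exists:
  assumes "sform a b = (1::'a)"
  obtains u where "quad u = 1" "eig u = {s *s a + t *s b |s t. True}"
proof -
  define D where "D = a$1 * b$2 - a$2 * b$1"
  have D': "a$3 * b$4 - a$4 * b$3 = 1 - D" using assms by (simp add: D_def sform_def algebra_simps)
  define u where "u = V (2 * D - 1) (2 * (b$4 * a$1 - a$4 * b$1)) (2 * (a$3 * b$2 - b$3 * a$2))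
    (2 * (a$3 * b$1 - b$3 * a$1)) (- (2 * (b$4 * a$2 - a$4 * b$2)))"
  \<comment> \<open>The last four coordinates of u contribute by the Grassmann-Pluecker
    relation.\<close>
  have "quad u = (2 * D - 1) * (2 * D - 1) + 2 * 2 * (D * (a$3 * b$4 - a$4 * b$3))"
    by (simp add: u_def D_def algebra_simps)
  also have "\<dots> = 1" unfolding D' by (simp add: algebra_simps)
  finally have q: "quad u = 1" .
  have cl: "clif u x = 2 *s (sform x b *s a - sform x a *s b) - x" for x
  proof -
    have "clif u x $ 1 = (2 *s (sform x b *s a - sform x a *s b) - x) $ 1"
      "clif u x $ 2 = (2 *s (sform x b *s a - sform x a *s b) - x) $ 2"
      by (simp_all add: u_def D_def sform_def algebra_simps)
    \<comment> \<open>These are polynomial identities only after adding a multiple of 1 - D - (a3 b4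
      - a4 b3), which vanishes because \<open>sform a b = 1\<close>.\<close>
    moreover have "clif u x $ 3 = (2 *s (sform x b *s a - sform x a *s b) - x) $ 3 + 2 * x$3 * (1 - D - (a$3 * b$4 - a$4 * b$3))"
      "clif u x $ 4 = (2 *s (sform x b *s a - sform x a *s b) - x) $ 4 + 2 * x$4 * (1 - D - (a$3 * b$4 - a$4 * b$3))"
      by (simp_all add: u_def sform_def algebra_simps)
    ultimately show ?thesis unfolding D' by (simp add: vec_eq_iff forall_4)
  qed
  have ba: "sform b a = - 1" using assms sform_sym[of b a] by simp
  have "eig u = {s *s a + t *s b |s t. True}"
  proof safe
    fix x assume "x \<in> eig u"
    then have "2 *s (sform x b *s a - sform x a *s b) = 2 *s x"
      by (simp add: eig_iff cl diff_eq_eq) (simp add: vec_eq_iff)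
    then have "sform x b *s a - sform x a *s b = x" using two by simp
    then have "x = sform x b *s a + (- sform x a) *s b" by simp
    then show "\<exists>s t. x = s *s a + t *s b \<and> True" by blast
  next
    fix s t
    have "2 *s x - x = x" for x :: "'a ^ 4" by (simp add: vec_eq_iff)
    then have "a \<in> eig u" "b \<in> eig u" by (simp_all add: eig_iff cl assms ba)
    then show "s *s a + t *s b \<in> eig u" by (intro eig_add eig_smult)
  qed
  with q show ?thesis by (rule that)
qed

end

section \<open>The dictionary between non-isotropic lines and unit vectors\<close>

locale symplectic_frame =
  fixes \<zeta> :: "('a::field ^ 4) set \<Rightarrow> ('a ^ 4) set" and \<phi> :: "'a ^ 4 \<Rightarrow> 'a ^ 4"
  assumes two: "(2 :: 'a) \<noteq> 0"
    and polar: "polarity \<zeta>"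
    and phi_add: "\<phi> (x + y) = \<phi> x + \<phi> y"
    and phi_smult: "\<phi> (c *s x) = c *s \<phi> x"
    and bij_phi: "bij \<phi>"
    and perp_phi: "\<phi> y \<in> \<zeta> (vec.span {\<phi> x}) \<longleftrightarrow> sform x y = 0"
begin

definition pt :: "'a ^ 4 \<Rightarrow> ('a ^ 4) set" where "pt x = vec.span {\<phi> x}"
definition line :: "'a vec5 \<Rightarrow> ('a ^ 4) set" where "line u = \<phi> ` eig u"

lemma phi_eq_iff [simp]: "\<phi> x = \<phi> y \<longleftrightarrow> x = y"
  using bij_phi by (simp add: bij_def inj_eq)
lemma phi_surj: obtains x where "y = \<phi> x"
  using bij_phi by (metis bij_pointE)
lemma phi_zero [simp]: "\<phi> 0 = 0" using phi_smult[of 0 0] by simp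
lemma phi_zero_iff [simp]: "\<phi> x = 0 \<longleftrightarrow> x = 0" using phi_eq_iff[of x 0] by simp

lemma pt_eq: "pt x = {\<phi> (k *s x) |k. True}"
  by (auto simp: pt_def vec.span_singleton phi_smult)

lemma pt_eq_iff:
  assumes "x \<noteq> 0" "y \<noteq> 0"
  shows "pt x = pt y \<longleftrightarrow> (\<exists>k. y = k *s x)"
proof
  assume "pt x = pt y"
  then have "\<phi> y \<in> pt x" by (simp add: pt_def vec.span_base)
  then show "\<exists>k. y = k *s x" by (auto simp: pt_eq)
next
  assume "\<exists>k. y = k *s x"
  then obtain k where k: "y = k *s x" by blast
  with assms have "k \<noteq> 0" by auto
  then have "m *s x = (m / k) *s y" for m by (simp add: k)
  then have "pt x \<subseteq> pt y" unfolding pt_eq by auto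
  moreover have "m *s y = (m * k) *s x" for m by (simp add: k)
  then have "pt y \<subseteq> pt x" unfolding pt_eq by auto
  ultimately show "pt x = pt y" by blast
qed

lemma pt_smult: "k \<noteq> 0 \<Longrightarrow> pt (k *s x) = pt x"
  using pt_eq_iff[of x "k *s x"] by (cases "x = 0") auto

lemma pg_points_eq: "pg_points = {pt x |x. x \<noteq> 0}"
proof safe
  fix P :: "('a ^ 4) set" assume "P \<in> pg_points"
  then have P: "vec.subspace P" "vec.dim P = 1" by (auto simp: pg_points_def)
  obtain B where B: "B \<subseteq> P" "vec.independent B" "P \<subseteq> vec.span B" "card B = vec.dim P"
    using vec.basis_exists by blast
  then obtain b where b: "B = {b}" using P(2) by (auto simp: card_1_singleton_iff)
  obtain x where x: "b = \<phi> x" by (rule phi_surj)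
  have "P = vec.span {b}" using B P(1) b by (metis vec.span_minimal subset_antisym)
  moreover have "x \<noteq> 0" using B(2) b x by auto
  ultimately show "\<exists>x. P = pt x \<and> x \<noteq> 0" using x by (auto simp: pt_def)
next
  fix x :: "'a ^ 4" assume "x \<noteq> 0"
  then show "pt x \<in> pg_points" by (simp add: pg_points_def pt_def)
qed

lemma pg_pointE:
  assumes "P \<in> pg_points" obtains x where "x \<noteq> 0" "P = pt x"
  using assms by (auto simp: pg_points_eq)
lemma pt_point: "x \<noteq> 0 \<Longrightarrow> pt x \<in> pg_points" by (auto simp: pg_points_eq)

lemma line_subspace: "vec.subspace (line u)"
proof -
  have "\<phi> x + \<phi> y \<in> line u" if "x \<in> eig u" "y \<in> eig u" for x y
    using that eig_add[of x u y] by (auto simp: line_def phi_add[symmetric])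
  moreover have "c *s \<phi> x \<in> line u" if "x \<in> eig u" for c x
    using that eig_smult[of x u c] by (auto simp: line_def phi_smult[symmetric])
  moreover have "0 \<in> line u" using eig_zero[of u] by (auto simp: line_def image_iff intro!: bexI[of _ 0])
  ultimately show ?thesis unfolding vec.subspace_def by (auto simp: line_def)
qed

lemma phi_in_line: "\<phi> x \<in> line u \<longleftrightarrow> x \<in> eig u" by (auto simp: line_def)

lemma pt_subset_line: "pt x \<subseteq> line u \<longleftrightarrow> x \<in> eig u"
proof
  assume "pt x \<subseteq> line u"
  moreover have "\<phi> x \<in> pt x" by (simp add: pt_def vec.span_base)
  ultimately show "x \<in> eig u" using phi_in_line by blast
next
  assume "x \<in> eig u"
  then show "pt x \<subseteq> line u" by (auto simp: pt_eq phi_in_line eig_smult)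
qed

lemma points_on_line: "points_on (line u) = {pt x |x. x \<noteq> 0 \<and> x \<in> eig u}"
  unfolding points_on_def pg_points_eq using pt_subset_line by blast

lemma pt_on_line: "x \<noteq> 0 \<Longrightarrow> pt x \<in> points_on (line u) \<longleftrightarrow> x \<in> eig u"
  by (simp add: points_on_def pt_point pt_subset_line)

lemma points_on_inject:
  assumes "quad u = 1" "quad v = 1" "points_on (line u) = points_on (line v)"
  shows "u = v"
proof -
  have "x \<in> eig u \<longleftrightarrow> x \<in> eig v" for x
    using assms(3) pt_on_line[of x] eig_zero by (cases "x = 0") auto
  then show ?thesis using eig_inject[OF two assms(1,2)] by blast
qed

lemma line_inject: "quad u = 1 \<Longrightarrow> quad v = 1 \<Longrightarrow> line u = line v \<Longrightarrow> u = v"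
  using points_on_inject by metis

lemma span_pair: "vec.span {\<phi> p, \<phi> q} = \<phi> ` {s *s p + t *s q |s t. True}"
proof -
  have "vec.span {\<phi> p, \<phi> q} = {s *s \<phi> p + t *s \<phi> q |s t. True}"
    by (auto simp: vec.span_insert vec.span_singleton algebra_simps)
  also have "\<dots> = {\<phi> (s *s p + t *s q) |s t. True}" by (simp add: phi_add phi_smult)
  also have "\<dots> = \<phi> ` {s *s p + t *s q |s t. True}" by blast
  finally show ?thesis .
qed

lemma dim_span_pair:
  assumes "sform p q \<noteq> 0"
  shows "vec.dim (vec.span {\<phi> p, \<phi> q}) = 2"
proof -
  have q: "q \<noteq> 0" using assms by auto
  have n: "\<phi> p \<notin> vec.span {\<phi> q}"
  proof
    assume "\<phi> p \<in> vec.span {\<phi> q}"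
    then obtain k where "\<phi> p = \<phi> (k *s q)" by (auto simp: vec.span_singleton phi_smult)
    then have "p = k *s q" by simp
    then show False using assms by (simp add: sform_smult_left)
  qed
  then have "\<phi> p \<noteq> \<phi> q" using vec.span_base[of "\<phi> q" "{\<phi> q}"] by auto
  moreover have "vec.independent {\<phi> p, \<phi> q}" using n q by (simp add: vec.independent_insert)
  ultimately show ?thesis by (simp add: vec.dim_eq_card_independent)
qed

lemma line_pg_line:
  assumes "quad u = 1"
  shows "line u \<in> pg_lines"
proof -
  obtain p q where pq: "sform p q \<noteq> 0" "eig u = {s *s p + t *s q |s t. True}"
    by (rule eig_basis[OF two assms])
  then have "line u = vec.span {\<phi> p, \<phi> q}" by (simp add: line_def span_pair)
  then show ?thesis using dim_span_pair[OF pq(1)] by (simp add: pg_lines_def)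
qed

lemma pg_line_subset_eq:
  assumes "l \<in> pg_lines" "l' \<in> pg_lines" "l \<subseteq> l'"
  shows "l = l'"
  using assms by (intro vec.subspace_dim_equal) (auto simp: pg_lines_def)

lemma polar_sub: "vec.subspace U \<Longrightarrow> vec.subspace (\<zeta> U)"
  and polar_inv: "vec.subspace U \<Longrightarrow> \<zeta> (\<zeta> U) = U"
  using polar by (auto simp: polarity_def)
lemma polar_anti: "vec.subspace U \<Longrightarrow> vec.subspace W \<Longrightarrow> U \<subseteq> W \<Longrightarrow> \<zeta> W \<subseteq> \<zeta> U"
  using polar by (auto simp: polarity_def)

text \<open>Inclusion reversal reduces the polar of U to the polars of its points; the converse
  direction applies \<open>\<zeta>\<close> twice.\<close>

lemma phi_in_polar:
  assumes U: "vec.subspace U"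
  shows "\<phi> y \<in> \<zeta> U \<longleftrightarrow> (\<forall>x. \<phi> x \<in> U \<longrightarrow> sform x y = 0)"
proof
  assume y: "\<phi> y \<in> \<zeta> U"
  show "\<forall>x. \<phi> x \<in> U \<longrightarrow> sform x y = 0"
  proof (intro allI impI)
    fix x assume "\<phi> x \<in> U"
    then have "\<zeta> U \<subseteq> \<zeta> (vec.span {\<phi> x})" by (intro polar_anti U) (simp_all add: vec.span_minimal U)
    then show "sform x y = 0" using y perp_phi by blast
  qed
next
  assume *: "\<forall>x. \<phi> x \<in> U \<longrightarrow> sform x y = 0"
  have "U \<subseteq> \<zeta> (vec.span {\<phi> y})"
  proof
    fix z assume z: "z \<in> U"
    obtain x where x: "z = \<phi> x" by (rule phi_surj)
    have "sform y x = 0" using * z x sform_sym[of y x] by simp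
    then show "z \<in> \<zeta> (vec.span {\<phi> y})" by (simp add: x perp_phi)
  qed
  then have "\<zeta> (\<zeta> (vec.span {\<phi> y})) \<subseteq> \<zeta> U" by (intro polar_anti U polar_sub) simp_all
  then show "\<phi> y \<in> \<zeta> U" by (simp add: polar_inv subset_iff vec.span_base)
qed

lemma polar_line:
  assumes "quad u = 1"
  shows "\<zeta> (line u) = line (neg u)"
proof (rule set_eqI)
  fix z
  obtain y where y: "z = \<phi> y" by (rule phi_surj)
  show "z \<in> \<zeta> (line u) \<longleftrightarrow> z \<in> line (neg u)"
    by (simp add: y phi_in_polar[OF line_subspace] phi_in_line eig_neg_perp[OF two assms] Ball_def)
qed

lemma orthogonal_pt: "pg_orthogonal \<zeta> (pt x) (pt y) \<longleftrightarrow> sform x y = 0"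
proof -
  have s: "vec.subspace (\<zeta> (pt x))" by (simp add: pt_def polar_sub)
  have "pt y \<subseteq> \<zeta> (pt x) \<longleftrightarrow> \<phi> y \<in> \<zeta> (pt x)"
    unfolding pt_def[of y] using s vec.span_minimal[of "{\<phi> y}"] vec.span_base[of "\<phi> y" "{\<phi> y}"] by auto
  then show ?thesis by (simp add: pg_orthogonal_def perp_phi pt_def)
qed

lemma line_not_isotropic:
  assumes "quad u = 1"
  shows "\<not> totally_isotropic \<zeta> (line u)"
proof
  assume "totally_isotropic \<zeta> (line u)"
  then have "line (neg u) = line u" by (simp add: totally_isotropic_def polar_line[OF assms])
  then have "neg u = u" using line_inject assms by (metis quad_neg)
  moreover obtain x where "x \<in> eig u" "x \<noteq> 0" by (rule eig_nonzero[OF two assms])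
  ultimately show False using eig_inter_neg[OF two, of x u] by simp
qed

text \<open>If all pairs on l were orthogonal, l would lie properly inside its polar, and this
  properly inside the polar of a point of l. Strict inclusions alone then force dimension four, so
  the point would be orthogonal to everything.\<close>

lemma nonisotropic_line:
  assumes l: "l \<in> pg_lines" and n: "\<not> totally_isotropic \<zeta> l"
  obtains u where "quad u = 1" "l = line u"
proof -
  have sub: "vec.subspace l" and dim: "vec.dim l = 2" using l by (auto simp: pg_lines_def)
  have "\<exists>a b. \<phi> a \<in> l \<and> \<phi> b \<in> l \<and> sform a b \<noteq> 0"
  proof (rule ccontr)
    assume *: "\<not> ?thesis"
    have "l \<subseteq> \<zeta> l"
    proof
      fix z assume "z \<in> l"
      moreover obtain y where "z = \<phi> y" by (rule phi_surj)
      ultimately show "z \<in> \<zeta> l" using * by (auto simp: phi_in_polar[OF sub])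
    qed
    have "\<not> vec.dim (\<zeta> l) \<le> vec.dim l"
    proof
      assume "vec.dim (\<zeta> l) \<le> vec.dim l"
      then have "l = \<zeta> l" by (intro vec.subspace_dim_equal sub polar_sub \<open>l \<subseteq> \<zeta> l\<close>)
      then show False using n by (simp add: totally_isotropic_def)
    qed
    then have d3: "vec.dim (\<zeta> l) \<ge> 3" using dim by simp
    have "l \<noteq> {0}" using dim by auto
    then obtain z where z: "z \<in> l" "z \<noteq> 0" using vec.subspace_0[OF sub] by blast
    obtain a where "z = \<phi> a" by (rule phi_surj)
    with z have a: "\<phi> a \<in> l" "a \<noteq> 0" by auto
    let ?P = "vec.span {\<phi> a}"
    have P: "?P \<subseteq> l" using a sub by (simp add: vec.span_minimal)
    have "\<zeta> l \<subseteq> \<zeta> ?P" by (intro polar_anti sub P) simp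
    have "\<not> vec.dim (\<zeta> ?P) \<le> vec.dim (\<zeta> l)"
    proof
      assume "vec.dim (\<zeta> ?P) \<le> vec.dim (\<zeta> l)"
      then have "\<zeta> l = \<zeta> ?P" using \<open>\<zeta> l \<subseteq> \<zeta> ?P\<close> sub by (intro vec.subspace_dim_equal polar_sub) simp_all
      then have "l = ?P" by (metis polar_inv sub vec.subspace_span)
      moreover have "vec.dim ?P \<le> 1" using vec.dim_le_card[of ?P "{\<phi> a}"] by simp
      ultimately show False using dim by simp
    qed
    then have "vec.dim (\<zeta> ?P) \<ge> 4" using d3 by simp
    moreover have "vec.dim (UNIV :: ('a ^ 4) set) = 4"
      by (simp add: vec.dim_UNIV vec.dimension_def card_cart_basis)
    ultimately have "\<zeta> ?P = UNIV" by (intro vec.subspace_dim_equal) (simp_all add: polar_sub)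
    then have "sform a y = 0" for y using perp_phi[of y a] by simp
    then have "sform y a = 0" for y using sform_sym[of y a] by simp
    then show False using sform_nondeg a(2) by blast
  qed
  then obtain a b where ab: "\<phi> a \<in> l" "\<phi> b \<in> l" "sform a b \<noteq> 0" by blast
  define b' where "b' = inverse (sform a b) *s b"
  have b': "\<phi> b' \<in> l" "sform a b' = 1"
    using ab vec.subspace_scale[OF sub ab(2)] by (simp_all add: b'_def phi_smult sform_smult_right)
  obtain u where u: "quad u = 1" "eig u = {s *s a + t *s b' |s t. True}" by (rule eig_exists[OF two b'(2)])
  have "line u = vec.span {\<phi> a, \<phi> b'}" by (simp add: line_def span_pair u(2))
  then have "line u \<subseteq> l" using ab b' sub by (simp add: vec.span_minimal)
  then have "line u = l" by (rule pg_line_subset_eq[OF line_pg_line[OF u(1)] l])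
  with u(1) show ?thesis using that by blast
qed

text \<open>Orthogonality puts the second line inside the polar of the first, and lines have equal
  dimension. This is the uniqueness of the partner line in a special spread.\<close>

lemma points_orthogonal_iff:
  assumes "quad u = 1" "quad v = 1"
  shows "(\<forall>x\<in>points_on (line u). \<forall>y\<in>points_on (line v). pg_orthogonal \<zeta> x y) \<longleftrightarrow> v = neg u"
proof
  assume *: "\<forall>x\<in>points_on (line u). \<forall>y\<in>points_on (line v). pg_orthogonal \<zeta> x y"
  have "eig v \<subseteq> eig (neg u)"
  proof
    fix y assume y: "y \<in> eig v"
    have "sform x y = 0" if x: "x \<in> eig u" for x
    proof (cases "x = 0 \<or> y = 0")
      case False
      then have "pg_orthogonal \<zeta> (pt x) (pt y)" using * x y pt_on_line by blast
      then show ?thesis by (simp add: orthogonal_pt)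
    qed auto
    then show "y \<in> eig (neg u)" by (simp add: eig_neg_perp[OF two assms(1)])
  qed
  then have "line v \<subseteq> line (neg u)" by (auto simp: line_def)
  then have "line v = line (neg u)" using assms by (intro pg_line_subset_eq line_pg_line) simp_all
  then show "v = neg u" using assms by (intro line_inject) simp_all
next
  assume "v = neg u"
  then show "\<forall>x\<in>points_on (line u). \<forall>y\<in>points_on (line v). pg_orthogonal \<zeta> x y"
    by (auto simp: points_on_line orthogonal_pt intro: eig_orth[OF two])
qed

lemma special_spread_line:
  assumes X: "special X"
  shows "line ` X \<in> special_spreads \<zeta>"
proof -
  have q: "quad u = 1" if "u \<in> X" for u using special_quad[OF X that] .
  have "partition_on pg_points (points_on ` line ` X)"
    unfolding partition_on_def
  proof (intro conjI)
    show "\<Union> (points_on ` line ` X) = pg_points"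
    proof (intro equalityI subsetI)
      fix P :: "('a ^ 4) set" assume "P \<in> pg_points"
      then obtain x where x: "x \<noteq> 0" "P = pt x" by (rule pg_pointE)
      obtain u where "u \<in> X" "clif u x = x" using special_cover[OF X x(1)] by blast
      then show "P \<in> \<Union> (points_on ` line ` X)" using x by (auto simp: pt_on_line eig_iff)
    qed (auto simp: points_on_def)
    show "disjoint (points_on ` line ` X)"
    proof (rule disjointI)
      fix A B assume "A \<in> points_on ` line ` X" "B \<in> points_on ` line ` X" and ne: "A \<noteq> B"
      then obtain u v where u: "u \<in> X" "A = points_on (line u)" and v: "v \<in> X" "B = points_on (line v)" by auto
      show "A \<inter> B = {}"
      proof (rule ccontr)
        assume "A \<inter> B \<noteq> {}"
        then obtain P where P: "P \<in> A" "P \<in> B" by blast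
        then obtain x where x: "x \<noteq> 0" "P = pt x" using u by (auto simp: points_on_line)
        then have "x \<in> eig u" "x \<in> eig v" using P u v by (auto simp: pt_on_line)
        then have "u = v" using special_unique[OF X u(1) v(1) _ _ x(1)] by (simp add: eig_iff)
        then show False using ne u v by simp
      qed
    qed
    show "{} \<notin> points_on ` line ` X"
    proof
      assume "{} \<in> points_on ` line ` X"
      then obtain u where "u \<in> X" "points_on (line u) = {}" by auto
      moreover obtain x where "x \<in> eig u" "x \<noteq> 0" by (rule eig_nonzero[OF two q[OF \<open>u \<in> X\<close>]])
      ultimately show False by (auto simp: points_on_line)
    qed
  qed
  then have "spread (line ` X)" using line_pg_line q by (auto simp: spread_def)
  moreover have "\<exists>!l'. l' \<in> line ` X \<and> (\<forall>x\<in>points_on l. \<forall>y\<in>points_on l'. pg_orthogonal \<zeta> x y)"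
    if l: "l \<in> line ` X" for l
  proof -
    obtain u where u: "u \<in> X" "l = line u" using l by blast
    show ?thesis
    proof (rule ex1I[of _ "line (neg u)"])
      show "line (neg u) \<in> line ` X \<and> (\<forall>x\<in>points_on l. \<forall>y\<in>points_on (line (neg u)). pg_orthogonal \<zeta> x y)"
        using points_orthogonal_iff[of u "neg u"] special_neg[OF X] q u by auto
      fix l' assume "l' \<in> line ` X \<and> (\<forall>x\<in>points_on l. \<forall>y\<in>points_on l'. pg_orthogonal \<zeta> x y)"
      then show "l' = line (neg u)" using points_orthogonal_iff[of u] q u by auto
    qed
  qed
  ultimately show ?thesis
    using line_not_isotropic q by (auto simp: special_spreads_def)
qed

text \<open>The set X consists of all unit vectors whose line belongs to S. The partner line
  supplies closure under \<open>neg\<close>, and the partition of the points supplies unique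
  covering.\<close>

lemma special_spreadE:
  assumes S: "S \<in> special_spreads \<zeta>"
  obtains X where "special X" "S = line ` X"
proof -
  define X where "X = {u. quad u = 1 \<and> line u \<in> S}"
  have sp: "S \<subseteq> pg_lines" "partition_on pg_points (points_on ` S)"
    and ni: "\<And>l. l \<in> S \<Longrightarrow> \<not> totally_isotropic \<zeta> l"
    using S by (auto simp: special_spreads_def spread_def)
  have ex: "\<exists>l'\<in>S. \<forall>x\<in>points_on l. \<forall>y\<in>points_on l'. pg_orthogonal \<zeta> x y" if "l \<in> S" for l
  proof -
    have "\<exists>!l'. l' \<in> S \<and> (\<forall>x\<in>points_on l. \<forall>y\<in>points_on l'. pg_orthogonal \<zeta> x y)"
      using S that by (simp add: special_spreads_def)
    then show ?thesis by blast
  qed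
  have lin: "\<exists>u\<in>X. l = line u" if "l \<in> S" for l
    using nonisotropic_line[of l] sp(1) ni that unfolding X_def by blast
  have "special X" unfolding special_def
  proof (intro conjI ballI allI impI)
    fix u assume u: "u \<in> X"
    then show q: "quad u = 1" by (simp add: X_def)
    obtain l' where l': "l' \<in> S" "\<forall>x\<in>points_on (line u). \<forall>y\<in>points_on l'. pg_orthogonal \<zeta> x y"
      using ex[of "line u"] u by (auto simp: X_def)
    obtain v where v: "v \<in> X" "l' = line v" using lin l'(1) by blast
    have "v = neg u" using points_orthogonal_iff[OF q, of v] l'(2) v by (auto simp: X_def)
    then show "neg u \<in> X" using v(1) by simp
  next
    fix x :: "'a ^ 4" assume x: "x \<noteq> 0"
    have "pt x \<in> \<Union> (points_on ` S)" using sp(2) pt_point[OF x] by (simp add: partition_on_def)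
    then obtain l where l: "l \<in> S" "pt x \<in> points_on l" by blast
    then obtain u where u: "u \<in> X" "l = line u" using lin by blast
    have ux: "clif u x = x" using l(2) u(2) pt_on_line[OF x] by (simp add: eig_iff)
    show "\<exists>!u. u \<in> X \<and> clif u x = x"
    proof (rule ex1I[of _ u])
      show "u \<in> X \<and> clif u x = x" using u(1) ux by simp
      fix v assume v: "v \<in> X \<and> clif v x = x"
      then have "pt x \<in> points_on (line u) \<inter> points_on (line v)"
        using ux pt_on_line[OF x] by (simp add: eig_iff)
      moreover have "line u \<in> S" "line v \<in> S" using u(1) v by (auto simp: X_def)
      ultimately have "points_on (line u) = points_on (line v)"
        using sp(2) unfolding partition_on_def disjoint_def by blast
      then show "v = u" using u(1) v by (intro points_on_inject) (auto simp: X_def)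
    qed
  qed
  moreover have "S = line ` X" using lin by (auto simp: X_def)
  ultimately show ?thesis by (rule that)
qed

end

section \<open>Equivalence and its invariant\<close>

context symplectic_frame
begin

definition act :: "'a vec5 \<Rightarrow> ('a ^ 4) set \<Rightarrow> ('a ^ 4) set" where
  "act w P = \<phi> ` clif w ` inv \<phi> ` P"

lemma act_pt: "act w (pt x) = pt (clif w x)"
proof -
  have "pt x = \<phi> ` {k *s x |k. True}" by (auto simp: pt_eq)
  then have "inv \<phi> ` pt x = {k *s x |k. True}"
    using bij_phi by (simp add: image_inv_f_f bij_is_inj)
  then have "act w (pt x) = {\<phi> (clif w (k *s x)) |k. True}" unfolding act_def by auto
  then show ?thesis by (simp add: pt_eq clif_smult)
qed

lemma act_act: "quad w \<noteq> 0 \<Longrightarrow> act w (act w (pt x)) = pt x"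
  by (simp add: act_pt clif_sq pt_smult)

lemma act_points:
  assumes w: "quad w \<noteq> 0"
  shows "act w ` points_on (line u) = points_on (line (reflect w u))"
proof (intro equalityI subsetI)
  fix P assume "P \<in> act w ` points_on (line u)"
  then obtain x where x: "x \<noteq> 0" "x \<in> eig u" "P = pt (clif w x)"
    by (auto simp: points_on_line act_pt)
  then show "P \<in> points_on (line (reflect w u))"
    using clif_neq0[OF w x(1)] clif_reflect[OF w, of u x] by (auto simp: points_on_line eig_iff)
next
  fix P assume "P \<in> points_on (line (reflect w u))"
  then obtain x where x: "x \<noteq> 0" "x \<in> eig (reflect w u)" "P = pt x"
    by (auto simp: points_on_line)
  have "clif u (clif w x) = clif w x"
    using clif_reflect[OF w, of "reflect w u" x] x(2) by (simp add: reflect_reflect[OF w] eig_iff)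
  then have "pt (clif w x) \<in> points_on (line u)"
    using clif_neq0[OF w x(1)] by (auto simp: points_on_line eig_iff)
  moreover have "P = act w (pt (clif w x))" using act_act[OF w, of x] x(3) by (simp add: act_pt)
  ultimately show "P \<in> act w ` points_on (line u)" by blast
qed

lemma act_automorphism:
  assumes w: "quad w \<noteq> 0"
  shows "Sp4_automorphism \<zeta> (act w)"
  unfolding Sp4_automorphism_def
proof (intro conjI ballI)
  have "act w (act w P) = P" "act w P \<in> pg_points" if "P \<in> pg_points" for P
    using that by (auto elim!: pg_pointE simp: act_act[OF w]) (auto simp: act_pt intro!: pt_point clif_neq0[OF w])
  then show b: "bij_betw (act w) pg_points pg_points"
    by (intro bij_betw_byWitness[of _ "act w"]) auto
  fix P Q :: "('a ^ 4) set" assume P: "P \<in> pg_points" and Q: "Q \<in> pg_points"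
  obtain x y where x: "x \<noteq> 0" "P = pt x" and y: "y \<noteq> 0" "Q = pt y"
    using P Q by (auto elim!: pg_pointE)
  have "act w P = act w Q \<longleftrightarrow> P = Q" using b P Q by (auto simp: bij_betw_def inj_on_def)
  moreover have "pg_orthogonal \<zeta> (act w P) (act w Q) \<longleftrightarrow> pg_orthogonal \<zeta> P Q"
    using w by (simp add: x y act_pt orthogonal_pt sform_clif_clif)
  moreover have "act w P \<in> pg_points" "act w Q \<in> pg_points" using b P Q by (auto simp: bij_betw_def)
  ultimately show "Sp4_adj \<zeta> (act w P) (act w Q) \<longleftrightarrow> Sp4_adj \<zeta> P Q"
    using P Q by (simp add: Sp4_adj_def)
qed

lemma equiv_reflect:
  assumes X: "special X" and w: "quad w \<noteq> 0"
  shows "(line ` X, line ` reflect w ` X) \<in> special_spread_equiv \<zeta>"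
proof -
  have "maps_spread (act w) (line ` X) (line ` reflect w ` X)"
    by (simp add: maps_spread_def image_image act_points[OF w])
  then show ?thesis
    using special_spread_line[OF X] special_spread_line[OF special_reflect[OF X w]] act_automorphism[OF w]
    by (auto simp: special_spread_equiv_def)
qed

section \<open>Orthogonality of unit vectors expressed in the graph\<close>

definition perp :: "('a ^ 4) set set \<Rightarrow> ('a ^ 4) set set" where
  "perp A = {y \<in> pg_points. \<forall>x\<in>A. x = y \<or> Sp4_adj \<zeta> x y}"

text \<open>Named after the operator relation u v + v u = 0. Only adjacency and automorphisms occur,
  so conjugation by any automorphism preserves it.\<close>

definition anticommute :: "('a ^ 4) set set \<Rightarrow> ('a ^ 4) set set \<Rightarrow> bool" where
  "anticommute A B \<longleftrightarrow>
     (\<exists>f. Sp4_automorphism \<zeta> f \<and> (\<forall>P\<in>A \<union> perp A. f P = P) \<and> f ` B = perp B)"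

lemma perp_line:
  assumes u: "quad u = 1"
  shows "perp (points_on (line u)) = points_on (line (neg u))"
proof (intro equalityI subsetI)
  fix P assume P: "P \<in> perp (points_on (line u))"
  then obtain y where y: "y \<noteq> 0" "P = pt y" by (auto simp: perp_def elim: pg_pointE)
  have "sform x y = 0" if "x \<in> eig u" for x
  proof (cases "x = 0")
    case False
    then have "pt x = pt y \<or> Sp4_adj \<zeta> (pt x) (pt y)"
      using P y that by (simp add: perp_def pt_on_line)
    then have "pg_orthogonal \<zeta> (pt x) (pt y)"
      using orthogonal_pt[of x x] by (auto simp: Sp4_adj_def)
    then show ?thesis by (simp add: orthogonal_pt)
  qed simp
  then show "P \<in> points_on (line (neg u))"
    using y by (simp add: pt_on_line eig_neg_perp[OF two u])
next
  fix P assume "P \<in> points_on (line (neg u))"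
  then obtain y where y: "y \<noteq> 0" "P = pt y" "y \<in> eig (neg u)" by (auto simp: points_on_line)
  then show "P \<in> perp (points_on (line u))"
    using eig_orth[OF two, of _ u y]
    by (auto simp: perp_def points_on_line Sp4_adj_def orthogonal_pt pt_point)
qed

lemma automorphism_pt:
  assumes f: "Sp4_automorphism \<zeta> f" and x: "x \<noteq> 0"
  obtains z where "z \<noteq> 0" "f (pt x) = pt z"
proof -
  have "f (pt x) \<in> pg_points" using f pt_point[OF x] by (auto simp: Sp4_automorphism_def bij_betw_def)
  then show ?thesis using that by (auto elim: pg_pointE)
qed

text \<open>Coinciding points are treated apart because adjacency is irreflexive, whereas the form
  vanishes on the diagonal.\<close>

lemma automorphism_sform:
  assumes f: "Sp4_automorphism \<zeta> f" and x: "x \<noteq> 0" "f (pt x) = pt z"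
    and y: "y \<noteq> 0" "f (pt y) = pt w" and xy: "sform x y = 0"
  shows "sform z w = 0"
proof (cases "pt x = pt y")
  case True
  then show ?thesis using x(2) y(2) orthogonal_pt[of z w] orthogonal_pt[of z z] by simp
next
  case False
  then have "Sp4_adj \<zeta> (pt x) (pt y)" using x y xy by (simp add: Sp4_adj_def pt_point orthogonal_pt)
  then have "Sp4_adj \<zeta> (f (pt x)) (f (pt y))"
    using f pt_point[OF x(1)] pt_point[OF y(1)] unfolding Sp4_automorphism_def by blast
  then have "Sp4_adj \<zeta> (pt z) (pt w)" using x(2) y(2) by simp
  then show ?thesis by (simp add: Sp4_adj_def orthogonal_pt)
qed

text \<open>The point of a + a' is orthogonal to the fixed points of a and of a', hence so is its
  image. Inside each eigenspace orthogonal means proportional, which puts the image into the span of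
  a and a'.\<close>

lemma fixing_automorphism:
  assumes f: "Sp4_automorphism \<zeta> f" and u: "quad u = 1"
    and fix_u: "\<And>x. x \<noteq> 0 \<Longrightarrow> x \<in> eig u \<Longrightarrow> f (pt x) = pt x"
    and fix_nu: "\<And>x. x \<noteq> 0 \<Longrightarrow> x \<in> eig (neg u) \<Longrightarrow> f (pt x) = pt x"
    and a: "a \<in> eig u" "a \<noteq> 0" and a': "a' \<in> eig (neg u)" "a' \<noteq> 0"
  obtains c where "c \<noteq> 0" "f (pt (a + a')) = pt (a + c *s a')"
proof -
  have nu: "quad (neg u) = 1" using u by simp
  have s0: "a + a' \<noteq> 0"
  proof
    assume "a + a' = 0"
    then have "a = - a'" by (simp add: add_eq_0_iff2)
    then have "a \<in> eig (neg u)" using eig_smult[OF a'(1), of "- 1"] by simp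
    then show False using eig_inter_neg[OF two a(1)] a(2) by simp
  qed
  obtain z where z: "z \<noteq> 0" "f (pt (a + a')) = pt z" by (rule automorphism_pt[OF f s0])
  obtain z1 z2 where z12: "z = z1 + z2" "z1 \<in> eig u" "z2 \<in> eig (neg u)" by (rule eig_decomp[OF two u])
  have aa: "sform a a' = 0" by (rule eig_orth[OF two a(1) a'(1)])
  then have aa': "sform a' a = 0" using sform_sym[of a' a] by simp
  have "sform a z = 0"
    by (rule automorphism_sform[OF f a(2) fix_u[OF a(2,1)] s0 z(2)]) (simp add: sform_add_right aa)
  moreover have "sform a z2 = 0" by (rule eig_orth[OF two a(1) z12(3)])
  ultimately have "sform a z1 = 0" by (simp add: z12(1) sform_add_right)
  then obtain k where k: "z1 = k *s a" by (rule eig_proportional[OF two u a z12(2)])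
  have "sform a' z = 0"
    by (rule automorphism_sform[OF f a'(2) fix_nu[OF a'(2,1)] s0 z(2)]) (simp add: sform_add_right aa')
  moreover have "sform a' z1 = 0" using eig_orth[OF two z12(2) a'(1)] sform_sym[of a' z1] by simp
  ultimately have "sform a' z2 = 0" by (simp add: z12(1) sform_add_right)
  then obtain l where l: "z2 = l *s a'" by (rule eig_proportional[OF two nu a' z12(3)])
  have inj: "pt x = pt y" if "f (pt x) = f (pt y)" "x \<noteq> 0" "y \<noteq> 0" for x y
    using f that pt_point by (auto simp: Sp4_automorphism_def bij_betw_def inj_on_def)
  \<comment> \<open>Otherwise the image would be the fixed point of a', against injectivity.\<close>
  have k0: "k \<noteq> 0"
  proof
    assume "k = 0"
    then have "z = l *s a'" "l \<noteq> 0" using z12 k l z(1) by auto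
    then have "f (pt (a + a')) = f (pt a')" using z(2) fix_nu[OF a'(2,1)] by (simp add: pt_smult)
    then have "pt a' = pt (a + a')" using inj[OF _ s0 a'(2)] by simp
    then obtain m where "a + a' = m *s a'" using pt_eq_iff[OF a'(2) s0] by blast
    then have "a = (m - 1) *s a'" by (simp add: vec.scale_left_diff_distrib eq_diff_eq)
    then have "a \<in> eig (neg u)" using eig_smult[OF a'(1)] by simp
    then show False using eig_inter_neg[OF two a(1)] a(2) by simp
  qed
  have l0: "l \<noteq> 0"
  proof
    assume "l = 0"
    then have "z = k *s a" using z12 k l by simp
    then have "f (pt (a + a')) = f (pt a)" using z(2) fix_u[OF a(2,1)] k0 by (simp add: pt_smult)
    then have "pt a = pt (a + a')" using inj[OF _ s0 a(2)] by simp
    then obtain m where "a + a' = m *s a" using pt_eq_iff[OF a(2) s0] by blast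
    then have "a' = (m - 1) *s a" by (simp add: vec.scale_left_diff_distrib eq_diff_eq add.commute)
    then have "a' \<in> eig u" using eig_smult[OF a(1)] by simp
    then show False using eig_inter_neg[OF two _ a'(1)] a'(2) by simp
  qed
  have "z = k *s (a + (l / k) *s a')" using k0 by (simp add: z12(1) k l vec.scale_right_distrib)
  then have "pt z = pt (a + (l / k) *s a')" using pt_smult[OF k0] by simp
  then show ?thesis using that[of "l / k"] z(2) k0 l0 by simp
qed

text \<open>A graph automorphism fixing all points of \<open>l\<close> and of its polar line acts on a point
  \<open>\<langle>x + x'\<rangle>\<close> by \<open>\<langle>x + c x'\<rangle>\<close>, and \<open>c c' = 1\<close> for orthogonal points. Three mutually
  orthogonal points force \<open>c\<^sup>2 = 1\<close>, so the automorphism behaves like the involution of \<open>l\<close>.\<close>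

lemma anticommute_iff:
  assumes u: "quad u = 1" and v: "quad v = 1"
    and disj: "v = u \<or> v = neg u \<or> (\<forall>x. x \<in> eig v \<longrightarrow> x \<noteq> 0 \<longrightarrow> x \<notin> eig u \<and> x \<notin> eig (neg u))"
  shows "anticommute (points_on (line u)) (points_on (line v)) \<longleftrightarrow> polar u v = 0"
proof
  assume "anticommute (points_on (line u)) (points_on (line v))"
  then obtain f where f: "Sp4_automorphism \<zeta> f"
    and fixed: "\<forall>P \<in> points_on (line u) \<union> points_on (line (neg u)). f P = P"
    and swap: "f ` points_on (line v) = points_on (line (neg v))"
    unfolding anticommute_def perp_line[OF u] perp_line[OF v] by (elim exE conjE) simp
  obtain y where y: "y \<in> eig v" "y \<noteq> 0" by (rule eig_nonzero[OF two v])
  have fix_u: "f (pt x) = pt x" if "x \<noteq> 0" "x \<in> eig u" for x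
    using fixed pt_on_line[OF that(1)] that(2) by blast
  have fix_nu: "f (pt x) = pt x" if "x \<noteq> 0" "x \<in> eig (neg u)" for x
    using fixed pt_on_line[OF that(1)] that(2) by blast
  have fy: "f (pt y) \<in> points_on (line (neg v))" using swap y pt_on_line[OF y(2)] by blast
  \<comment> \<open>In that case f would fix a point of the line of v that it has to move to the
    polar line.\<close>
  have "\<not> (v = u \<or> v = neg u)"
  proof
    assume "v = u \<or> v = neg u"
    then have "f (pt y) = pt y" using fix_u fix_nu y by auto
    then have "y \<in> eig (neg v)" using fy pt_on_line[OF y(2)] by simp
    then show False using eig_inter_neg[OF two y(1)] y(2) by simp
  qed
  then have ny: "y \<notin> eig u" "y \<notin> eig (neg u)" using disj y by auto
  obtain x x' where x: "y = x + x'" "clif u y = x - x'" "x \<in> eig u" "x' \<in> eig (neg u)"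
    by (rule eig_decomp[OF two u])
  have x0: "x \<noteq> 0" "x' \<noteq> 0" using ny x by auto
  have nu: "quad (neg u) = 1" using u by simp
  \<comment> \<open>The opposite values 1 and -1 make x + x' and w + w' orthogonal; their sum is the
    third mutually orthogonal vector.\<close>
  obtain w where w: "w \<in> eig u" "sform x w = 1" by (rule eig_dual[OF two u x(3) x0(1)])
  obtain w' where w': "w' \<in> eig (neg u)" "sform x' w' = - 1" by (rule eig_dual[OF two nu x(4) x0(2)])
  have sw: "sform w x = - 1" "sform w' x' = 1" using w(2) w'(2) sform_sym[of w x] sform_sym[of w' x'] by auto
  have w0: "w \<noteq> 0" "w' \<noteq> 0" using w(2) w'(2) by auto
  have xw: "x + w \<in> eig u" "x' + w' \<in> eig (neg u)" using eig_add x w w' by blast+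
  have "sform x (x + w) = 1" "sform x' (x' + w') = - 1" using w w' by (simp_all add: sform_add_right)
  then have xw0: "x + w \<noteq> 0" "x' + w' \<noteq> 0" by auto
  have orth: "sform p p' = 0" "sform p' p = 0" if "p \<in> eig u" "p' \<in> eig (neg u)" for p p'
    using eig_orth[OF two that] sform_sym[of p' p] by auto
  obtain c1 where c1: "f (pt (x + x')) = pt (x + c1 *s x')"
    by (rule fixing_automorphism[OF f u fix_u fix_nu x(3) x0(1) x(4) x0(2)])
  obtain c2 where c2: "f (pt (w + w')) = pt (w + c2 *s w')"
    by (rule fixing_automorphism[OF f u fix_u fix_nu w(1) w0(1) w'(1) w0(2)])
  obtain c3 where c3: "f (pt ((x + w) + (x' + w'))) = pt ((x + w) + c3 *s (x' + w'))"
    by (rule fixing_automorphism[OF f u fix_u fix_nu xw(1) xw0(1) xw(2) xw0(2)])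
  note expand = sform_add_left sform_add_right sform_smult_left sform_smult_right
    orth x(3,4) w(1) w'(1) w(2) w'(2) sw
  have n0: "p + p' \<noteq> 0" if "p \<in> eig u" "p' \<in> eig (neg u)" "p \<noteq> 0" for p p'
  proof
    assume "p + p' = 0"
    then have "p = - p'" by (simp add: add_eq_0_iff2)
    then have "p \<in> eig (neg u)" using eig_smult[OF that(2), of "- 1"] by simp
    then show False using eig_inter_neg[OF two that(1)] that(3) by simp
  qed
  have "sform (x + c1 *s x') (w + c2 *s w') = 0"
    by (rule automorphism_sform[OF f n0[OF x(3,4) x0(1)] c1 n0[OF w(1) w'(1) w0(1)] c2])
      (simp add: expand)
  then have 12: "c1 * c2 = 1" by (simp add: expand mult.commute)
  have "sform (x + c1 *s x') ((x + w) + c3 *s (x' + w')) = 0"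
    by (rule automorphism_sform[OF f n0[OF x(3,4) x0(1)] c1 n0[OF xw xw0(1)] c3])
      (simp add: expand)
  then have 13: "c1 * c3 = 1" by (simp add: expand mult.commute)
  have "sform (w + c2 *s w') ((x + w) + c3 *s (x' + w')) = 0"
    by (rule automorphism_sform[OF f n0[OF w(1) w'(1) w0(1)] c2 n0[OF xw xw0(1)] c3])
      (simp add: expand)
  then have 23: "c2 * c3 = 1" by (simp add: expand mult.commute add_eq_0_iff2)
  have "c2 \<noteq> 0" using 12 by auto
  then have "c1 = c3" using 12 23 by (metis mult.commute mult_left_cancel)
  then have "c1 * c1 = 1" using 13 by simp
  then have c1': "c1 = 1 \<or> c1 = - 1" by (simp add: square_eq_1_iff)
  let ?z = "x + c1 *s x'"
  have z0: "?z \<noteq> 0" by (rule n0[OF x(3) eig_smult[OF x(4)] x0(1)])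
  have zv: "?z \<in> eig (neg v)" using fy c1 x(1) pt_on_line[OF z0] by simp
  from c1' show "polar u v = 0"
  proof
    assume "c1 = 1"
    then have "y \<in> eig (neg v)" using zv x(1) by simp
    then show ?thesis using eig_inter_neg[OF two y(1)] y(2) by simp
  next
    assume "c1 = - 1"
    \<comment> \<open>The image of the point of y is now that of x - x', which is u y. Hence v
      negates u y while it fixes y, and u v + v u kills y.\<close>
    then have "clif u y \<in> eig (neg v)" using zv x(2) by simp
    then have "clif v (clif u y) = - clif u y" by (simp add: eig_neg_iff)
    moreover have "clif v y = y" using y(1) by (simp add: eig_iff)
    ultimately have "polar u v *s y = 0" using clif_anti[of u v y] by simp
    then show ?thesis using y(2) by (simp add: vector_mul_eq_0)
  qed
next
  assume p: "polar u v = 0"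
  have u0: "quad u \<noteq> 0" using u by simp
  \<comment> \<open>For orthogonal u and v the automorphism of u itself is the required
    witness.\<close>
  have "reflect u v = neg v" using p by (cases u; cases v) (simp add: reflect_def)
  then have "act u ` points_on (line v) = perp (points_on (line v))"
    using act_points[OF u0, of v] perp_line[OF v] by simp
  moreover have "act u P = P" if P: "P \<in> points_on (line u) \<union> perp (points_on (line u))" for P
  proof -
    obtain x where x: "x \<noteq> 0" "P = pt x" "x \<in> eig u \<or> x \<in> eig (neg u)"
      using P[unfolded perp_line[OF u]] by (auto simp: points_on_line)
    have "clif u x = 1 *s x \<or> clif u x = (- 1) *s x"
      using x(3) by (auto simp: eig_neg_iff) (auto simp: eig_iff)
    then obtain k where k: "k \<noteq> 0" "clif u x = k *s x"
      by (metis one_neq_zero neg_equal_0_iff_equal)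
    show ?thesis unfolding x(2) act_pt k(2) by (rule pt_smult[OF k(1)])
  qed
  ultimately show "anticommute (points_on (line u)) (points_on (line v))"
    using act_automorphism[OF u0] unfolding anticommute_def by blast
qed

lemma perp_image:
  assumes g: "Sp4_automorphism \<zeta> g" and A: "A \<subseteq> pg_points"
  shows "perp (g ` A) = g ` perp A"
proof (intro equalityI subsetI)
  have b: "bij_betw g pg_points pg_points"
    and adj: "\<And>x y. x \<in> pg_points \<Longrightarrow> y \<in> pg_points \<Longrightarrow> (g x = g y \<or> Sp4_adj \<zeta> (g x) (g y)) = (x = y \<or> Sp4_adj \<zeta> x y)"
    using g by (auto simp: Sp4_automorphism_def bij_betw_def inj_on_def)
  show "P \<in> g ` perp A" if P: "P \<in> perp (g ` A)" for P
  proof -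
    have "P \<in> g ` pg_points" using P b by (simp add: perp_def bij_betw_def)
    then obtain y where y: "y \<in> pg_points" "P = g y" by blast
    then have "y \<in> perp A" using P A adj by (auto simp: perp_def subset_iff)
    then show ?thesis using y by blast
  qed
  show "P \<in> perp (g ` A)" if P: "P \<in> g ` perp A" for P
  proof -
    obtain y where y: "y \<in> perp A" "P = g y" using P by blast
    then have "y \<in> pg_points" by (simp add: perp_def)
    then show ?thesis using y A adj b by (auto simp: perp_def subset_iff bij_betw_def)
  qed
qed

text \<open>The witness is the conjugate of f by g.\<close>

lemma anticommute_image:
  assumes g: "Sp4_automorphism \<zeta> g" and A: "A \<subseteq> pg_points" and B: "B \<subseteq> pg_points"
    and ac: "anticommute A B"
  shows "anticommute (g ` A) (g ` B)"
proof -
  obtain f where f: "Sp4_automorphism \<zeta> f" "\<forall>P \<in> A \<union> perp A. f P = P" "f ` B = perp B"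
    using ac unfolding anticommute_def by (elim exE conjE) simp
  let ?h = "inv_into pg_points g"
  let ?f = "g \<circ> (f \<circ> ?h)"
  have b: "bij_betw g pg_points pg_points" using g by (simp add: Sp4_automorphism_def)
  have h: "?h (g P) = P" if "P \<in> pg_points" for P
    using b that by (simp add: bij_betw_def)
  have "Sp4_automorphism \<zeta> ?f"
    by (intro Sp4_automorphism_comp Sp4_automorphism_inv g f)
  moreover have "?f P = P" if P: "P \<in> g ` A \<union> perp (g ` A)" for P
  proof -
    obtain Q where Q: "Q \<in> A \<union> perp A" "P = g Q"
      using P unfolding perp_image[OF g A] by blast
    then have "Q \<in> pg_points" using A by (auto simp: perp_def)
    then show ?thesis using h f(2) Q by simp
  qed
  moreover have "?f ` g ` B = perp (g ` B)"
  proof -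
    have "?h ` g ` B = B" using b B by (intro inv_into_image_cancel) (auto simp: bij_betw_def)
    then have "?f ` g ` B = g ` f ` B" by (simp only: image_comp[symmetric])
    then show ?thesis by (simp only: perp_image[OF g B] f(3))
  qed
  ultimately show ?thesis unfolding anticommute_def by blast
qed

definition orth_pairs :: "'a vec5 set \<Rightarrow> ('a vec5 \<times> 'a vec5) set" where
  "orth_pairs X = {(u, v). u \<in> X \<and> v \<in> X \<and> polar u v = 0}"

lemma anticommute_special:
  assumes X: "special X" and u: "u \<in> X" and v: "v \<in> X"
  shows "anticommute (points_on (line u)) (points_on (line v)) \<longleftrightarrow> polar u v = 0"
proof (rule anticommute_iff)
  show "quad u = 1" "quad v = 1" using special_quad[OF X] u v by auto
  have "v = u" if "x \<in> eig v" "x \<noteq> 0" "x \<in> eig u" for x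
    using special_unique[OF X v u _ _ that(2)] that by (simp add: eig_iff)
  moreover have "v = neg u" if "x \<in> eig v" "x \<noteq> 0" "x \<in> eig (neg u)" for x
    using special_unique[OF X v _ _ _ that(2), of "neg u"] special_neg[OF X] u that by (simp add: eig_iff)
  ultimately show "v = u \<or> v = neg u \<or> (\<forall>x. x \<in> eig v \<longrightarrow> x \<noteq> 0 \<longrightarrow> x \<notin> eig u \<and> x \<notin> eig (neg u))"
    by blast
qed

text \<open>Through the point sets of lines, g induces a bijection \<open>\<tau>\<close> of the unit
  vectors. Of the polar form only its vanishing is transported, by means of
  \<open>anticommute\<close>.\<close>

lemma orth_pairs_invariant:
  assumes X: "special X" and Y: "special Y"
    and e: "(line ` X, line ` Y) \<in> special_spread_equiv \<zeta>"
  shows "card (orth_pairs X) = card (orth_pairs Y)"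
proof -
  let ?p = "\<lambda>u. points_on (line u)"
  obtain g where g: "Sp4_automorphism \<zeta> g" and m: "(\<lambda>u. g ` ?p u) ` X = ?p ` Y"
    using e by (auto simp: special_spread_equiv_def maps_spread_def image_image)
  have sub: "?p u \<subseteq> pg_points" for u by (auto simp: points_on_def)
  have b: "bij_betw g pg_points pg_points" using g by (simp add: Sp4_automorphism_def)
  have gsub: "g ` ?p u \<subseteq> pg_points" for u
    using image_mono[OF sub, of g] bij_betw_imp_surj_on[OF b] by simp
  have pinj: "inj_on ?p Z" if "special Z" for Z
    using points_on_inject special_quad[OF that] by (auto simp: inj_on_def)
  define \<tau> where "\<tau> u = inv_into Y ?p (g ` ?p u)" for u
  have tY: "\<tau> u \<in> Y" and tp: "?p (\<tau> u) = g ` ?p u" if "u \<in> X" for u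
  proof -
    have *: "g ` ?p u \<in> ?p ` Y" using m that by blast
    show "\<tau> u \<in> Y" unfolding \<tau>_def using * by (rule inv_into_into)
    show "?p (\<tau> u) = g ` ?p u" unfolding \<tau>_def by (rule f_inv_into_f[OF *])
  qed
  have inj: "inj_on \<tau> X"
  proof (rule inj_onI)
    fix u v assume u: "u \<in> X" and v: "v \<in> X" and "\<tau> u = \<tau> v"
    then have "g ` ?p u = g ` ?p v" using tp[OF u] tp[OF v] by simp
    then have "?p u = ?p v" by (simp only: inj_on_image_eq_iff[OF bij_betw_imp_inj_on[OF b] sub sub])
    then show "u = v" by (rule inj_onD[OF pinj[OF X] _ u v])
  qed
  have surj: "\<tau> ` X = Y"
  proof
    show "Y \<subseteq> \<tau> ` X"
    proof
      fix v assume v: "v \<in> Y"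
      then have "?p v \<in> (\<lambda>u. g ` ?p u) ` X" unfolding m by blast
      then obtain u where u: "u \<in> X" "?p v = g ` ?p u" by blast
      then have "?p (\<tau> u) = ?p v" using tp by simp
      then have "\<tau> u = v" by (rule inj_onD[OF pinj[OF Y] _ tY[OF u(1)] v])
      then show "v \<in> \<tau> ` X" using u(1) by blast
    qed
  qed (rule image_subsetI, rule tY)
  have iff: "polar (\<tau> u) (\<tau> v) = 0 \<longleftrightarrow> polar u v = 0" if u: "u \<in> X" and v: "v \<in> X" for u v
  proof
    assume "polar u v = 0"
    then have "anticommute (?p u) (?p v)" using anticommute_special[OF X u v] by simp
    then have "anticommute (?p (\<tau> u)) (?p (\<tau> v))"
      using anticommute_image[OF g sub sub] by (simp add: tp u v)
    then show "polar (\<tau> u) (\<tau> v) = 0" using anticommute_special[OF Y] tY u v by blast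
  next
    assume "polar (\<tau> u) (\<tau> v) = 0"
    then have "anticommute (?p (\<tau> u)) (?p (\<tau> v))"
      using anticommute_special[OF Y tY[OF u] tY[OF v]] by simp
    then have "anticommute (g ` ?p u) (g ` ?p v)" by (simp add: tp u v)
    \<comment> \<open>The reverse implication comes from the inverse automorphism.\<close>
    then have "anticommute (inv_into pg_points g ` g ` ?p u) (inv_into pg_points g ` g ` ?p v)"
      by (rule anticommute_image[OF Sp4_automorphism_inv[OF g] gsub gsub])
    moreover have "inv_into pg_points g ` g ` ?p w = ?p w" for w
      using b sub[of w] by (intro inv_into_image_cancel) (auto simp: bij_betw_def)
    ultimately show "polar u v = 0" using anticommute_special[OF X u v] by simp
  qed
  have "bij_betw (map_prod \<tau> \<tau>) (orth_pairs X) (orth_pairs Y)"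
    unfolding bij_betw_def
  proof
    show "inj_on (map_prod \<tau> \<tau>) (orth_pairs X)"
      using inj by (auto simp: inj_on_def orth_pairs_def)
    show "map_prod \<tau> \<tau> ` orth_pairs X = orth_pairs Y"
    proof (intro equalityI subsetI)
      fix z assume "z \<in> orth_pairs Y"
      then obtain u v where "u \<in> X" "v \<in> X" "z = (\<tau> u, \<tau> v)" "polar (\<tau> u) (\<tau> v) = 0"
        using surj by (force simp: orth_pairs_def)
      then show "z \<in> map_prod \<tau> \<tau> ` orth_pairs X" using iff by (force simp: orth_pairs_def)
    qed (use iff tY in \<open>auto simp: orth_pairs_def\<close>)
  qed
  then show ?thesis by (rule bij_betw_same_card)
qed

end

section \<open>Counting the classes\<close>

fun separated_from :: "'a::field vec5 \<Rightarrow> 'a vec5 list \<Rightarrow> bool" where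
  "separated_from f [] = True"
| "separated_from f (v # vs) = (\<not> is_pm_two (pairing f v) \<and> separated_from f vs)"
fun separated :: "'a::field vec5 list \<Rightarrow> bool" where
  "separated [] = True"
| "separated (u # us) = (is_zero (quad u + - 1) \<and> separated_from (dual u) us \<and> separated us)"

fun inc_if :: "bool \<Rightarrow> num \<Rightarrow> num" where
  "inc_if True n = Num.inc n"
| "inc_if False n = n"
fun count_from :: "'a::field vec5 \<Rightarrow> 'a vec5 list \<Rightarrow> num \<Rightarrow> num" where
  "count_from f [] n = n"
| "count_from f (v # vs) n = count_from f vs (inc_if (is_zero (pairing f v)) n)"
fun count_all :: "'a::field vec5 list \<Rightarrow> 'a vec5 list \<Rightarrow> num \<Rightarrow> num" where
  "count_all [] vs n = n"
| "count_all (u # us) vs n = count_all us vs (count_from (dual u) vs n)"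
text \<open>The type \<open>num\<close> has no zero, so counting starts at one and the value exceeds
  the number of orthogonal pairs by one.\<close>

definition orth_count :: "'a::field vec5 list \<Rightarrow> num" where "orth_count r = count_all r r num.One"

lemmas count_rules = separated.simps separated_from.simps orth_count_def count_from.simps count_all.simps inc_if.simps Num.inc.simps

lemma separated_from_iff: "separated_from f vs \<longleftrightarrow> (\<forall>v\<in>set vs. \<not> is_pm_two (pairing f v))" by (induction vs) auto

lemma count_from_eq: "nat_of_num (count_from (dual u) vs n) = nat_of_num n + length (filter (\<lambda>v. polar u v = 0) vs)"
proof (induction vs arbitrary: n)
  case (Cons v vs)
  then show ?case by (cases "is_zero (pairing (dual u) v)") (auto simp: is_zero_def polar_def nat_of_num_inc)
qed simp
lemma count_all_eq:
  "nat_of_num (count_all us vs n) = nat_of_num n + (\<Sum>u\<leftarrow>us. length (filter (\<lambda>v. polar u v = 0) vs))"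
  by (induction us arbitrary: n) (auto simp: count_from_eq)

lemma separated_props:
  assumes "separated r"
  shows "distinct r" "\<forall>u\<in>set r. quad u = 1"
    "\<forall>u\<in>set r. \<forall>v\<in>set r. u \<noteq> v \<longrightarrow> polar u v \<noteq> 2 \<and> polar u v \<noteq> - 2"
proof -
  have "distinct r \<and> (\<forall>u\<in>set r. quad u = 1) \<and>
    (\<forall>u\<in>set r. \<forall>v\<in>set r. u \<noteq> v \<longrightarrow> polar u v \<noteq> 2 \<and> polar u v \<noteq> - 2)"
    using assms
  proof (induction r)
    case (Cons u r)
    have q: "quad u = 1" using Cons.prems by (simp add: is_zero_def)
    have b: "polar u v \<noteq> 2" "polar u v \<noteq> - 2" if "v \<in> set r" for v
      using Cons.prems that by (auto simp: separated_from_iff polar_def is_pm_two_def)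
    \<comment> \<open>A repeated unit vector would violate the test, as B(u, u) = 2.\<close>
    then have n: "u \<notin> set r" using polar_self[of u] q by auto
    have "polar v u \<noteq> 2" "polar v u \<noteq> - 2" if "v \<in> set r" for v
      using b[OF that] by (simp_all only: polar_sym[of v u] not_False_eq_True)
    note b' = this
    have s: "separated r" using Cons.prems by simp
    show ?case
    proof (intro conjI ballI impI)
      show "distinct (u # r)" using Cons.IH[OF s] n by simp
      show "quad w = 1" if "w \<in> set (u # r)" for w using that Cons.IH[OF s] q by auto
      fix w w' assume w: "w \<in> set (u # r)" "w' \<in> set (u # r)" "w \<noteq> w'"
      consider "w = u" "w' \<in> set r" | "w' = u" "w \<in> set r" | "w \<in> set r" "w' \<in> set r"
        using w by auto
      then have "polar w w' \<noteq> 2 \<and> polar w w' \<noteq> - 2"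
        using b b' Cons.IH[OF s] w(3) by cases simp_all
      then show "polar w w' \<noteq> 2" "polar w w' \<noteq> - 2" by simp_all
    qed
  qed simp
  then show "distinct r" "\<forall>u\<in>set r. quad u = 1"
    "\<forall>u\<in>set r. \<forall>v\<in>set r. u \<noteq> v \<longrightarrow> polar u v \<noteq> 2 \<and> polar u v \<noteq> - 2" by auto
qed

lemma pm_disjoint:
  assumes two: "(2 :: 'a::field) \<noteq> 0" and s: "separated (r :: 'a vec5 list)"
  shows "set r \<inter> neg ` set r = {}"
proof (rule ccontr)
  assume "set r \<inter> neg ` set r \<noteq> {}"
  then obtain u v where uv: "u \<in> set r" "v \<in> set r" "u = neg v" by auto
  have q: "quad v = 1" using separated_props(2)[OF s] uv by blast
  have p: "polar u v = - 2" using q by (simp add: uv(3) polar_neg polar_self)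
  show False
  proof (cases "u = v")
    case True
    then have "(2 :: 'a) = - 2" using p q by (simp add: polar_self)
    then have "(2 :: 'a) * 2 = 0" by (metis add.right_inverse mult_2)
    then show False using two by (metis mult_eq_0_iff)
  next
    case False
    then show False using separated_props(3)[OF s] uv p by blast
  qed
qed

lemma pm_eq: "pm A = A \<union> neg ` A"
  by (auto simp: image_iff) (metis neg_neg)+

lemma inj_neg: "inj_on neg A" by (metis inj_onI neg_neg)

lemma sum_pm:
  assumes two: "(2 :: 'a::field) \<noteq> 0" and s: "separated (r :: 'a vec5 list)"
    and f: "\<And>u. f (neg u) = (f u :: nat)"
  shows "sum f (pm (set r)) = 2 * sum f (set r)"
proof -
  have "sum f (pm (set r)) = sum f (set r) + sum f (neg ` set r)"
    unfolding pm_eq by (intro sum.union_disjoint pm_disjoint[OF two s]) auto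
  also have "sum f (neg ` set r) = sum f (set r)"
    by (subst sum.reindex[OF inj_neg]) (simp add: f)
  finally show ?thesis by simp
qed

text \<open>Orthogonality is insensitive to signs, so each ordered pair from the list accounts for
  four pairs of the set.\<close>

lemma card_orth_pairs:
  assumes two: "(2 :: 'a::field) \<noteq> 0" and s: "separated (r :: 'a vec5 list)"
  shows "card {(u, v). u \<in> pm (set r) \<and> v \<in> pm (set r) \<and> polar u v = 0} = 4 * (nat_of_num (orth_count r) - 1)"
proof -
  let ?X = "pm (set r)" and ?z = "\<lambda>u v :: 'a vec5. (if polar u v = 0 then 1 else 0) :: nat"
  have fin: "finite ?X" unfolding pm_eq by simp
  have "{(u, v). u \<in> ?X \<and> v \<in> ?X \<and> polar u v = 0} = (SIGMA u:?X. {v\<in>?X. polar u v = 0})" by auto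
  then have "card {(u, v). u \<in> ?X \<and> v \<in> ?X \<and> polar u v = 0} = (\<Sum>u\<in>?X. card {v\<in>?X. polar u v = 0})"
    using fin by (simp add: card_SigmaI)
  also have "\<dots> = (\<Sum>u\<in>?X. \<Sum>v\<in>?X. ?z u v)"
    using fin by (intro sum.cong refl) (simp add: sum.If_cases Int_def)
  also have "\<dots> = (\<Sum>u\<in>?X. 2 * (\<Sum>v\<in>set r. ?z u v))"
    by (intro sum.cong refl sum_pm[OF two s]) (simp add: polar_neg')
  also have "\<dots> = 2 * (\<Sum>u\<in>set r. 2 * (\<Sum>v\<in>set r. ?z u v))"
    by (intro sum_pm[OF two s]) (simp add: polar_neg)
  also have "\<dots> = 4 * (\<Sum>u\<in>set r. \<Sum>v\<in>set r. ?z u v)" by (simp add: sum_distrib_left)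
  also have "(\<Sum>v\<in>set r. ?z u v) = length (filter (\<lambda>v. polar u v = 0) r)" for u
  proof -
    have "length (filter (\<lambda>v. polar u v = 0) r) = card (set (filter (\<lambda>v. polar u v = 0) r))"
      using separated_props(1)[OF s] by (simp add: distinct_card del: set_filter)
    then show ?thesis by (simp add: sum.If_cases Int_def)
  qed
  then have "(\<Sum>u\<in>set r. \<Sum>v\<in>set r. ?z u v) = (\<Sum>u\<leftarrow>r. length (filter (\<lambda>v. polar u v = 0) r))"
    using separated_props(1)[OF s] by (simp add: sum_list_distinct_conv_sum_set)
  also have "\<dots> = nat_of_num (orth_count r) - 1" by (simp add: orth_count_def count_all_eq)
  finally show ?thesis .
qed

lemma card_eig:
  assumes two: "(2 :: 'a::{field, finite}) \<noteq> 0" and u: "quad u = (1 :: 'a)"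
  shows "card (eig u) = CARD('a)\<^sup>2"
proof -
  obtain p q where pq: "sform p q \<noteq> 0" "eig u = {s *s p + t *s q |s t. True}" by (rule eig_basis[OF two u])
  have qp: "sform q p \<noteq> 0" using pq(1) sform_sym[of q p] by simp
  have "inj (\<lambda>(s, t). s *s p + t *s q)"
  proof (rule injI, clarify)
    fix s t s' t' assume e: "s *s p + t *s q = s' *s p + t' *s q"
    have "s = s'"
      using arg_cong[OF e, of "\<lambda>x. sform x q"] pq(1) by (simp add: sform_add_left sform_smult_left)
    moreover have "t = t'"
      using arg_cong[OF e, of "\<lambda>x. sform x p"] qp by (simp add: sform_add_left sform_smult_left)
    ultimately show "s = s' \<and> t = t'" by simp
  qed
  moreover have "eig u = range (\<lambda>(s, t). s *s p + t *s q)" using pq(2) by auto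
  ultimately have "card (eig u) = card (UNIV :: ('a \<times> 'a) set)" by (simp add: card_image)
  then show ?thesis by (simp add: card_prod power2_eq_square)
qed

text \<open>The q^2 + 1 eigenspaces meet pairwise only in zero and have q^2 - 1 nonzero vectors
  each, together q^4 - 1, so they cover everything.\<close>

lemma special_pm:
  assumes two: "(2 :: 'a::{field, finite}) \<noteq> 0" and s: "separated (r :: 'a vec5 list)"
    and len: "2 * length r = CARD('a)\<^sup>2 + 1"
  shows "special (pm (set r))"
proof -
  let ?X = "pm (set r)"
  have q: "quad u = 1" if "u \<in> ?X" for u using that separated_props(2)[OF s] quad_neg by fastforce
  have fin: "finite ?X" unfolding pm_eq by simp
  have unique: "u = v" if h: "u \<in> ?X" "v \<in> ?X" "x \<in> eig u" "x \<in> eig v" "x \<noteq> 0" for u v x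
  proof -
    have "clif u x = x" "clif v x = x" using that(3,4) by (simp_all add: eig_iff)
    \<comment> \<open>A common fixed vector forces B(u, v) = 2, which among members of the set
      leaves only u = v.\<close>
    then have "polar u v *s x = x + x" using clif_anti[of u v x] by simp
    also have "\<dots> = 2 *s x" by (simp add: vec_eq_iff)
    finally have p: "polar u v = 2" using that(5) by (simp add: vector_mul_rcancel)
    have cl: "u' = v'" if "u' \<in> set r" "v' \<in> set r" "polar u' v' = 2 \<or> polar u' v' = - 2" for u' v'
      using separated_props(3)[OF s] that by blast
    have neg2: "(2 :: 'a) \<noteq> - 2"
    proof
      assume "(2 :: 'a) = - 2"
      then have "(2 :: 'a) * 2 = 0" by (metis add.right_inverse mult_2)
      then show False using two by (metis mult_eq_0_iff)
    qed
    have no: "polar u' (neg v') \<noteq> 2" if "u' \<in> set r" "v' \<in> set r" for u' v'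
    proof
      assume h: "polar u' (neg v') = 2"
      then have m: "polar u' v' = - 2" using polar_neg'[of u' v'] by (metis minus_minus)
      then have "u' = v'" using cl that by blast
      then show False using m neg2 separated_props(2)[OF s] that by (simp add: polar_self)
    qed
    consider "u \<in> set r" "v \<in> set r" | "u \<in> set r" "neg v \<in> set r"
      | "neg u \<in> set r" "v \<in> set r" | "neg u \<in> set r" "neg v \<in> set r" using h(1,2) by blast
    then show "u = v"
    proof cases
      case 1
      then show ?thesis using cl p by blast
    next
      case 2
      then show ?thesis using no[of u "neg v"] p by simp
    next
      case 3
      then show ?thesis using no[of v "neg u"] p polar_sym[of u v] by simp
    next
      case 4
      have "polar (neg u) (neg v) = 2" using p by (simp add: polar_neg polar_neg')
      then have "neg u = neg v" using cl 4 by blast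
      then show ?thesis by (metis neg_neg)
    qed
  qed
  have "card ?X = 2 * length r"
    using sum_pm[OF two s, of "\<lambda>_. 1"] distinct_card[OF separated_props(1)[OF s]] by simp
  then have cX: "card ?X = CARD('a)\<^sup>2 + 1" using len by simp
  have disj: "(eig u - {0}) \<inter> (eig v - {0}) = {}" if "u \<in> ?X" "v \<in> ?X" "u \<noteq> v" for u v
    using unique[OF that(1,2)] that(3) by blast
  have "card (\<Union>u\<in>?X. eig u - {0}) = (\<Sum>u\<in>?X. card (eig u - {0}))"
    using fin disj by (intro card_UN_disjoint ballI impI) simp_all
  also have "\<dots> = (\<Sum>u\<in>?X. CARD('a)\<^sup>2 - 1)"
  proof (intro sum.cong refl)
    fix u assume "u \<in> ?X"
    then show "card (eig u - {0}) = CARD('a)\<^sup>2 - 1"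
      by (simp only: card_Diff_singleton[OF eig_zero] card_eig[OF two q])
  qed
  also have "\<dots> = (CARD('a)\<^sup>2 + 1) * (CARD('a)\<^sup>2 - 1)" by (simp add: cX)
  also have "\<dots> = CARD('a) ^ 4 - 1"
  proof -
    have "(n + 1) * (n - 1) = n * n - 1" for n :: nat by (cases n) auto
    then have "(CARD('a)\<^sup>2 + 1) * (CARD('a)\<^sup>2 - 1) = CARD('a)\<^sup>2 * CARD('a)\<^sup>2 - 1" by blast
    also have "CARD('a)\<^sup>2 * CARD('a)\<^sup>2 = CARD('a) ^ 4"
      by (simp add: power2_eq_square power4_eq_xxxx mult.assoc)
    finally show ?thesis .
  qed
  also have "\<dots> = card (UNIV - {0 :: 'a ^ 4})" by (simp add: card_Diff_singleton)
  finally have "(\<Union>u\<in>?X. eig u - {0}) = UNIV - {0}" by (intro card_subset_eq) auto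
  then have cover: "\<exists>u\<in>?X. x \<in> eig u" if "x \<noteq> 0" for x using that by blast
  show ?thesis unfolding special_def
  proof (intro conjI ballI allI impI)
    show "quad u = 1" "neg u \<in> ?X" if "u \<in> ?X" for u using q[OF that] that by auto
    fix x :: "'a ^ 4" assume x: "x \<noteq> 0"
    obtain u where u: "u \<in> ?X" "x \<in> eig u" using cover[OF x] by blast
    show "\<exists>!u. u \<in> ?X \<and> clif u x = x"
    proof (rule ex1I[of _ u])
      show "u \<in> ?X \<and> clif u x = x" using u by (simp add: eig_iff)
      fix v assume "v \<in> ?X \<and> clif v x = x"
      then show "v = u" using unique[OF _ u(1) _ u(2) x] by (simp add: eig_iff)
    qed
  qed
qed

lemma grid_complete:
  "\<lbrakk>list_all2 (\<lambda>y ys. y \<in> set ys) ys xss; quad (vec5_of (rev ys @ p)) = 1\<rbrakk> \<Longrightarrow> vec5_of (rev ys @ p) \<in> set_tree (grid p xss)"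
proof (induction xss arbitrary: p ys)
  case (Cons xs xss)
  obtain y ys' where ys: "ys = y # ys'" "y \<in> set xs" "list_all2 (\<lambda>y ys. y \<in> set ys) ys' xss"
    using Cons.prems(1) unfolding list_all2_Cons2 by blast
  have "set_tree (grid (y # p) xss) \<subseteq> set_tree (grid_first p xs xss)"
    using ys(2) by (induction xs) (auto simp: set_join)
  moreover have "vec5_of (rev ys' @ y # p) \<in> set_tree (grid (y # p) xss)"
    by (rule Cons.IH[OF ys(3)]) (use Cons.prems(2) ys(1) in simp)
  ultimately show ?case using ys(1) by auto
qed (simp add: is_zero_def)

text \<open>A unit vector is nonzero; its first nonzero entry or the negative of that entry lies in
  \<open>hf\<close>, so u or \<open>neg u\<close> is listed.\<close>

lemma all_units_complete:
  assumes es: "\<And>x. x \<in> set es" and hf: "\<And>x. x \<noteq> 0 \<Longrightarrow> x \<in> set hf \<or> - x \<in> set hf" and u: "quad u = 1"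
  shows "u \<in> pm (set_tree (all_units hf es))"
proof -
  have half: "V a b c d e \<in> set_tree (all_units hf es)"
    if q: "quad (V a b c d e) = 1" and h: "a \<in> set hf \<or> a = 0 \<and> (b \<in> set hf \<or> b = 0 \<and> (c \<in> set hf \<or> c = 0 \<and>
      (d \<in> set hf \<or> d = 0 \<and> e \<in> set hf)))" for a b c d e
  proof -
    have 1: "V a b c d e \<in> set_tree (grid [] [hf, es, es, es, es])" if "a \<in> set hf"
      using grid_complete[of "[a, b, c, d, e]" "[hf, es, es, es, es]" "[]"] that es q by (simp del: grid.simps quad.simps)
    have 2: "V a b c d e \<in> set_tree (grid [0] [hf, es, es, es])" if "a = 0" "b \<in> set hf"
      using grid_complete[of "[b, c, d, e]" "[hf, es, es, es]" "[0]"] that es q by (simp del: grid.simps quad.simps)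
    have 3: "V a b c d e \<in> set_tree (grid [0, 0] [hf, es, es])" if "a = 0" "b = 0" "c \<in> set hf"
      using grid_complete[of "[c, d, e]" "[hf, es, es]" "[0, 0]"] that es q by (simp del: grid.simps quad.simps)
    have 4: "V a b c d e \<in> set_tree (grid [0, 0, 0] [hf, es])" if "a = 0" "b = 0" "c = 0" "d \<in> set hf"
      using grid_complete[of "[d, e]" "[hf, es]" "[0, 0, 0]"] that es q by (simp del: grid.simps quad.simps)
    have 5: "V a b c d e \<in> set_tree (grid [0, 0, 0, 0] [hf])" if "a = 0" "b = 0" "c = 0" "d = 0" "e \<in> set hf"
      using grid_complete[of "[e]" "[hf]" "[0, 0, 0, 0]"] that es q by (simp del: grid.simps quad.simps)
    consider (a) "a \<in> set hf" | (b) "a = 0" "b \<in> set hf" | (c) "a = 0" "b = 0" "c \<in> set hf"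
      | (d) "a = 0" "b = 0" "c = 0" "d \<in> set hf" | (e) "a = 0" "b = 0" "c = 0" "d = 0" "e \<in> set hf"
      using h by blast
    then show ?thesis
    proof cases
      case a
      from 1[OF this] show ?thesis unfolding all_units_def set_join by blast
    next
      case b
      from 2[OF this] show ?thesis unfolding all_units_def set_join by blast
    next
      case c
      from 3[OF this] show ?thesis unfolding all_units_def set_join by blast
    next
      case d
      from 4[OF this] show ?thesis unfolding all_units_def set_join by blast
    next
      case e
      from 5[OF this] show ?thesis unfolding all_units_def set_join by blast
    qed
  qed
  obtain a b c d e where V: "u = V a b c d e" by (cases u)
  let ?h = "\<lambda>a b c d e. a \<in> set hf \<or> a = 0 \<and> (b \<in> set hf \<or> b = 0 \<and> (c \<in> set hf \<or> c = 0 \<and>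
      (d \<in> set hf \<or> d = 0 \<and> e \<in> set hf)))"
  have "\<not> (a = 0 \<and> b = 0 \<and> c = 0 \<and> d = 0 \<and> e = 0)" using u V by auto
  then consider "a \<noteq> 0" | "a = 0" "b \<noteq> 0" | "a = 0" "b = 0" "c \<noteq> 0"
    | "a = 0" "b = 0" "c = 0" "d \<noteq> 0" | "a = 0" "b = 0" "c = 0" "d = 0" "e \<noteq> 0" by blast
  then have "?h a b c d e \<or> ?h (- a) (- b) (- c) (- d) (- e)"
  proof cases
    case 1
    then show ?thesis using hf[of a] by blast
  next
    case 2
    then show ?thesis using hf[of b] by simp blast
  next
    case 3
    then show ?thesis using hf[of c] by simp blast
  next
    case 4
    then show ?thesis using hf[of d] by simp blast
  next
    case 5
    then show ?thesis using hf[of e] by simp blast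
  qed
  then show ?thesis
  proof
    assume "?h a b c d e"
    then show ?thesis using half[of a b c d e] u V by simp
  next
    assume "?h (- a) (- b) (- c) (- d) (- e)"
    then have "neg u \<in> set_tree (all_units hf es)" using half[of "- a" "- b" "- c" "- d" "- e"] u V by simp
    then show ?thesis by simp
  qed
qed

lemma (in symplectic_frame) card_classes:
  assumes sp: "\<And>r. r \<in> set R \<Longrightarrow> special (pm (set r))"
    and inv: "inj_on (\<lambda>r. card (orth_pairs (pm (set r)))) (set R)" "distinct R"
    and complete: "\<And>X. special X \<Longrightarrow> \<exists>r\<in>set R. (line ` X, line ` pm (set r)) \<in> special_spread_equiv \<zeta>"
  shows "card (special_spreads \<zeta> // special_spread_equiv \<zeta>) = length R"
proof -
  let ?E = "special_spread_equiv \<zeta>"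
  let ?S = "\<lambda>r. line ` pm (set r)"
  have eq: "equiv (special_spreads \<zeta>) ?E" by (rule equiv_special_spread_equiv)
  have "special_spreads \<zeta> // ?E = (\<lambda>r. ?E `` {?S r}) ` set R"
  proof (intro equalityI subsetI)
    fix C assume "C \<in> special_spreads \<zeta> // ?E"
    then obtain S where S: "S \<in> special_spreads \<zeta>" "C = ?E `` {S}" by (auto elim: quotientE)
    obtain X where X: "special X" "S = line ` X" by (rule special_spreadE[OF S(1)])
    obtain r where r: "r \<in> set R" "(line ` X, ?S r) \<in> ?E" using complete[OF X(1)] by blast
    then have "C = ?E `` {?S r}" using S(2) X(2) equiv_class_eq[OF eq] by blast
    then show "C \<in> (\<lambda>r. ?E `` {?S r}) ` set R" using r(1) by blast
  next
    fix C assume "C \<in> (\<lambda>r. ?E `` {?S r}) ` set R"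
    then obtain r where "r \<in> set R" "C = ?E `` {?S r}" by blast
    then show "C \<in> special_spreads \<zeta> // ?E" using special_spread_line[OF sp] by (auto intro: quotientI)
  qed
  moreover have "inj_on (\<lambda>r. ?E `` {?S r}) (set R)"
  proof (rule inj_onI)
    fix r s assume r: "r \<in> set R" and s: "s \<in> set R" and "?E `` {?S r} = ?E `` {?S s}"
    then have "(?S r, ?S s) \<in> ?E"
      using special_spread_line[OF sp] eq_equiv_class[OF _ eq] by blast
    then have "card (orth_pairs (pm (set r))) = card (orth_pairs (pm (set s)))"
      using orth_pairs_invariant sp r s by blast
    then show "r = s" by (rule inj_onD[OF inv(1) _ r s])
  qed
  ultimately show ?thesis using distinct_card[OF inv(2)] by (simp add: card_image)
qed

lemma isSome_iff: "isSome x \<longleftrightarrow> (\<exists>y. x = Some y)" by (cases x) auto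

lemma count_special_spreads:
  fixes \<zeta> :: "('a::{field, finite} ^ 4) set \<Rightarrow> ('a ^ 4) set"
  assumes \<zeta>: "symplectic_polarity \<zeta>" and two: "(2 :: 'a) \<noteq> 0"
    and separated: "list_all separated (deferred R)"
    and len: "list_all (\<lambda>r. 2 * length r = CARD('a)\<^sup>2 + 1) R"
    and dist: "distinct (map orth_count (deferred R))"
    and es: "\<And>x :: 'a. x \<in> set es" and hf: "\<And>x :: 'a. x \<noteq> 0 \<Longrightarrow> x \<in> set hf \<or> - x \<in> set hf"
    and check: "isSome (check R [] [] (all_units hf es) c)"
  shows "card (special_spreads \<zeta> // special_spread_equiv \<zeta>) = length R"
proof -
  have "\<exists>\<phi>. symplectic_frame \<zeta> \<phi>"
    using \<zeta> two by (rule_tac symplectic_coordinates[OF \<zeta>], rule_tac exI, rule_tac symplectic_frame.intro)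
      (simp_all add: symplectic_polarity_def)
  then obtain \<phi> where "symplectic_frame \<zeta> \<phi>" ..
  then interpret symplectic_frame \<zeta> \<phi> .
  have sepR: "separated r" if "r \<in> set R" for r using separated that by (simp add: list_all_iff deferred_def)
  have sp: "special (pm (set r))" if "r \<in> set R" for r
    using special_pm[OF two sepR[OF that]] len that by (simp add: list_all_iff)
  have eq: "equiv (special_spreads \<zeta>) (special_spread_equiv \<zeta>)" by (rule equiv_special_spread_equiv)
  interpret checker "\<lambda>X. \<exists>r\<in>set R. (line ` X, line ` pm (set r)) \<in> special_spread_equiv \<zeta>" R
  proof
    fix X w assume X: "special X" and w: "quad w \<noteq> 0"
      and "\<exists>r\<in>set R. (line ` reflect w ` X, line ` pm (set r)) \<in> special_spread_equiv \<zeta>"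
    then show "\<exists>r\<in>set R. (line ` X, line ` pm (set r)) \<in> special_spread_equiv \<zeta>"
      using equiv_reflect[OF X w] eq unfolding equiv_def by (meson transD)
  next
    fix X r assume X: "special X" and r: "r \<in> set R" and sub: "X \<subseteq> pm (set r)"
    have "X = pm (set r)" by (rule special_subset_eq[OF X sp[OF r] sub])
    then have "(line ` X, line ` pm (set r)) \<in> special_spread_equiv \<zeta>"
      using special_spread_line[OF X] eq unfolding equiv_def refl_on_def by auto
    then show "\<exists>r\<in>set R. (line ` X, line ` pm (set r)) \<in> special_spread_equiv \<zeta>" using r by blast
  qed
  have "confined [] (all_units hf es)"
    unfolding confined_def using all_units_complete[OF es hf] special_quad by auto
  \<comment> \<open>The empty configuration is contained in every special set, so settling it
    settles all of them.\<close>
  then have "good []" using check_sound(1)[of "[]" "[]" "all_units hf es" c] check by (auto simp: isSome_iff)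
  then have complete: "\<exists>r\<in>set R. (line ` X, line ` pm (set r)) \<in> special_spread_equiv \<zeta>" if "special X" for X
    using that by (simp add: good_def)
  have "card (orth_pairs (pm (set r))) = 4 * (nat_of_num (orth_count r) - 1)" if "r \<in> set R" for r
    unfolding orth_pairs_def by (rule card_orth_pairs[OF two sepR[OF that]])
  moreover have "nat_of_num (orth_count r) - 1 = nat_of_num (orth_count s) - 1 \<Longrightarrow> orth_count r = orth_count s" for r s :: "'a vec5 list"
    using nat_of_num_pos[of "orth_count r"] nat_of_num_pos[of "orth_count s"] num_eq_iff[of "orth_count r" "orth_count s"] by linarith
  ultimately have "inj_on (\<lambda>r. card (orth_pairs (pm (set r)))) (set R)"
    using dist by (auto simp: inj_on_def distinct_map deferred_def)
  moreover have "distinct R" using dist by (simp add: distinct_map deferred_def)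
  ultimately show ?thesis using sp complete by (intro card_classes) simp_all
qed

section \<open>Orders three, five and seven\<close>

text \<open>Adding 1 permutes the ring, so the sum of all elements equals itself plus the number of
  elements.\<close>

lemma of_nat_CARD: "of_nat CARD('a) = (0 :: 'a :: {ring_1, finite})"
proof -
  have "(\<Sum>x\<in>UNIV. x + 1) = (\<Sum>x\<in>UNIV. x :: 'a)"
    by (rule sum.reindex_bij_witness[of _ "\<lambda>x. x - 1" "\<lambda>x. x + 1"]) auto
  then show ?thesis by (simp add: sum.distrib)
qed

lemma numeral_mod:
  assumes "of_nat q = (0 :: 'a::semiring_1)"
  shows "numeral k = (of_nat (numeral k mod q) :: 'a)"
proof -
  have "numeral k = (of_nat (q * (numeral k div q) + numeral k mod q) :: 'a)" by simp
  then show ?thesis by (simp only: of_nat_add of_nat_mult assms mult_zero_left add_0)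
qed

text \<open>Reduces every comparison of field elements to the tables for negation, addition and
  \<open>is_zero\<close>.\<close>

lemma eq_is_zero: "x = y \<longleftrightarrow> is_zero (x + - y)" for x y :: "'a::field"
  by (simp add: is_zero_def)
lemma is_zero_unit: "a * b = 1 \<Longrightarrow> is_zero a = False" for a b :: "'a::field"
  by (auto simp: is_zero_def)
lemma is_zero_zero: "is_zero 0 = True" by (simp add: is_zero_def)

lemma set_complete:
  assumes "distinct es" "length es = CARD('a::finite)"
  shows "x \<in> set (es :: 'a list)"
proof -
  have "set es = UNIV" using assms by (intro card_subset_eq) (simp_all add: distinct_card)
  then show ?thesis by simp
qed

section \<open>The field of three elements: five vectors, one for each pair of polar lines\<close>

definition reps3 :: "'a::field vec5 list list" where
  "reps3 = map (map decode_vec)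
[[36864,33344,33418,33425,32777]]"

text \<open>The root is the point (0, 0, 0, 1). Of its nine branches one is searched; the other
  eight are carried from it by a single reflection each.\<close>

definition tree3 :: cert where
  "tree3 =
(Br 4097 (Nx (Rec (Br 4161 (Nx (Rec (Leaf [] 1)) (Sx [33346] 1 (Sx [33345] 1 Dn))))) (Sx [36866]
1 (Sx [36865] 1 (Sx [37888] 1 (Sx [37890] 1 (Sx [37889] 1 (Sx [37376] 1 (Sx [37378] 1 (Sx [37377]
1 Dn))))))))))"

context
  assumes zero: "(3 :: 'a::field) = 0"
begin

lemma numerals3:
  "(3 :: 'a) = 0" "(4 :: 'a) = 1"
  by (rule trans[OF numeral_mod[of 3]], use zero in simp, simp)+

lemma add3:
  "0 + 0 = (0 :: 'a)" "0 + 1 = (1 :: 'a)" "0 + 2 = (2 :: 'a)" "1 + 0 = (1 :: 'a)"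
  "1 + 1 = (2 :: 'a)" "1 + 2 = (0 :: 'a)" "2 + 0 = (2 :: 'a)" "2 + 1 = (0 :: 'a)"
  "2 + 2 = (1 :: 'a)"
  by (simp_all add: numerals3)

lemma mult3:
  "0 * 0 = (0 :: 'a)" "0 * 1 = (0 :: 'a)" "0 * 2 = (0 :: 'a)" "1 * 0 = (0 :: 'a)"
  "1 * 1 = (1 :: 'a)" "1 * 2 = (2 :: 'a)" "2 * 0 = (0 :: 'a)" "2 * 1 = (2 :: 'a)"
  "2 * 2 = (1 :: 'a)"
  by (simp_all add: numerals3)

lemma uminus3:
  "- 0 = (0 :: 'a)" "- 1 = (2 :: 'a)" "- 2 = (1 :: 'a)"
  by (simp_all only: neg_eq_iff_add_eq_0 add3)

lemma inverse3:
  "inverse 0 = (0 :: 'a)" "inverse 1 = (1 :: 'a)" "inverse 2 = (2 :: 'a)"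
  by (rule inverse_zero, (rule inverse_unique, simp only: mult3)+)

lemma isz3:
  "is_zero (0 :: 'a) = True" "is_zero (1 :: 'a) = False" "is_zero (2 :: 'a) = False"
  by (rule is_zero_zero, rule is_zero_unit[of _ 1], simp only: mult3, rule is_zero_unit[of _ 2], simp only: mult3)

lemma bad3:
  "is_pm_two (0 :: 'a) = False" "is_pm_two (1 :: 'a) = True" "is_pm_two (2 :: 'a) = True"
  by (simp_all only: is_pm_two_def eq_is_zero uminus3 add3 isz3 simp_thms)

lemmas eval3 = eval_rules count_rules add3 mult3 uminus3 inverse3 isz3 bad3 eq_is_zero list.map
  trans[OF deferred_def[of reps3] reps3_def]

lemma search3: "isSome (check (reps3 :: 'a vec5 list list) [] [] (all_units [1] [0, 1, 2]) tree3)"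
  unfolding tree3_def by (simp only: eval3)

lemma separated_reps3: "list_all separated (deferred (reps3 :: 'a vec5 list list))"
  by (simp only: eval3 list.pred_inject)

lemma distinct_reps3: "distinct (map orth_count (deferred (reps3 :: 'a vec5 list list)))"
  by (simp only: eval3) simp

lemma elements3: "distinct ([0, 1, 2] :: 'a list)"
  by (simp only: distinct.simps list.set insert_iff empty_iff eq_is_zero uminus3 add3 isz3 simp_thms)

lemma halves3: "x \<in> set [0, 1, 2] \<Longrightarrow> x \<noteq> 0 \<Longrightarrow> x \<in> set [1] \<or> - x \<in> set ([1] :: 'a list)"
  unfolding list.set insert_iff empty_iff
  by (elim disjE; (hypsubst)?; simp only: eq_is_zero uminus3 add3 isz3 simp_thms)

end

lemma count3:
  fixes \<zeta> :: "('a::{field, finite} ^ 4) set \<Rightarrow> ('a ^ 4) set"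
  assumes \<zeta>: "symplectic_polarity \<zeta>" and q: "CARD('a) = 3"
  shows "card (special_spreads \<zeta> // special_spread_equiv \<zeta>) = 1"
proof -
  have z: "(3 :: 'a) = 0" using of_nat_CARD[where 'a = 'a] by (simp add: q)
  have es: "x \<in> set ([0, 1, 2] :: 'a list)" for x
    by (rule set_complete[OF elements3[OF z]]) (simp add: q)
  have two: "(2 :: 'a) \<noteq> 0" using isz3(3)[OF z] by (simp add: is_zero_def)
  have len: "list_all (\<lambda>r :: 'a vec5 list. 2 * length r = CARD('a)\<^sup>2 + 1) reps3"
    by (simp add: q reps3_def)
  have "card (special_spreads \<zeta> // special_spread_equiv \<zeta>) = length (reps3 :: 'a vec5 list list)"
    by (rule count_special_spreads[OF \<zeta> two separated_reps3[OF z] len distinct_reps3[OF z] es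
      halves3[OF z es] search3[OF z]])
  then show ?thesis by (simp add: reps3_def)
qed

section \<open>The field of five elements: two sets of thirteen pairs of polar lines\<close>

definition reps5 :: "'a::field vec5 list list" where
  "reps5 = map (map decode_vec)
[[36864,41600,43200,41105,41180,33553,41507,33955,42252,42593,43018,33420,33874],[36864,41600
,43200,41105,41180,33553,33506,33889,41500,43025,33483,33874,33948]]"

text \<open>Again one of the 25 branches at the root is searched, and single reflections account for
  the other 24.\<close>

definition tree5 :: cert where
  "tree5 =
(Br 4097 (Nx (Rec (Br 4161 (Nx (Rec (Br 4163 (Nx (Br 4168 (Nx (Rec (Br 4176 (Nx (Br 4641 Dn)
(Nx (Br 4180 (Nx (Br 4169 (Nx (Br 4170 (Nx (Leaf [] 1) Dn)) (Nx (Br 4170 (Nx (Leaf [33506] 1) Dn))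
(Nx (Br 4170 (Nx (Leaf [33496] 1) (Nx (Leaf [] 2) Dn))) Dn)))) Dn)) Dn)))) (Sx [32777] 1 (Sx
[33408,33472] 1 (Sx [33408,33490] 1 (Sx [37504,33484] 1 (Sx [37504,33488] 1 (Nx (Br 4170 (Sx
[33408,33473] 1 (Sx [33408,33504] 1 (Nx (Br 4171 (Sx [33475] 1 (Nx (Br 4176 (Nx (Br 4169 (Sx
[33474] 1 (Sx [38668,33299,33426] 1 Dn))) Dn)) Dn))) Dn)))) Dn)))))))) (Nx (Rec (Br 4184 (Nx
(Rec (Br 4176 (Nx (Rec (Br 4169 (Nx (Br 4171 Dn) Dn))) (Sx [33410,33474] 1 Dn)))) (Nx (Br 4169
(Nx (Br 4172 (Nx (Br 4177 (Sx [33369,33297] 1 Dn)) Dn)) Dn)) (Nx (Br 4194 (Nx (Br 4616 Dn) Dn))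
Dn))))) (Sx [33506,33505] 1 (Sx [33508,33505] 1 (Sx [38144] 1 Dn))))))) (Sx [33376,33378] 1 (Sx
[33292,33291] 1 (Sx [33300,33297] 1 (Sx [33412,33409] 1 (Sx [33344] 1 (Sx [33347] 1 (Sx [33345] 1
(Sx [33348] 1 (Sx [33346] 1 (Nx (Rec (Br 4162 (Nx (Rec (Br 4168 (Sx [33436] 1 (Sx [33418] 1 (Nx
(Br 4176 (Nx (Br 4169 (Sx [32865] 1 (Sx [32849] 1 (Sx [33417] 1 (Sx [33544,33420] 1 (Sx
[37440,37666] 1 Dn)))))) Dn)) Dn))))) (Sx [33540] 1 (Sx [33539] 1 (Sx [33538] 1 (Sx [33537] 1
Dn))))))) (Sx [33347] 1 (Sx [33345] 1 (Sx [33348] 1 (Sx [33346] 1 Dn))))))))))))))))) (Sx [36867]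
1 (Sx [36865] 1 (Sx [36868] 1 (Sx [36866] 1 (Sx [38400] 1 (Sx [38403] 1 (Sx [38401] 1 (Sx [38404]
1 (Sx [38402] 1 (Sx [37376] 1 (Sx [37379] 1 (Sx [37377] 1 (Sx [37380] 1 (Sx [37378] 1 (Sx [38912]
1 (Sx [38915] 1 (Sx [38913] 1 (Sx [38916] 1 (Sx [38914] 1 (Sx [37888] 1 (Sx [37891] 1 (Sx [37889]
1 (Sx [37892] 1 (Sx [37890] 1 Dn))))))))))))))))))))))))))"

context
  assumes zero: "(5 :: 'a::field) = 0"
begin

lemma numerals5:
  "(5 :: 'a) = 0" "(6 :: 'a) = 1" "(7 :: 'a) = 2" "(8 :: 'a) = 3" "(9 :: 'a) = 4"
  "(10 :: 'a) = 0" "(11 :: 'a) = 1" "(12 :: 'a) = 2" "(13 :: 'a) = 3" "(14 :: 'a) = 4"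
  "(15 :: 'a) = 0" "(16 :: 'a) = 1"
  by (rule trans[OF numeral_mod[of 5]], use zero in simp, simp)+

lemma add5:
  "0 + 0 = (0 :: 'a)" "0 + 1 = (1 :: 'a)" "0 + 2 = (2 :: 'a)" "0 + 3 = (3 :: 'a)"
  "0 + 4 = (4 :: 'a)" "1 + 0 = (1 :: 'a)" "1 + 1 = (2 :: 'a)" "1 + 2 = (3 :: 'a)"
  "1 + 3 = (4 :: 'a)" "1 + 4 = (0 :: 'a)" "2 + 0 = (2 :: 'a)" "2 + 1 = (3 :: 'a)"
  "2 + 2 = (4 :: 'a)" "2 + 3 = (0 :: 'a)" "2 + 4 = (1 :: 'a)" "3 + 0 = (3 :: 'a)"
  "3 + 1 = (4 :: 'a)" "3 + 2 = (0 :: 'a)" "3 + 3 = (1 :: 'a)" "3 + 4 = (2 :: 'a)"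
  "4 + 0 = (4 :: 'a)" "4 + 1 = (0 :: 'a)" "4 + 2 = (1 :: 'a)" "4 + 3 = (2 :: 'a)"
  "4 + 4 = (3 :: 'a)"
  by (simp_all add: numerals5)

lemma mult5:
  "0 * 0 = (0 :: 'a)" "0 * 1 = (0 :: 'a)" "0 * 2 = (0 :: 'a)" "0 * 3 = (0 :: 'a)"
  "0 * 4 = (0 :: 'a)" "1 * 0 = (0 :: 'a)" "1 * 1 = (1 :: 'a)" "1 * 2 = (2 :: 'a)"
  "1 * 3 = (3 :: 'a)" "1 * 4 = (4 :: 'a)" "2 * 0 = (0 :: 'a)" "2 * 1 = (2 :: 'a)"
  "2 * 2 = (4 :: 'a)" "2 * 3 = (1 :: 'a)" "2 * 4 = (3 :: 'a)" "3 * 0 = (0 :: 'a)"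
  "3 * 1 = (3 :: 'a)" "3 * 2 = (1 :: 'a)" "3 * 3 = (4 :: 'a)" "3 * 4 = (2 :: 'a)"
  "4 * 0 = (0 :: 'a)" "4 * 1 = (4 :: 'a)" "4 * 2 = (3 :: 'a)" "4 * 3 = (2 :: 'a)"
  "4 * 4 = (1 :: 'a)"
  by (simp_all add: numerals5)

lemma uminus5:
  "- 0 = (0 :: 'a)" "- 1 = (4 :: 'a)" "- 2 = (3 :: 'a)" "- 3 = (2 :: 'a)" "- 4 = (1 :: 'a)"
  by (simp_all only: neg_eq_iff_add_eq_0 add5)

lemma inverse5:
  "inverse 0 = (0 :: 'a)" "inverse 1 = (1 :: 'a)" "inverse 2 = (3 :: 'a)"
  "inverse 3 = (2 :: 'a)" "inverse 4 = (4 :: 'a)"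
  by (rule inverse_zero, (rule inverse_unique, simp only: mult5)+)

lemma isz5:
  "is_zero (0 :: 'a) = True" "is_zero (1 :: 'a) = False" "is_zero (2 :: 'a) = False"
  "is_zero (3 :: 'a) = False" "is_zero (4 :: 'a) = False"
  by (rule is_zero_zero, rule is_zero_unit[of _ 1], simp only: mult5, rule is_zero_unit[of _ 3], simp only: mult5, rule is_zero_unit[of _ 2], simp only: mult5, rule is_zero_unit[of _ 4], simp only: mult5)

lemma bad5:
  "is_pm_two (0 :: 'a) = False" "is_pm_two (1 :: 'a) = False" "is_pm_two (2 :: 'a) = True" "is_pm_two (3 :: 'a) = True"
  "is_pm_two (4 :: 'a) = False"
  by (simp_all only: is_pm_two_def eq_is_zero uminus5 add5 isz5 simp_thms)

lemmas eval5 = eval_rules count_rules add5 mult5 uminus5 inverse5 isz5 bad5 eq_is_zero list.map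
  trans[OF deferred_def[of reps5] reps5_def]

lemma search5: "isSome (check (reps5 :: 'a vec5 list list) [] [] (all_units [1, 2] [0, 1, 2, 3, 4]) tree5)"
  unfolding tree5_def by (simp only: eval5)

lemma separated_reps5: "list_all separated (deferred (reps5 :: 'a vec5 list list))"
  by (simp only: eval5 list.pred_inject)

lemma distinct_reps5: "distinct (map orth_count (deferred (reps5 :: 'a vec5 list list)))"
  by (simp only: eval5) simp

lemma elements5: "distinct ([0, 1, 2, 3, 4] :: 'a list)"
  by (simp only: distinct.simps list.set insert_iff empty_iff eq_is_zero uminus5 add5 isz5 simp_thms)

lemma halves5: "x \<in> set [0, 1, 2, 3, 4] \<Longrightarrow> x \<noteq> 0 \<Longrightarrow> x \<in> set [1, 2] \<or> - x \<in> set ([1, 2] :: 'a list)"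
  unfolding list.set insert_iff empty_iff
  by (elim disjE; (hypsubst)?; simp only: eq_is_zero uminus5 add5 isz5 simp_thms)

end

lemma count5:
  fixes \<zeta> :: "('a::{field, finite} ^ 4) set \<Rightarrow> ('a ^ 4) set"
  assumes \<zeta>: "symplectic_polarity \<zeta>" and q: "CARD('a) = 5"
  shows "card (special_spreads \<zeta> // special_spread_equiv \<zeta>) = 2"
proof -
  have z: "(5 :: 'a) = 0" using of_nat_CARD[where 'a = 'a] by (simp add: q)
  have es: "x \<in> set ([0, 1, 2, 3, 4] :: 'a list)" for x
    by (rule set_complete[OF elements5[OF z]]) (simp add: q)
  have two: "(2 :: 'a) \<noteq> 0" using isz5(3)[OF z] by (simp add: is_zero_def)
  have len: "list_all (\<lambda>r :: 'a vec5 list. 2 * length r = CARD('a)\<^sup>2 + 1) reps5"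
    by (simp add: q reps5_def)
  have "card (special_spreads \<zeta> // special_spread_equiv \<zeta>) = length (reps5 :: 'a vec5 list list)"
    by (rule count_special_spreads[OF \<zeta> two separated_reps5[OF z] len distinct_reps5[OF z] es
      halves5[OF z es] search5[OF z]])
  then show ?thesis by (simp add: reps5_def)
qed

section \<open>The field of seven elements: fourteen sets of 25 pairs of polar lines\<close>

definition reps7 :: "'a::field vec5 list list" where
  "reps7 = map (map decode_vec)
[[36870,36872,37466,39734,39286,42734,33932,42112,46802,47148,45356,43174,42508,33392,43872
,42278,37526,37974,40334,41164,41732,43076,45812,46708,48562],[36870,36872,37466,39734,39286
,43038,41246,42152,34612,47405,41578,42116,34571,46225,46868,46720,45082,38253,39597,39769
,46272,47316,48540,48562,33953],[36870,36872,37466,39734,41996,38746,45100,39642,39028,43300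
,34545,48337,47872,46272,39700,41356,41698,42094,42715,46377,46493,33691,33953,34051,34096],[
36870,36872,37466,39734,41996,38746,45100,34048,45908,40110,41164,42594,33352,37749,44388,38109
,41636,41818,44174,46274,46708,47876,34011,34396,34632],[36870,36872,37466,39734,46288,47872
,38746,48426,47786,42204,45105,42594,44204,37713,37749,38109,41818,42603,43682,44174,44322
,46273,33801,34048,32969],[36870,36872,37466,40364,39541,37749,38289,40081,32905,34048,43426
,45105,42412,33801,41707,41818,42603,43610,44204,44322,45673,48562,33350,33392,34624],[36870
,36872,37466,40364,39541,37749,44458,43864,38041,37454,45164,47316,34627,42204,48154,43750
,41356,41502,41610,44131,46722,47325,47424,47912,48018],[36870,36872,37466,40364,39765,45082
,40990,39858,40306,46274,46722,42114,46877,42120,33971,46225,39218,41574,42766,43214,43872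
,47325,33368,34020,34468],[36870,36872,37653,32777,45105,38997,38037,42698,48216,44427,45976
,33376,46802,48045,34020,34011,37554,37545,38193,42854,43950,46724,47428,47836,34628],[36870
,36872,37653,32777,45105,34624,40149,38193,46364,39541,47428,43598,34403,44322,39505,40369
,44331,46421,46724,46744,47448,47509,48426,48540,34140],[36870,36872,37653,32777,45105,34624
,40149,39261,43356,43682,44331,42594,43691,43598,38289,38325,39252,42603,44322,46698,46720
,47425,47472,47786,48426],[36870,36872,37653,32777,45105,34624,40149,41698,45802,41707,42382
,39541,39505,34468,47448,38289,44322,34459,38325,43598,44331,46724,46744,47428,48426],[36870
,36872,37653,32777,45297,48177,40149,37454,33350,33352,39505,47029,42144,43723,47513,38193
,34187,38282,43872,44454,45956,47221,47796,48196,34403],[36870,36872,37653,32777,45297,48177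
,40149,37454,33350,33352,39505,47029,42144,46386,41698,45802,42282,39018,39541,41707,42115
,42382,43840,46377,46993]]"

text \<open>Each representative also occurs at a leaf without reflections, as a completion reached
  by the search itself. At the root, the point (0, 1, 5, 2), 48 of the 49 branches are single
  reflections of the first.\<close>

definition tree7 :: cert where
  "tree7 =
(Br 4202 (Nx (Rec (Br 4653 (Nx (Rec (Br 4746 (Nx (Rec (Br 4852 (Nx (Rec (Br 4876 (Nx (Rec (Br
5003 (Nx (Br 4812 (Nx (Br 4173 (Nx (Br 4881 (Nx (Br 4742 Dn) Dn)) Dn)) (Nx (Br 4766 (Nx (Br 4190
(Nx (Br 4660 (Nx (Br 4672 Dn) Dn)) (Nx (Br 4885 (Nx (Br 4993 Dn) (Nx (Br 4914 (Nx (Br 4776 (Nx (Br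
4211 (Nx (Br 4835 (Nx (Br 4874 (Nx (Br 4745 (Nx (Leaf [] 1) Dn)) Dn)) Dn)) Dn)) Dn)) Dn)) Dn)))
Dn))) (Nx (Br 4749 (Nx (Br 4620 (Nx (Br 5001 (Nx (Br 5041 (Nx (Br 4853 (Nx (Br 4712 (Nx (Br 4912
(Nx (Br 5030 (Nx (Leaf [33632] 1) Dn)) Dn)) Dn)) Dn)) Dn)) Dn)) Dn)) Dn)) (Nx (Br 4897 (Nx (Br
4892 (Nx (Br 5011 (Nx (Br 4875 (Nx (Br 4633 (Nx (Br 4869 (Nx (Br 4673 (Nx (Leaf [39185] 1) Dn))
Dn)) Dn)) Dn)) Dn)) (Nx (Br 4762 (Nx (Br 4929 (Nx (Br 4828 (Nx (Br 4673 (Nx (Br 4674 (Nx (Leaf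
[33512,39185] 1) Dn)) Dn)) Dn)) Dn)) Dn)) Dn))) Dn)) (Nx (Br 5041 (Nx (Br 4717 (Nx (Br 4949 Dn)
Dn)) (Nx (Br 5019 (Nx (Br 4764 Dn) (Nx (Br 4756 (Nx (Br 4893 (Nx (Br 4208 (Nx (Br 4640 (Nx (Leaf
[33512] 1) Dn)) Dn)) Dn)) Dn)) Dn))) Dn))) (Nx (Br 5013 (Nx (Br 4768 (Nx (Br 4710 (Nx (Br 4953 (Nx
(Br 4699 (Nx (Br 4853 (Nx (Br 4754 (Nx (Leaf [33632,39185] 1) Dn)) Dn)) Dn)) Dn)) Dn)) Dn)) Dn))
Dn)))))) (Nx (Br 4172 (Nx (Br 4913 (Nx (Br 4676 Dn) Dn)) Dn)) Dn)))) (Nx (Br 4714 (Nx (Br 4842 (Nx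
(Br 4768 (Nx (Br 4683 (Nx (Br 4749 (Nx (Br 4649 Dn) Dn)) Dn)) Dn)) (Nx (Br 4688 (Nx (Br 4193 (Nx
(Br 4976 (Nx (Br 4628 (Nx (Br 4705 (Nx (Br 4209 (Nx (Br 4617 (Nx (Br 4899 (Nx (Br 4849 (Nx (Leaf
[] 2) Dn)) Dn)) Dn)) (Nx (Br 5043 (Nx (Br 4766 (Nx (Leaf [39185] 2) Dn)) Dn)) Dn))) Dn)) Dn)) Dn))
Dn)) Dn)) Dn))) (Nx (Br 4657 (Nx (Br 5042 Dn) (Nx (Br 4693 (Nx (Br 4915 (Nx (Br 4754 (Nx (Br 5037
(Nx (Br 4692 (Nx (Br 4880 (Nx (Leaf [33512] 2) Dn)) Dn)) Dn)) Dn)) Dn)) Dn)) Dn))) (Nx (Br 5033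
(Nx (Br 5011 (Nx (Br 4966 (Nx (Br 4752 (Nx (Br 4742 (Nx (Br 4894 (Nx (Br 4737 (Nx (Br 4172 (Nx
(Leaf [32777,40149] 2) Dn)) Dn)) Dn)) Dn)) Dn)) Dn)) Dn)) (Nx (Br 4190 (Nx (Br 4778 Dn) Dn)) Dn)))
Dn)))) (Nx (Br 4900 (Nx (Br 4620 (Nx (Br 4190 (Nx (Br 4953 (Nx (Br 4882 (Nx (Br 4672 (Nx (Br 4748
(Nx (Br 4616 (Nx (Leaf [33632] 2) Dn)) Dn)) Dn)) Dn)) Dn)) Dn)) (Nx (Br 4172 Dn) Dn))) (Nx (Br
4840 (Nx (Br 4632 (Nx (Br 4970 (Nx (Br 4946 Dn) Dn)) Dn)) Dn)) Dn))) (Nx (Br 4756 (Nx (Br 4776 (Nx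
(Br 4937 (Nx (Br 5027 Dn) Dn)) Dn)) (Nx (Br 4900 (Nx (Br 4938 (Nx (Br 4763 (Nx (Br 4872 (Nx (Br
4979 (Nx (Br 5018 (Nx (Br 4610 (Nx (Leaf [32777,38805] 2) Dn)) Dn)) Dn)) Dn)) Dn)) (Nx (Br 5014
(Nx (Br 4905 Dn) Dn)) Dn))) (Nx (Br 4165 Dn) Dn))) Dn))) Dn)))))) (Nx (Rec (Br 4882 (Nx (Br 4610
(Nx (Br 5018 (Nx (Br 4915 (Nx (Br 4850 (Nx (Br 4812 (Nx (Br 4933 (Nx (Br 4877 (Nx (Br 4843 (Nx
(Leaf [] 3) Dn)) Dn)) Dn)) Dn)) Dn)) Dn)) (Nx (Br 4658 (Nx (Br 4694 (Nx (Br 5028 (Nx (Br 4741 (Nx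
(Br 4678 (Nx (Br 4699 (Nx (Br 4888 (Nx (Leaf [] 4) Dn)) Dn)) Dn)) Dn)) Dn)) Dn)) Dn)) Dn))) (Sx
[32777,37717,38037] 1 Dn))) (Nx (Br 4956 (Nx (Br 4979 (Nx (Br 5003 (Nx (Br 4185 (Nx (Br 4789 (Nx
(Br 4714 (Nx (Br 4974 (Nx (Br 4194 (Nx (Br 4189 (Nx (Leaf [39185] 3) Dn)) Dn)) Dn)) Dn)) Dn)) Dn))
Dn)) (Nx (Br 4209 (Nx (Br 4781 (Nx (Br 4196 (Nx (Br 4700 (Nx (Br 4954 (Nx (Br 4817 (Nx (Br 4760
(Nx (Leaf [39125] 3) Dn)) Dn)) Dn)) Dn)) Dn)) Dn)) Dn)) Dn))) (Nx (Br 4750 (Nx (Br 5028 (Nx (Br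
4896 (Nx (Br 4976 (Nx (Br 4652 (Nx (Br 4714 (Nx (Br 4169 (Nx (Br 4875 (Nx (Leaf [38037] 3) Dn))
Dn)) Dn)) Dn)) Dn)) Dn)) Dn)) (Nx (Br 4980 (Nx (Br 5020 (Nx (Br 4705 (Nx (Br 4915 (Nx (Br 4164 (Nx
(Br 4176 (Nx (Br 4748 (Nx (Br 4189 (Nx (Leaf [39125] 4) Dn)) Dn)) Dn)) Dn)) Dn)) Dn)) Dn)) Dn))
Dn))) Dn))) (Sx [32777,38805] 1 (Nx (Br 5033 (Nx (Br 4654 (Nx (Br 4659 (Nx (Br 4110 Dn) Dn)) (Nx
(Br 4618 Dn) Dn))) (Nx (Br 5019 (Nx (Br 4108 (Nx (Br 4930 (Nx (Br 4716 (Nx (Br 4819 (Nx (Br 4758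
(Nx (Br 4721 (Nx (Leaf [39185] 4) Dn)) Dn)) Dn)) Dn)) Dn)) Dn)) Dn)) (Nx (Br 4659 (Nx (Br 4947 (Nx
(Br 4700 (Nx (Br 4169 (Nx (Br 4724 (Nx (Br 4672 (Nx (Br 4704 (Nx (Leaf [39185,39125] 4) Dn)) Dn))
Dn)) Dn)) Dn)) Dn)) Dn)) Dn)))) Dn)))))) (Nx (Rec (Br 4187 (Nx (Br 4750 (Sx [33632] 1 (Sx [38469]
1 Dn))) (Sx [36973,40141] 1 (Nx (Br 4714 (Sx [32777,38805] 2 (Nx (Br 4755 (Nx (Br 4646 Dn) Dn))
(Nx (Br 4690 (Nx (Br 4717 (Nx (Br 5013 Dn) Dn)) Dn)) (Nx (Br 5001 (Nx (Br 4810 (Nx (Br 5046 Dn)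
Dn)) (Nx (Br 4994 (Nx (Br 4849 (Nx (Br 4914 (Nx (Br 4868 (Sx [39852,38230,38469] 1 Dn)) Dn)) Dn))
Dn)) Dn))) Dn))))) Dn))))) (Nx (Rec (Br 5009 (Sx [33632] 2 (Nx (Br 4868 (Nx (Br 4843 (Sx
[39212,37590,38469] 2 (Nx (Br 4914 (Sx [39852,38230] 2 (Nx (Br 4194 (Nx (Br 4770 (Nx (Br 4737 (Nx
(Br 4872 (Nx (Leaf [] 5) Dn)) Dn)) Dn)) Dn)) Dn))) Dn))) (Sx [32777,38469,38581] 3 (Sx
[32777,38469,38581] 2 Dn)))) (Sx [33632] 1 (Nx (Br 4192 (Nx (Br 4659 (Nx (Br 4998 (Nx (Br 4626 (Nx
(Br 4973 (Sx [32777,38805] 2 Dn)) Dn)) Dn)) Dn)) (Nx (Br 4612 (Nx (Br 4659 (Nx (Br 4189 (Nx (Br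
4628 (Sx [32777,38805] 1 Dn)) Dn)) Dn)) (Nx (Br 4211 (Nx (Br 4754 (Sx [32777,37301,39845] 1 Dn))
Dn)) Dn))) (Nx (Br 4612 (Nx (Br 4842 (Sx [32777,38997,33408] 1 Dn)) (Nx (Br 4888 (Nx (Br 4997 (Nx
(Br 4893 (Nx (Br 4753 (Sx [39333,37382,40080] 2 Dn)) Dn)) Dn)) Dn)) Dn))) Dn)))) Dn)))))) (Nx (Br
4750 (Sx [33632] 3 (Sx [33632] 1 (Nx (Br 5001 (Nx (Br 4772 (Nx (Br 4853 Dn) Dn)) (Sx [32777,38805]
3 Dn))) Dn)))) Dn))))))) (Nx (Br 5000 (Nx (Rec (Br 4756 (Nx (Br 5027 (Nx (Br 4108 (Nx (Br 4168
(Nx (Br 4884 (Nx (Br 4964 (Nx (Br 4622 Dn) Dn)) Dn)) (Nx (Br 4915 (Nx (Br 4698 (Nx (Br 4651 Dn)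
Dn)) Dn)) (Nx (Br 4894 (Nx (Br 4698 (Nx (Br 4886 (Nx (Br 4192 (Nx (Br 4811 (Nx (Br 4969 (Nx (Br
4656 (Nx (Br 4972 (Nx (Br 4702 (Sx [33508,37109,38097] 1 (Sx [39953,38097,33345] 1 Dn))) Dn)) Dn))
Dn)) Dn)) Dn)) Dn)) Dn)) Dn)) (Nx (Br 4894 (Nx (Br 4769 (Nx (Br 4770 (Nx (Br 4952 (Nx (Br 4971 (Nx
(Leaf [] 6) Dn)) Dn)) Dn)) Dn)) Dn)) Dn))))) Dn)) (Nx (Br 4813 (Nx (Br 4838 (Nx (Br 4698 (Nx (Br
4748 (Sx [33350,39190,33412] 1 Dn)) Dn)) Dn)) Dn)) (Nx (Br 4700 (Nx (Br 4108 (Nx (Br 4764 (Nx (Br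
4897 (Nx (Br 4779 (Nx (Br 4628 (Nx (Br 4636 (Nx (Br 4954 (Nx (Br 4977 (Nx (Leaf [] 7) Dn)) Dn))
Dn)) Dn)) Dn)) (Nx (Br 4694 (Nx (Br 4976 (Nx (Br 4950 (Nx (Leaf [36885] 7) Dn)) Dn)) Dn)) Dn)))
Dn)) (Nx (Br 4750 (Nx (Br 4620 (Nx (Br 4820 (Sx [33348,38545,39441] 1 Dn)) Dn)) Dn)) Dn))) Dn))
(Nx (Br 4970 (Nx (Br 4617 Dn) Dn)) Dn))))) (Nx (Br 4960 (Nx (Br 4785 (Nx (Br 4952 (Nx (Br 4946 (Nx
(Br 4168 (Nx (Br 4632 (Nx (Br 4212 Dn) (Nx (Br 4883 (Nx (Br 4720 (Nx (Br 4806 (Nx (Leaf [40109] 6)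
Dn)) Dn)) Dn)) Dn))) Dn)) Dn)) Dn)) Dn)) (Nx (Br 4976 (Nx (Br 4744 (Nx (Br 4866 (Nx (Br 4189 Dn)
Dn)) Dn)) Dn)) (Nx (Br 5009 (Nx (Br 4213 (Nx (Br 4962 Dn) (Nx (Br 5035 (Nx (Br 4632 (Nx (Br 4630
(Nx (Br 5011 (Nx (Leaf [37398,33412] 7) Dn)) Dn)) Dn)) Dn)) Dn))) Dn)) Dn)))) (Nx (Br 4726 (Nx (Br
4998 (Nx (Br 4678 Dn) (Nx (Br 4724 (Nx (Br 4930 (Nx (Br 4765 (Nx (Br 4802 (Nx (Br 4883 (Nx (Br
4712 (Nx (Leaf [38165,38613] 7) Dn)) Dn)) Dn)) Dn)) Dn)) Dn)) Dn))) (Nx (Br 4790 Dn) Dn))) (Nx (Br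
4698 (Nx (Br 4726 Dn) (Nx (Br 4812 (Nx (Br 4827 Dn) (Nx (Br 4899 (Nx (Br 4624 (Nx (Br 4848 (Nx (Br
4822 (Nx (Br 4849 (Nx (Br 5041 (Nx (Leaf [40080] 7) Dn)) Dn)) Dn)) Dn)) Dn)) Dn)) Dn))) Dn))) (Nx
(Br 4929 (Nx (Br 4616 (Nx (Br 4875 (Nx (Br 4974 (Nx (Br 4962 (Nx (Br 5018 (Nx (Br 4715 (Nx (Leaf
[38741] 7) Dn)) Dn)) Dn)) Dn)) (Nx (Br 4773 Dn) Dn))) (Nx (Br 4742 (Nx (Br 4800 Dn) Dn)) (Nx (Br
4938 (Nx (Br 4208 (Nx (Br 4908 (Nx (Br 4717 (Nx (Br 4800 Dn) (Nx (Br 4627 (Nx (Br 4890 (Nx (Br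
4826 (Nx (Br 4659 (Nx (Leaf [39693] 6) Dn)) Dn)) (Nx (Br 4108 Dn) Dn))) Dn)) Dn))) Dn)) Dn)) Dn))
Dn)))) (Sx [39764,33473,33348] 1 (Sx [37201,37392,38420] 1 Dn)))) Dn))))))) (Nx (Rec (Br 4953 (Nx
(Br 4689 (Nx (Br 4752 (Sx [38645,37747,38299,40114] 2 Dn)) (Nx (Br 4765 (Nx (Br 4940 (Nx (Br 4182
(Sx [40021] 1 Dn)) Dn)) (Nx (Br 4678 (Nx (Br 4192 (Nx (Br 4677 (Nx (Br 4892 Dn) Dn)) Dn)) Dn))
Dn))) (Sx [36899,40021] 1 (Nx (Br 4954 (Nx (Br 4947 (Nx (Br 4789 Dn) Dn)) (Nx (Br 4946 (Sx
[38417,40147,40208] 2 Dn)) Dn))) Dn))))) (Nx (Br 4898 (Nx (Br 4686 (Nx (Br 4635 (Nx (Br 4828 (Nx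
(Br 4652 (Nx (Br 4870 (Sx [39760,37396,37904] 2 Dn)) Dn)) Dn)) Dn)) (Nx (Br 4881 Dn) Dn))) (Nx (Br
4771 (Nx (Br 4835 (Nx (Br 4182 Dn) Dn)) Dn)) Dn))) (Nx (Br 4716 (Nx (Br 4805 (Nx (Br 4633 Dn) (Nx
(Br 5044 (Nx (Br 4912 Dn) Dn)) Dn))) (Nx (Br 4656 (Nx (Br 4758 Dn) Dn)) (Nx (Br 5010 (Nx (Br 4770
(Sx [33371,38611] 2 Dn)) (Nx (Br 4873 Dn) Dn))) Dn)))) (Nx (Br 4722 (Nx (Br 4705 (Nx (Br 4747 Dn)
Dn)) (Nx (Br 4633 (Nx (Br 4752 (Nx (Br 4918 (Nx (Br 4833 (Nx (Br 4163 (Nx (Br 4996 (Nx (Br 4905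
(Nx (Br 4213 (Nx (Br 4840 (Nx (Leaf [] 8) Dn)) Dn)) Dn)) Dn)) (Sx [36886,40276,39764] 2 Dn))) Dn))
Dn)) (Nx (Br 4685 (Nx (Br 4626 Dn) Dn)) Dn))) (Nx (Br 4774 (Nx (Br 4212 (Nx (Br 4109 Dn) Dn)) Dn))
Dn))) Dn))) Dn)))))) (Nx (Rec (Br 4704 (Sx [33371,39977,37644,40021] 3 (Sx
[33371,39977,38048,37289] 3 (Nx (Br 5009 (Nx (Br 4690 (Nx (Br 5008 (Nx (Br 4802 (Sx
[39069,38021,37973] 3 (Nx (Br 4640 (Nx (Br 5027 (Sx [37577,37680] 1 Dn)) (Nx (Br 4749 (Sx
[37963,33541,37989] 3 Dn)) (Sx [38677] 2 Dn)))) Dn))) (Sx [38541,36933] 3 Dn))) (Sx [33473,38038]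
3 (Sx [33473,39250] 3 Dn)))) (Sx [33371] 2 (Nx (Br 4186 (Nx (Br 4996 (Sx [38048,39529] 1 Dn)) (Nx
(Br 4829 (Nx (Br 4958 Dn) (Nx (Br 4832 (Nx (Br 4896 (Sx [39505,38102,38802] 3 (Sx
[36870,39570,38673] 3 Dn))) Dn)) Dn))) (Sx [38677] 2 Dn)))) (Nx (Br 4686 (Sx [37973,37653] 3 (Nx
(Br 4788 (Nx (Br 4625 (Nx (Br 4213 (Nx (Br 4763 (Nx (Br 4685 Dn) Dn)) (Nx (Br 5016 (Nx (Br 4905
Dn) Dn)) (Nx (Br 4188 (Sx [39966,39131,39304,38691] 3 Dn)) (Nx (Br 4966 (Sx
[32777,38645,39205,39733] 3 Dn)) Dn))))) Dn)) (Sx [36899,37781] 2 (Sx [39966,38668] 1 Dn)))) Dn)))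
(Nx (Br 4172 (Nx (Br 5030 (Nx (Br 4997 (Nx (Br 4642 (Sx [33371,39125] 1 Dn)) Dn)) Dn)) (Sx
[36899,38677] 2 (Nx (Br 4652 (Sx [37781] 1 Dn)) Dn)))) Dn)))))) (Sx [33371,39977] 3 Dn)))))) (Nx
(Rec (Br 4756 (Sx [33362] 2 (Sx [38645] 2 (Nx (Br 4708 (Sx [33605,39698,37781] 4 (Sx
[33362,39205] 2 (Sx [33362,39469] 4 Dn)))) (Nx (Br 4724 (Nx (Br 4192 (Sx [39701,37717] 4 Dn)) (Sx
[36899,38677] 3 (Nx (Br 4885 (Sx [33371,40021] 2 Dn)) Dn)))) Dn)))))) (Nx (Rec (Br 4953 (Sx
[36870,38294,40082] 5 (Nx (Br 4897 (Nx (Br 4848 (Sx [36899] 4 (Sx [39185] 3 Dn))) (Sx [36899] 2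
(Sx [36885] 2 (Nx (Br 4829 (Nx (Br 4874 Dn) (Nx (Br 4649 (Sx [36899,37045,38413] 2 Dn)) Dn))) (Nx
(Br 4610 (Sx [40201,33498] 4 (Sx [39125] 3 Dn))) Dn)))))) (Sx [40201,37915] 5 Dn))))) (Nx (Rec
(Br 5009 (Sx [33371,38645] 3 (Sx [33371] 5 (Nx (Br 5029 (Sx [33362,36885] 2 (Nx (Br 4962 (Sx
[39185] 3 (Nx (Br 4846 (Nx (Br 4872 (Sx [40021] 2 Dn)) Dn)) Dn))) (Sx [36899,39125] 3 Dn)))) (Sx
[36899,33664] 3 (Nx (Br 4182 (Nx (Br 4209 (Sx [36899,36885] 3 (Nx (Br 4872 (Nx (Br 5029 (Sx
[39185,39125] 4 Dn)) (Nx (Br 4688 (Nx (Br 4846 (Sx [39510,33536,33410] 6 Dn)) Dn)) (Nx (Br 4888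
(Nx (Br 4771 (Nx (Br 4765 (Nx (Br 4700 (Nx (Br 4838 (Nx (Br 4786 (Nx (Br 4170 (Sx [39253,37973] 4
(Nx (Br 5002 (Sx [36899,38645,37781] 2 Dn)) (Sx [36899,37781] 2 Dn)))) Dn)) Dn)) Dn)) Dn)) Dn))
Dn)) (Nx (Br 4745 (Sx [39125] 4 Dn)) Dn))))) Dn))) (Sx [40021] 5 (Sx [39185,39125] 3 Dn))))
Dn))))))) (Sx [39185,36885] 2 (Sx [39185,36885] 5 (Sx [39185,36885] 1 (Sx [39185,36885] 3 (Nx (Br
5038 (Sx [39185,33664] 2 (Sx [39125] 2 (Nx (Br 4610 (Nx (Br 4883 (Sx [39989,38021] 4 (Nx (Br 4741
(Sx [38645,38597] 5 (Sx [33371,37781] 3 Dn))) (Sx [37301,38021] 3 (Sx [37301,39781] 3 (Nx (Br 4789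
(Sx [37301,36899,37460] 3 (Sx [37301,33371,38035] 3 (Nx (Br 4882 (Nx (Br 4672 (Sx [36899,37269] 7
Dn)) (Nx (Br 4912 (Nx (Br 4820 (Sx [39125] 1 Dn)) Dn)) (Sx [36899,39125] 4 Dn)))) Dn)))) Dn))))))
(Nx (Br 4633 (Nx (Br 4702 (Nx (Br 4658 (Sx [39989,33392] 6 Dn)) (Sx [39185,39125] 4 Dn))) (Sx
[33371,38677] 5 (Nx (Br 4690 (Nx (Br 4620 (Nx (Br 4748 (Nx (Br 5044 (Sx [37301,33392] 4 Dn)) Dn))
Dn)) Dn)) Dn)))) (Sx [40021] 5 (Sx [39125] 5 (Nx (Br 4690 (Nx (Br 4811 (Nx (Br 4736 (Nx (Br 4712
(Sx [40021] 6 Dn)) Dn)) (Sx [38645,37781] 5 Dn))) (Nx (Br 4169 (Nx (Br 4853 (Nx (Br 4718 (Sx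
[36899,40021] 6 Dn)) Dn)) Dn)) (Sx [39185,40021] 5 Dn)))) Dn)))))) Dn)))) (Sx [39185,36885] 4
Dn))))))))))))) (Sx [39125,33664] 7 (Sx [33664,39125] 7 (Sx [39125,36885] 7 (Sx [37781,39125] 7
(Sx [39125,38677] 7 Dn))))))))) (Nx (Rec (Br 4902 (Nx (Rec (Br 5004 (Nx (Br 4182 (Sx
[38421,33344] 1 (Nx (Br 5001 (Sx [33606,38614] 1 (Sx [33666,38736] 1 Dn))) (Nx (Br 4773 (Sx
[33606,38293] 1 (Sx [39957] 1 Dn))) (Nx (Br 4906 (Nx (Br 4912 (Nx (Br 4198 Dn) (Sx
[33644,33635,39507] 1 Dn))) (Nx (Br 4843 (Sx [33666,39057] 1 Dn)) (Sx [39717,36899,37524] 1 Dn))))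
(Nx (Br 4747 (Sx [33666,39440] 1 (Sx [38549] 1 Dn))) (Sx [36899,37717] 1 (Sx [37797,37197] 1 (Sx
[33644,33635,40337] 1 Dn))))))))) (Sx [38741] 1 (Nx (Rec (Br 4649 (Sx [32777,37797,38021] 1 (Sx
[39659,38316,39156] 1 (Nx (Br 4737 (Sx [37973] 1 (Nx (Br 4662 (Sx [37797,38597] 1 (Nx (Br 4190 (Nx
(Br 4657 (Nx (Br 4187 (Sx [37712,33668] 1 (Sx [38995,37010] 1 Dn))) Dn)) Dn)) Dn))) Dn))) Dn)))))
(Nx (Br 4974 (Sx [33666,38291] 2 (Sx [40109,37813] 2 (Sx [40209,39828] 2 Dn)))) (Nx (Br 4182 (Sx
[33666] 1 (Sx [39445,39701] 2 (Nx (Br 4851 (Sx [36899] 1 (Sx [32777,37013] 2 Dn))) Dn))))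
Dn))))))) (Sx [32777] 1 (Sx [37525,39189] 1 (Sx [39445,33472] 1 (Sx [37269,40149] 1 (Sx
[40149,39189] 1 (Nx (Br 4176 (Nx (Rec (Br 4882 (Nx (Br 4692 (Nx (Br 4634 (Sx [37603,39301,40310]
3 (Nx (Br 4701 (Sx [37485,38101] 3 (Nx (Br 4625 (Nx (Br 4821 (Nx (Br 4616 (Nx (Br 5021 (Nx (Br
4651 (Nx (Br 4877 (Nx (Br 4760 (Nx (Br 4717 (Nx (Leaf [] 9) Dn)) Dn)) Dn)) (Nx (Br 4677 (Nx (Br
5037 (Nx (Leaf [39189] 9) Dn)) Dn)) Dn))) Dn)) Dn)) Dn)) Dn)) Dn))) (Sx [39659,37529,39046] 3 (Nx
(Br 4878 (Nx (Br 4933 (Nx (Br 4714 (Nx (Br 4769 (Nx (Br 4937 (Nx (Br 4801 (Nx (Br 4617 (Nx (Br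
5037 (Nx (Leaf [39189,37525] 9) Dn)) Dn)) (Nx (Br 4641 (Nx (Br 4643 (Nx (Leaf [37525] 9) Dn)) Dn))
Dn))) Dn)) Dn)) Dn)) Dn)) (Sx [38225] 3 Dn))) (Sx [39857,33541,38133] 3 (Nx (Br 4994 (Nx (Br 4619
(Nx (Br 4841 (Nx (Br 4186 (Nx (Br 5038 (Sx [40350,40085] 3 Dn)) Dn)) Dn)) (Nx (Br 4836 (Nx (Br
4950 (Nx (Br 4928 (Nx (Br 4657 (Nx (Br 4652 (Nx (Br 5008 (Nx (Leaf [37525,39189] 9) Dn)) Dn)) (Nx
(Br 4626 (Nx (Br 4635 (Nx (Leaf [37973] 9) Dn)) Dn)) Dn))) Dn)) Dn)) Dn)) Dn))) Dn)) Dn)))))))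
Dn)) (Sx [38259,33667] 3 (Nx (Br 4978 (Nx (Br 4845 (Nx (Br 4172 (Nx (Br 5004 (Sx
[38726,39489,40200] 3 Dn)) (Nx (Br 4109 (Nx (Br 4162 (Nx (Br 5021 (Nx (Br 4710 (Nx (Br 4744 (Nx
(Leaf [] 10) Dn)) Dn)) Dn)) Dn)) Dn)) Dn))) (Nx (Br 4756 (Nx (Br 4724 (Sx [36889,37722,40044] 3
Dn)) (Nx (Br 4812 (Nx (Br 4891 (Nx (Br 4870 (Nx (Br 4737 (Nx (Br 4968 (Nx (Br 4977 (Nx (Br 4658
(Nx (Leaf [37585] 10) Dn)) Dn)) Dn)) Dn)) Dn)) Dn)) Dn)) Dn))) (Nx (Br 4977 (Sx
[38294,37266,39254] 1 (Nx (Br 4869 (Nx (Br 4691 (Nx (Br 4187 (Nx (Br 4997 (Nx (Br 4678 (Nx (Leaf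
[] 11) Dn)) Dn)) Dn)) Dn)) Dn)) Dn))) (Nx (Br 4997 (Nx (Br 4177 (Nx (Br 4110 (Nx (Br 4853 (Nx (Br
4846 (Nx (Leaf [36872] 10) Dn)) Dn)) Dn)) Dn)) (Nx (Br 4835 (Nx (Br 4181 (Sx [36889,40337,37530] 3
Dn)) Dn)) Dn))) (Nx (Br 4835 (Sx [39249,38612] 1 (Nx (Br 4747 (Nx (Br 4979 (Nx (Br 4912 (Nx (Br
4808 (Nx (Br 4723 (Nx (Br 4714 (Nx (Leaf [38741] 11) Dn)) Dn)) Dn)) Dn)) Dn)) Dn)) Dn))) (Nx (Br
4883 (Sx [38285,38701] 1 (Nx (Br 4710 (Nx (Br 4709 (Nx (Br 4165 (Nx (Br 4190 (Nx (Br 4893 (Nx (Br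
5025 (Nx (Leaf [39494] 10) Dn)) Dn)) Dn)) Dn)) (Nx (Br 4718 (Nx (Br 4873 (Nx (Br 4726 (Nx (Br 4808
(Nx (Leaf [38545] 10) Dn)) Dn)) Dn)) Dn)) (Nx (Br 4953 (Nx (Br 4214 (Nx (Br 5041 (Nx (Br 5006 (Nx
(Br 4641 (Nx (Br 4841 (Nx (Br 4808 (Nx (Leaf [33472] 11) (Sx [40099,37813] 3 Dn))) Dn)) Dn)) Dn))
(Nx (Br 4190 (Nx (Br 4659 (Nx (Br 4764 (Nx (Br 4640 (Sx [38053,39581] 1 (Nx (Leaf [38741,33472]
11) Dn))) Dn)) Dn)) Dn)) (Nx (Br 4764 (Nx (Br 4841 (Nx (Br 4854 (Nx (Br 4762 (Sx [39621,39437] 3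
(Nx (Leaf [] 12) Dn))) Dn)) Dn)) Dn)) Dn)))) Dn)) (Nx (Br 4789 (Nx (Br 5004 (Nx (Br 4940 (Nx (Br
4872 (Nx (Br 4781 (Nx (Br 4672 (Nx (Leaf [38289] 10) Dn)) Dn)) Dn)) Dn)) Dn)) Dn)) (Nx (Br 5025
(Nx (Br 4745 (Nx (Br 5026 (Nx (Br 4744 (Nx (Leaf [33472] 10) Dn)) Dn)) Dn)) Dn)) Dn)))) (Nx (Br
4768 (Nx (Br 4864 (Nx (Br 4180 (Nx (Br 4622 (Nx (Br 4181 (Nx (Leaf [38581] 10) Dn)) Dn)) Dn)) Dn))
Dn)) (Nx (Br 5045 (Nx (Br 4620 (Nx (Br 4724 (Nx (Br 5030 (Nx (Leaf [36917] 10) Dn)) Dn)) Dn)) Dn))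
Dn)))))) Dn)) Dn))) Dn))))))) Dn)) Dn))))) (Sx [37269] 1 (Nx (Rec (Br 4612 (Sx [39445] 1 (Sx
[37909,39957] 1 (Nx (Br 4876 (Nx (Br 4726 (Nx (Br 4166 (Nx (Br 4786 (Nx (Br 4917 (Nx (Br 4638 (Nx
(Br 4865 (Nx (Br 4180 (Nx (Br 4169 (Nx (Br 4825 (Nx (Br 4173 (Nx (Leaf [] 13) Dn)) Dn)) Dn)) (Nx
(Br 4723 (Nx (Br 4649 (Nx (Br 4825 (Nx (Leaf [] 14) Dn)) Dn)) Dn)) Dn))) Dn)) Dn)) (Nx (Br 4877
(Nx (Br 4627 (Nx (Br 4941 (Nx (Br 4641 (Nx (Br 4938 (Nx (Leaf [32777] 13) Dn)) Dn)) Dn)) (Nx (Br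
4960 (Nx (Br 5034 (Nx (Leaf [36872] 13) Dn)) Dn)) Dn))) Dn)) Dn))) Dn)) Dn)) (Nx (Br 4812 (Nx (Br
5010 (Nx (Br 4804 (Nx (Br 5014 (Nx (Br 4976 (Nx (Br 4644 (Nx (Br 5022 (Nx (Leaf [32777,40277] 13)
Dn)) Dn)) Dn)) Dn)) Dn)) (Nx (Br 4789 (Nx (Br 4169 (Nx (Br 4753 (Nx (Br 4881 (Nx (Leaf
[32777,36949] 13) Dn)) Dn)) Dn)) Dn)) Dn))) (Nx (Br 4906 Dn) Dn))) (Nx (Br 4818 (Nx (Br 4982 (Nx
(Br 4677 (Nx (Br 4953 (Nx (Br 4957 (Nx (Br 4701 (Nx (Br 4712 (Nx (Br 5037 (Nx (Br 4898 (Nx (Leaf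
[32777,33472] 13) Dn)) Dn)) Dn)) Dn)) Dn)) (Nx (Br 5022 (Nx (Br 4826 (Nx (Br 4782 (Nx (Br 4699 (Nx
(Br 4778 (Nx (Leaf [36917,40277] 13) Dn)) Dn)) Dn)) Dn)) Dn)) Dn))) Dn)) Dn)) (Nx (Br 5011 (Nx (Br
4900 (Nx (Br 4877 (Nx (Br 4864 (Nx (Br 4952 (Nx (Br 4648 (Nx (Br 4717 (Nx (Leaf [36899] 13) Dn))
Dn)) Dn)) Dn)) (Nx (Br 4977 (Nx (Br 4185 (Nx (Br 4872 (Nx (Br 4825 (Nx (Leaf [36949] 13) Dn)) Dn))
Dn)) Dn)) Dn))) Dn)) Dn)) Dn))) (Nx (Br 4835 (Nx (Br 4913 (Nx (Br 4716 (Nx (Br 5028 (Nx (Br 4709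
(Nx (Br 4845 (Nx (Br 4790 (Nx (Br 4172 (Nx (Leaf [33472] 14) Dn)) Dn)) (Nx (Br 4723 (Nx (Br 4801
(Nx (Leaf [33472] 13) Dn)) Dn)) Dn))) Dn)) Dn)) (Nx (Br 4749 (Nx (Br 5013 (Nx (Br 4650 (Nx (Br
4809 (Nx (Leaf [38613] 13) Dn)) Dn)) (Nx (Br 4801 (Nx (Br 4789 (Nx (Leaf [40277] 13) Dn)) Dn))
Dn))) Dn)) Dn))) Dn)) Dn)) (Nx (Br 4962 (Nx (Br 4771 (Nx (Br 4177 (Nx (Br 4872 (Nx (Br 4169 (Nx
(Br 4180 (Nx (Leaf [37653] 13) Dn)) Dn)) (Nx (Br 4644 (Nx (Br 4966 (Nx (Leaf [33558,37585] 13)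
Dn)) Dn)) Dn))) Dn)) (Nx (Br 4853 (Nx (Br 4193 (Nx (Br 4870 (Nx (Br 4681 (Nx (Br 4845 (Nx (Leaf
[32777,37653] 13) Dn)) Dn)) Dn)) (Nx (Br 4942 (Nx (Br 4849 (Nx (Leaf [36917] 13) Dn)) Dn)) Dn)))
Dn)) Dn))) (Sx [38638,38488,40147] 2 Dn))) (Nx (Br 4110 (Nx (Br 4900 (Nx (Br 4884 (Nx (Br 4714 (Nx
(Br 4962 (Nx (Leaf [36917,33472] 13) Dn)) Dn)) Dn)) Dn)) (Nx (Br 4854 (Nx (Br 4770 (Nx (Br 5020
(Nx (Br 4693 (Nx (Leaf [36917,37653] 13) Dn)) Dn)) Dn)) Dn)) Dn))) Dn))))))) Dn)) Dn))))) (Nx (Br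
4692 (Sx [39189] 2 (Sx [39445] 1 (Sx [38421,37781] 1 Dn)))) (Sx [37269] 1 Dn)))))) Dn))))))))) (Sx
[39701,39061] 6 (Sx [33344] 1 (Sx [38805] 6 (Sx [33344] 6 (Sx [39509] 6 (Sx [37077] 6 (Sx [40085]
1 (Sx [37973,38293] 6 (Sx [38293,38037] 6 (Sx [38933] 1 (Sx [38805] 1 (Sx [37013,33600] 6 (Sx
[40085] 6 (Sx [37653] 6 (Sx [39509] 1 (Sx [37397,39829] 6 (Sx [37077] 1 (Sx [39637,38549] 6 (Sx
[38933] 6 Dn))))))))))))))))))))))) (Nx (Rec (Br 4696 (Sx [36944] 1 (Nx (Rec (Br 4746 (Nx (Br
4918 (Nx (Rec (Br 5040 (Sx [32858,37723] 1 (Sx [32858,39556] 1 (Nx (Br 4882 (Sx [40272] 1 Dn))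
(Sx [33558,40131] 1 Dn)))))) (Sx [37142] 2 (Sx [37458] 2 (Nx (Rec (Br 4892 (Sx [39050,40082] 2
(Nx (Br 4808 (Sx [32858,40206] 2 (Sx [32858,39628] 2 (Nx (Br 5043 (Nx (Br 4952 (Sx [37908] 2 (Sx
[38228] 2 (Sx [33524,40102] 2 Dn)))) Dn)) Dn)))) (Sx [33524,38272] 2 Dn))))) (Sx [32858,40358] 3
(Sx [39316] 3 (Sx [33524,39533] 3 (Sx [33524,36976] 3 (Sx [33524,39282] 3 (Sx [33558,39632] 3 (Sx
[39632] 3 Dn)))))))))))) (Nx (Br 4982 (Sx [36886] 3 (Sx [37043,37595] 3 (Sx [32858,37699] 3 (Sx
[32858,37941] 3 (Sx [39626,33313,37740] 2 (Sx [32858,39050,39250,40278] 1 (Sx [39312] 3 (Sx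
[33524,38408] 3 (Sx [37906] 3 (Sx [39312,33347] 3 (Sx [33524,37595] 3 Dn)))))))))))) (Nx (Br 4661
(Nx (Rec (Br 4214 (Sx [33690,36896] 3 (Sx [33690,39717] 3 (Nx (Br 4930 (Sx [38564,38916] 3 (Sx
[33524,37645] 3 Dn))) (Sx [32858,40206] 3 Dn)))))) (Sx [32858,37699] 4 (Nx (Rec (Br 5002 (Sx
[33524,37744] 4 (Nx (Br 4109 (Sx [33349] 4 (Sx [39257,40156] 4 (Sx [39257,37729] 4 Dn)))) (Sx
[33524,40171] 4 Dn))))) (Sx [32858,40182] 5 (Nx (Rec (Br 4680 (Sx [39637,38484] 2 (Sx
[37977,39137] 5 (Sx [39844,33428] 5 (Sx [32858,40366] 5 Dn)))))) Dn)))))) (Nx (Br 4888 (Sx [37910]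
6 (Sx [38738] 6 (Sx [33524,37941] 6 (Sx [33524,38309] 6 (Sx [40020] 6 (Sx [38102] 6 (Sx
[32858,38149] 6 (Sx [32858,37941] 6 (Sx [39441] 6 (Sx [39257,39347,40022] 4 (Sx [38933,40022] 5
Dn)))))))))))) (Nx (Br 4814 (Sx [33524,39018] 6 (Sx [38933,37779] 1 (Sx [38933,37779] 2 (Sx
[38933,37779] 3 (Sx [33524,37595] 6 Dn)))))) (Nx (Br 4625 (Sx [38034,38546] 6 (Sx
[33524,39961,37941,38309] 3 (Sx [39827] 6 (Sx [33524,39961,33642,38832] 2 (Sx
[39145,38921,37809,37675] 1 Dn)))))) (Nx (Br 4641 (Sx [39763,38739] 6 (Sx [32858,37723] 6 (Sx
[38161] 6 (Sx [38673] 6 (Sx [40326,39108] 6 (Sx [40326,38681,40030,38688] 4 (Sx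
[33524,40340,39057,39122] 5 (Sx [39697] 6 (Sx [40326,33697] 6 (Sx [32858,38408] 6 (Nx (Br 4942 (Sx
[32858,37387] 6 (Sx [32858,39668] 6 (Sx [40326,33665] 6 (Nx (Br 5038 (Sx [39764,39830] 6 (Sx
[33524,38125] 6 (Sx [33524,37076,38549] 5 Dn)))) Dn))))) Dn)))))))))))) Dn))))))))) (Nx (Rec (Br
4852 (Nx (Br 4745 (Sx [33389,38209] 7 (Sx [40272,33474] 7 (Sx [33524,38125] 7 (Sx [38548] 7 (Nx
(Br 4896 (Sx [39441] 7 (Nx (Br 4187 (Sx [39446,37264] 7 (Sx [38673] 7 (Sx [37275,38913] 7 (Sx
[33524,37969] 1 (Sx [33389,37723] 7 (Nx (Br 5006 (Sx [33350] 7 (Nx (Br 4969 (Nx (Br 4609 (Nx (Br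
4946 (Sx [39221,38809] 7 (Sx [39776,38466] 7 (Sx [38480] 7 (Sx [32867,39534] 7 (Sx [33524,40210] 1
Dn)))))) Dn)) Dn)) Dn))) Dn))))))) (Sx [33389,39067] 7 Dn)))) (Sx [33524,38499] 7 (Sx
[33524,37744] 7 (Sx [38289] 7 (Sx [33389,38976] 7 (Sx [38992] 1 (Sx [37275,40236] 1 (Sx [40339] 7
Dn))))))))))))) (Nx (Rec (Br 4813 (Sx [33488,33550] 7 (Nx (Br 4812 (Sx [33476] 7 (Sx
[32867,38029] 7 (Sx [37206] 1 (Sx [37268] 7 (Sx [33524,37061] 7 (Sx [40144] 7 (Sx [39598,38744] 7
(Sx [39190] 7 Dn))))))))) (Sx [33488,39024] 7 (Nx (Br 4628 (Sx [39257,39840] 7 (Sx [33524,39706] 7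
(Sx [37076] 1 (Sx [37130,38634] 7 Dn))))) (Sx [33477,39697] 1 Dn))))))) (Sx [36946,33413] 1 (Sx
[36946,39057] 1 (Sx [36946,39702] 1 (Sx [39057,39702] 1 (Sx [37584,33413] 1 Dn))))))))) (Sx
[33414] 9 (Sx [39507,33348] 1 (Sx [39760,39252] 3 (Sx [38420] 9 (Sx [37584,36946] 3 (Sx
[33478,39187] 1 (Sx [33536,37461] 1 (Nx (Br 4746 (Sx [39050,33675] 3 (Sx [33524] 3 (Nx (Br 4745
(Sx [33524,38153] 9 (Sx [33524,36957] 9 (Sx [33541] 9 (Sx [33524,39786] 9 (Sx [37398] 9 (Sx
[33524,38125] 9 (Sx [38548] 9 (Sx [40202,33420] 9 (Sx [33524,38499] 9 (Sx [33524,37744] 9 (Sx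
[38289] 9 (Sx [36882] 9 (Sx [40202,39753] 9 (Sx [40214] 9 (Nx (Br 4643 (Sx [33524,40329] 9 (Sx
[39699] 9 (Sx [39442,38418] 9 (Sx [39257,38129] 9 (Sx [37651] 9 (Sx [33524,39472] 9 (Sx [38163] 9
(Sx [33524,39282] 9 (Sx [40202,40245] 9 (Sx [37913,38034] 9 Dn))))))))))) (Sx [38482] 9 (Sx
[40339] 9 Dn)))))))))))))))))) (Sx [39257] 3 (Sx [33524,38934,39507] 3 (Sx [39961] 3 (Sx
[33524,37969,38294] 3 Dn)))))))) (Sx [40337] 9 (Sx [37076,38802] 1 (Sx [40275,39252] 3 (Sx [39059]
9 (Sx [39252,40275] 3 (Sx [40210,38992] 1 (Sx [37590] 9 (Sx [37396,40210] 1 (Sx [39702,37584] 3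
(Sx [39698] 9 Dn))))))))))))))))))))))) (Sx [33540] 1 (Sx [39635] 1 (Sx [39764,37715] 1 (Sx
[38737,37206] 10 (Sx [39952] 10 (Nx (Rec (Br 4696 (Sx [33461,37979] 10 (Sx [36944] 10 (Sx [33603]
1 (Sx [33414] 10 (Sx [33461,32876] 10 (Sx [40211] 1 (Sx [38420] 10 (Sx [37394] 1 (Sx [33461,37934]
10 (Sx [33461,38274] 10 (Sx [37014] 1 (Sx [40337] 10 (Sx [38996] 1 (Sx [39059] 10 (Sx
[33461,38024] 10 (Sx [39824] 1 (Sx [33461,38132] 10 (Sx [37590] 10 (Sx [38609] 1 (Sx [39698] 10
(Sx [33461,38177] 10 Dn))))))))))))))))))))))) (Sx [33540] 1 (Sx [33540] 11 (Sx [39318] 1 (Sx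
[37140] 11 (Sx [37457] 11 (Sx [38546] 1 (Sx [39312,39633] 11 (Sx [38486,33473] 2 (Sx [39318] 2 (Sx
[38546] 2 (Sx [38102,37908] 2 (Sx [33667,38673] 11 (Sx [38995,40209] 2 (Sx [39572,33666] 11 (Sx
[39318] 11 (Sx [37140] 1 (Sx [39952] 1 (Sx [39635] 11 (Sx [38418,33412] 11 (Sx [37781,40021] 2 (Sx
[39952] 2 (Sx [37140] 2 (Sx [39504,40083] 2 (Sx [33411,39060] 11 (Sx [38546] 11 (Sx [37457] 1 (Sx
[37457] 2 Dn))))))))))))))))))))))))))))))))))))) (Sx [37122] 1 (Sx [36933] 1 (Sx [37185] 1 (Sx
[36996] 1 (Sx [37248] 1 (Sx [37059] 1 (Sx [33290] 1 (Sx [33416] 1 (Sx [33549] 1 (Sx [33675] 1 (Sx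
[33353] 1 (Sx [33486] 1 (Sx [33612] 1 (Sx [38429] 1 (Sx [38744] 1 (Sx [38618] 1 (Sx [38492] 1 (Sx
[38814] 1 (Sx [38681] 1 (Sx [38555] 1 (Sx [39988] 1 (Sx [40051] 1 (Sx [40114] 1 (Sx [40177] 1 (Sx
[40240] 1 (Sx [40310] 1 (Sx [40373] 1 (Sx [38944] 1 (Sx [39203] 1 (Sx [39014] 1 (Sx [39266] 1 (Sx
[39077] 1 (Sx [39329] 1 (Sx [39140] 1 (Sx [37385] 1 (Sx [37518] 1 (Sx [37644] 1 (Sx [37770] 1 (Sx
[37448] 1 (Sx [37581] 1 (Sx [37707] 1 (Sx [39466] 1 (Sx [39851] 1 (Sx [39788] 1 (Sx [39725] 1 (Sx
[39662] 1 (Sx [39592] 1 (Sx [39529] 1 Dn))))))))))))))))))))))))))))))))))))))))))))))))))"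

context
  assumes zero: "(7 :: 'a::field) = 0"
begin

text \<open>The range ends at 36 = 6 * 6, the largest value before reduction in the two tables
  below.\<close>

lemma numerals7:
  "(7 :: 'a) = 0" "(8 :: 'a) = 1" "(9 :: 'a) = 2" "(10 :: 'a) = 3" "(11 :: 'a) = 4"
  "(12 :: 'a) = 5" "(13 :: 'a) = 6" "(14 :: 'a) = 0" "(15 :: 'a) = 1" "(16 :: 'a) = 2"
  "(17 :: 'a) = 3" "(18 :: 'a) = 4" "(19 :: 'a) = 5" "(20 :: 'a) = 6" "(21 :: 'a) = 0"
  "(22 :: 'a) = 1" "(23 :: 'a) = 2" "(24 :: 'a) = 3" "(25 :: 'a) = 4" "(26 :: 'a) = 5"
  "(27 :: 'a) = 6" "(28 :: 'a) = 0" "(29 :: 'a) = 1" "(30 :: 'a) = 2" "(31 :: 'a) = 3"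
  "(32 :: 'a) = 4" "(33 :: 'a) = 5" "(34 :: 'a) = 6" "(35 :: 'a) = 0" "(36 :: 'a) = 1"
  by (rule trans[OF numeral_mod[of 7]], use zero in simp, simp)+

lemma add7:
  "0 + 0 = (0 :: 'a)" "0 + 1 = (1 :: 'a)" "0 + 2 = (2 :: 'a)" "0 + 3 = (3 :: 'a)"
  "0 + 4 = (4 :: 'a)" "0 + 5 = (5 :: 'a)" "0 + 6 = (6 :: 'a)" "1 + 0 = (1 :: 'a)"
  "1 + 1 = (2 :: 'a)" "1 + 2 = (3 :: 'a)" "1 + 3 = (4 :: 'a)" "1 + 4 = (5 :: 'a)"
  "1 + 5 = (6 :: 'a)" "1 + 6 = (0 :: 'a)" "2 + 0 = (2 :: 'a)" "2 + 1 = (3 :: 'a)"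
  "2 + 2 = (4 :: 'a)" "2 + 3 = (5 :: 'a)" "2 + 4 = (6 :: 'a)" "2 + 5 = (0 :: 'a)"
  "2 + 6 = (1 :: 'a)" "3 + 0 = (3 :: 'a)" "3 + 1 = (4 :: 'a)" "3 + 2 = (5 :: 'a)"
  "3 + 3 = (6 :: 'a)" "3 + 4 = (0 :: 'a)" "3 + 5 = (1 :: 'a)" "3 + 6 = (2 :: 'a)"
  "4 + 0 = (4 :: 'a)" "4 + 1 = (5 :: 'a)" "4 + 2 = (6 :: 'a)" "4 + 3 = (0 :: 'a)"
  "4 + 4 = (1 :: 'a)" "4 + 5 = (2 :: 'a)" "4 + 6 = (3 :: 'a)" "5 + 0 = (5 :: 'a)"
  "5 + 1 = (6 :: 'a)" "5 + 2 = (0 :: 'a)" "5 + 3 = (1 :: 'a)" "5 + 4 = (2 :: 'a)"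
  "5 + 5 = (3 :: 'a)" "5 + 6 = (4 :: 'a)" "6 + 0 = (6 :: 'a)" "6 + 1 = (0 :: 'a)"
  "6 + 2 = (1 :: 'a)" "6 + 3 = (2 :: 'a)" "6 + 4 = (3 :: 'a)" "6 + 5 = (4 :: 'a)"
  "6 + 6 = (5 :: 'a)"
  by (simp_all add: numerals7)

lemma mult7:
  "0 * 0 = (0 :: 'a)" "0 * 1 = (0 :: 'a)" "0 * 2 = (0 :: 'a)" "0 * 3 = (0 :: 'a)"
  "0 * 4 = (0 :: 'a)" "0 * 5 = (0 :: 'a)" "0 * 6 = (0 :: 'a)" "1 * 0 = (0 :: 'a)"
  "1 * 1 = (1 :: 'a)" "1 * 2 = (2 :: 'a)" "1 * 3 = (3 :: 'a)" "1 * 4 = (4 :: 'a)"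
  "1 * 5 = (5 :: 'a)" "1 * 6 = (6 :: 'a)" "2 * 0 = (0 :: 'a)" "2 * 1 = (2 :: 'a)"
  "2 * 2 = (4 :: 'a)" "2 * 3 = (6 :: 'a)" "2 * 4 = (1 :: 'a)" "2 * 5 = (3 :: 'a)"
  "2 * 6 = (5 :: 'a)" "3 * 0 = (0 :: 'a)" "3 * 1 = (3 :: 'a)" "3 * 2 = (6 :: 'a)"
  "3 * 3 = (2 :: 'a)" "3 * 4 = (5 :: 'a)" "3 * 5 = (1 :: 'a)" "3 * 6 = (4 :: 'a)"
  "4 * 0 = (0 :: 'a)" "4 * 1 = (4 :: 'a)" "4 * 2 = (1 :: 'a)" "4 * 3 = (5 :: 'a)"
  "4 * 4 = (2 :: 'a)" "4 * 5 = (6 :: 'a)" "4 * 6 = (3 :: 'a)" "5 * 0 = (0 :: 'a)"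
  "5 * 1 = (5 :: 'a)" "5 * 2 = (3 :: 'a)" "5 * 3 = (1 :: 'a)" "5 * 4 = (6 :: 'a)"
  "5 * 5 = (4 :: 'a)" "5 * 6 = (2 :: 'a)" "6 * 0 = (0 :: 'a)" "6 * 1 = (6 :: 'a)"
  "6 * 2 = (5 :: 'a)" "6 * 3 = (4 :: 'a)" "6 * 4 = (3 :: 'a)" "6 * 5 = (2 :: 'a)"
  "6 * 6 = (1 :: 'a)"
  by (simp_all add: numerals7)

lemma uminus7:
  "- 0 = (0 :: 'a)" "- 1 = (6 :: 'a)" "- 2 = (5 :: 'a)" "- 3 = (4 :: 'a)" "- 4 = (3 :: 'a)"
  "- 5 = (2 :: 'a)" "- 6 = (1 :: 'a)"
  by (simp_all only: neg_eq_iff_add_eq_0 add7)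

lemma inverse7:
  "inverse 0 = (0 :: 'a)" "inverse 1 = (1 :: 'a)" "inverse 2 = (4 :: 'a)"
  "inverse 3 = (5 :: 'a)" "inverse 4 = (2 :: 'a)" "inverse 5 = (3 :: 'a)"
  "inverse 6 = (6 :: 'a)"
  by (rule inverse_zero, (rule inverse_unique, simp only: mult7)+)

lemma isz7:
  "is_zero (0 :: 'a) = True" "is_zero (1 :: 'a) = False" "is_zero (2 :: 'a) = False"
  "is_zero (3 :: 'a) = False" "is_zero (4 :: 'a) = False" "is_zero (5 :: 'a) = False"
  "is_zero (6 :: 'a) = False"
  by (rule is_zero_zero, rule is_zero_unit[of _ 1], simp only: mult7, rule is_zero_unit[of _ 4], simp only: mult7, rule is_zero_unit[of _ 5], simp only: mult7, rule is_zero_unit[of _ 2], simp only: mult7, rule is_zero_unit[of _ 3], simp only: mult7, rule is_zero_unit[of _ 6], simp only: mult7)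

lemma bad7:
  "is_pm_two (0 :: 'a) = False" "is_pm_two (1 :: 'a) = False" "is_pm_two (2 :: 'a) = True"
  "is_pm_two (3 :: 'a) = False" "is_pm_two (4 :: 'a) = False" "is_pm_two (5 :: 'a) = True"
  "is_pm_two (6 :: 'a) = False"
  by (simp_all only: is_pm_two_def eq_is_zero uminus7 add7 isz7 simp_thms)

lemmas eval7 = eval_rules count_rules add7 mult7 uminus7 inverse7 isz7 bad7 eq_is_zero list.map
  trans[OF deferred_def[of reps7] reps7_def]

lemma search7: "isSome (check (reps7 :: 'a vec5 list list) [] [] (all_units [1, 2, 3] [0, 1, 2, 3, 4, 5, 6]) tree7)"
  unfolding tree7_def by (simp only: eval7)

lemma separated_reps7: "list_all separated (deferred (reps7 :: 'a vec5 list list))"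
  by (simp only: eval7 list.pred_inject)

text \<open>The lower bound: pairwise different numbers of orthogonal pairs make the fourteen sets
  inequivalent.\<close>

lemma distinct_reps7: "distinct (map orth_count (deferred (reps7 :: 'a vec5 list list)))"
  by (simp only: eval7) simp

lemma elements7: "distinct ([0, 1, 2, 3, 4, 5, 6] :: 'a list)"
  by (simp only: distinct.simps list.set insert_iff empty_iff eq_is_zero uminus7 add7 isz7 simp_thms)

lemma halves7: "x \<in> set [0, 1, 2, 3, 4, 5, 6] \<Longrightarrow> x \<noteq> 0 \<Longrightarrow> x \<in> set [1, 2, 3] \<or> - x \<in> set ([1, 2, 3] :: 'a list)"
  unfolding list.set insert_iff empty_iff
  by (elim disjE; (hypsubst)?; simp only: eq_is_zero uminus7 add7 isz7 simp_thms)

end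

lemma count7:
  fixes \<zeta> :: "('a::{field, finite} ^ 4) set \<Rightarrow> ('a ^ 4) set"
  assumes \<zeta>: "symplectic_polarity \<zeta>" and q: "CARD('a) = 7"
  shows "card (special_spreads \<zeta> // special_spread_equiv \<zeta>) = 14"
proof -
  have z: "(7 :: 'a) = 0" using of_nat_CARD[where 'a = 'a] by (simp add: q)
  have es: "x \<in> set ([0, 1, 2, 3, 4, 5, 6] :: 'a list)" for x
    by (rule set_complete[OF elements7[OF z]]) (simp add: q)
  have two: "(2 :: 'a) \<noteq> 0" using isz7(3)[OF z] by (simp add: is_zero_def)
  have len: "list_all (\<lambda>r :: 'a vec5 list. 2 * length r = CARD('a)\<^sup>2 + 1) reps7"
    by (simp add: q reps7_def)
  have "card (special_spreads \<zeta> // special_spread_equiv \<zeta>) = length (reps7 :: 'a vec5 list list)"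
    by (rule count_special_spreads[OF \<zeta> two separated_reps7[OF z] len distinct_reps7[OF z] es
      halves7[OF z es] search7[OF z]])
  then show ?thesis by (simp add: reps7_def)
qed

theorem theorem4:
  fixes \<zeta> :: "('a::{field, finite} ^ 4) set \<Rightarrow> ('a ^ 4) set"
  assumes "symplectic_polarity \<zeta>"
  shows "(CARD('a) = 3 \<longrightarrow> card (special_spreads \<zeta> // special_spread_equiv \<zeta>) = 1) \<and>
         (CARD('a) = 5 \<longrightarrow> card (special_spreads \<zeta> // special_spread_equiv \<zeta>) = 2) \<and>
         (CARD('a) = 7 \<longrightarrow> card (special_spreads \<zeta> // special_spread_equiv \<zeta>) = 14)"
  using count3[OF assms] count5[OF assms] count7[OF assms] by blast

end
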